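(* Let $G$ be a simply connected Lie group with Lie algebra $\mathfrak g$, let $U$ be a neighbourhood of $1$ in $G$ such that $\log$ is defined on $U$, and let $\mathfrak a$ be a representation of $G$. Then $I^2$ is a left inverse for $\delta^2$, in the sense that $\delta^2\circ I^2=id$ on $ZL^2(\mathfrak g,\mathfrak a^a)$.
   Context: $\log$ is the inverse of $\exp$. Write $g\rhd h=ghg^{-1}$ and $U_{2\text{-}loc}=\{(g,h)\in G\times U: g\rhd h\in U\}$. $ZL^2(\mathfrak g,\mathfrak a^a)$ (Leibniz 2-cocycles with coefficients in $\mathfrak a$ viewed as an anti-symmetric representation, i.e. with zero right action) is the set of bilinear maps $\omega:\mathfrak g\times\mathfrak g\to\mathfrak a$ with $x.\omega(y,z)-y.\omega(x,z)-\omega([x,y],z)-\omega(y,[x,z])+\omega(x,[y,z])=0$. $G$ acts on $Hom(\mathfrak g,\mathfrak a)$ by $(g.\alpha)(y)=g.\alpha(Ad_{g^{-1}}y)$. For a representation $V$ of $G$ and $\alpha\in Hom(\mathfrak g,V)$, the form $\alpha^{eq}\in\Omega^1(G,V)$ is $\alpha^{eq}(h)(m)=h.\alpha(T_hL_{h^{-1}}m)$. For $\omega\in ZL^2(\mathfrak g,\mathfrak a^a)$ put $\tau^2(\omega)(x)(y)=\omega(x,y)$, so $\tau^2(\omega)\in Hom(\mathfrak g,Hom(\mathfrak g,\mathfrak a))$, and $I(\omega)(g)=\int_{c_g}\tau^2(\omega)^{eq}\in Hom(\mathfrak g,\mathfrak a)$, where $c:G\times[0,1]\to G$ is a smooth map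 such that $c_g$ is a path from $1$ to $g$ and $c_1$ is constant (the value does not depend on $c$). With $\gamma_k(s)=\exp(s\log k)$, define for $(g,h)\in U_{2\text{-}loc}$ $$I^2(\omega)(g,h)=\int_{\gamma_{g\rhd h}}(I(\omega)(g))^{eq}\in\mathfrak a.$$ For a map $f:U_{2\text{-}loc}\to\mathfrak a$, smooth in a neighbourhood of $(1,1)$ and with $f(g,1)=f(1,h)=0$, $\delta^2(f)(x,y)=d^2f(1,1)\big((x,0),(0,y)\big)$ for $x,y\in\mathfrak g$, where $d^2f$ is the second differential. *)

theory Defs
  imports "HOL-Analysis.Analysis" "HOL-Algebra.Group"
begin

section \<open>Smooth maps between manifolds\<close>

text \<open>Only used on open sets. On a finite-dimensional space, asking for all directional
  derivatives of the Frechet derivative is the same as asking for the Frechet derivative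
  itself to be of class C^k.\<close>

primrec Ck_on :: "nat \<Rightarrow> 'e::real_normed_vector set \<Rightarrow> ('e \<Rightarrow> 'f::real_normed_vector) \<Rightarrow> bool" where
  "Ck_on 0 S f \<longleftrightarrow> continuous_on S f"
| "Ck_on (Suc k) S f \<longleftrightarrow> (\<forall>x\<in>S. f differentiable (at x)) \<and>
     (\<forall>v. Ck_on k S (\<lambda>x. frechet_derivative f (at x) v))"

definition smooth_on :: "'e::real_normed_vector set \<Rightarrow> ('e \<Rightarrow> 'f::real_normed_vector) \<Rightarrow> bool" where
  "smooth_on S f \<longleftrightarrow> (\<forall>k. Ck_on k S f)"

text \<open>A chart is a domain together with a coordinate map; the values of the coordinate map
  outside the domain are irrelevant.\<close>

type_synonym ('m, 'e) chart = "'m set \<times> ('m \<Rightarrow> 'e)"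

abbreviation chart_inv :: "('m, 'e) chart \<Rightarrow> 'e \<Rightarrow> 'm" where
  "chart_inv \<kappa> \<equiv> the_inv_into (fst \<kappa>) (snd \<kappa>)"

definition is_chart :: "('m::topological_space, 'e::real_normed_vector) chart \<Rightarrow> bool" where
  "is_chart \<kappa> \<longleftrightarrow> open (fst \<kappa>) \<and> open (snd \<kappa> ` fst \<kappa>) \<and>
     homeomorphism (fst \<kappa>) (snd \<kappa> ` fst \<kappa>) (snd \<kappa>) (chart_inv \<kappa>)"

definition smooth_atlas :: "('m::topological_space, 'e::real_normed_vector) chart set \<Rightarrow> bool" where
  "smooth_atlas A \<longleftrightarrow> (\<forall>\<kappa>\<in>A. is_chart \<kappa>) \<and> (\<Union>\<kappa>\<in>A. fst \<kappa>) = UNIV \<and>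
     (\<forall>\<kappa>\<in>A. \<forall>\<mu>\<in>A. smooth_on (snd \<kappa> ` (fst \<kappa> \<inter> fst \<mu>)) (snd \<mu> \<circ> chart_inv \<kappa>))"

definition vec_atlas :: "('e, 'e) chart set" where
  "vec_atlas = {(UNIV, id)}"

definition prod_atlas ::
  "('m, 'e) chart set \<Rightarrow> ('n, 'f) chart set \<Rightarrow> ('m \<times> 'n, 'e \<times> 'f) chart set" where
  "prod_atlas A B = {(fst \<kappa> \<times> fst \<mu>, map_prod (snd \<kappa>) (snd \<mu>)) | \<kappa> \<mu>. \<kappa> \<in> A \<and> \<mu> \<in> B}"

text \<open>Smoothness on an open set W.\<close>

definition smooth_map_open ::
  "('m::topological_space, 'e::real_normed_vector) chart set \<Rightarrow>
   ('n::topological_space, 'f::real_normed_vector) chart set \<Rightarrow> 'm set \<Rightarrow> ('m \<Rightarrow> 'n) \<Rightarrow> bool" where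
  "smooth_map_open A B W f \<longleftrightarrow> open W \<and> continuous_on W f \<and>
     (\<forall>\<kappa>\<in>A. \<forall>\<mu>\<in>B.
        smooth_on (snd \<kappa> ` {p \<in> W \<inter> fst \<kappa>. f p \<in> fst \<mu>}) (snd \<mu> \<circ> f \<circ> chart_inv \<kappa>))"

text \<open>Smoothness on an arbitrary subset S, such as {0..1} or W \<times> {0..1}: local extendability to
  smooth maps on open sets.\<close>

definition smooth_map ::
  "('m::topological_space, 'e::real_normed_vector) chart set \<Rightarrow>
   ('n::topological_space, 'f::real_normed_vector) chart set \<Rightarrow> 'm set \<Rightarrow> ('m \<Rightarrow> 'n) \<Rightarrow> bool" where
  "smooth_map A B S f \<longleftrightarrow>
     (\<forall>p\<in>S. \<exists>N F. p \<in> N \<and> smooth_map_open A B N F \<and> (\<forall>q\<in>N \<inter> S. F q = f q))"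

text \<open>The tangent space at p is identified with the model space 'e by means of a chart
  at p chosen once and for all.\<close>

definition chart_at :: "('m, 'e) chart set \<Rightarrow> 'm \<Rightarrow> ('m, 'e) chart" where
  "chart_at A p = (SOME \<kappa>. \<kappa> \<in> A \<and> p \<in> fst \<kappa>)"

definition tangent_map ::
  "('m, 'e::real_normed_vector) chart set \<Rightarrow> ('n, 'f::real_normed_vector) chart set \<Rightarrow>
   ('m \<Rightarrow> 'n) \<Rightarrow> 'm \<Rightarrow> 'e \<Rightarrow> 'f" where
  "tangent_map A B f p =
     frechet_derivative (snd (chart_at B (f p)) \<circ> f \<circ> chart_inv (chart_at A p))
       (at (snd (chart_at A p) p))"

definition velocity :: "('m, 'e::real_normed_vector) chart set \<Rightarrow> (real \<Rightarrow> 'm) \<Rightarrow> real \<Rightarrow> 'e" where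
  "velocity A \<gamma> t = vector_derivative (snd (chart_at A (\<gamma> t)) \<circ> \<gamma>) (at t within {0..1})"

definition path_integral ::
  "('m, 'e::real_normed_vector) chart set \<Rightarrow> ('m \<Rightarrow> 'e \<Rightarrow> 'v::real_normed_vector) \<Rightarrow>
   (real \<Rightarrow> 'm) \<Rightarrow> 'v" where
  "path_integral A \<theta> \<gamma> = integral {0..1} (\<lambda>t. \<theta> (\<gamma> t) (velocity A \<gamma> t))"


section \<open>Lie groups\<close>

record ('g, 'e) lie_struct = "'g monoid" +
  atlas :: "('g, 'e) chart set"

text \<open>Finite dimensionality is an assumption rather than the class euclidean_space, because
  the latter excludes dimension 0.\<close>

locale lie_group = group G
  for G :: "('g::{t2_space, second_countable_topology}, 'e::banach) lie_struct" (structure) +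
  assumes carrier_UNIV: "carrier G = UNIV"
    and atlas: "smooth_atlas (atlas G)"
    and finite_dim: "\<exists>B::'e set. finite B \<and> span B = UNIV"
    and smooth_mult: "smooth_map (prod_atlas (atlas G) (atlas G)) (atlas G) UNIV (\<lambda>(g, h). g \<otimes> h)"
    and smooth_inv: "smooth_map (atlas G) (atlas G) UNIV (\<lambda>g. inv g)"

definition conj_by :: "('g, 'e) lie_struct \<Rightarrow> 'g \<Rightarrow> 'g \<Rightarrow> 'g" where
  "conj_by G g h = g \<otimes>\<^bsub>G\<^esub> h \<otimes>\<^bsub>G\<^esub> inv\<^bsub>G\<^esub> g"

text \<open>The Lie algebra is the tangent space at the unit, i.e. the type 'e.\<close>

definition Ad :: "('g, 'e::real_normed_vector) lie_struct \<Rightarrow> 'g \<Rightarrow> 'e \<Rightarrow>\<^sub>L 'e" where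
  "Ad G g = Blinfun (tangent_map (atlas G) (atlas G) (conj_by G g) \<one>\<^bsub>G\<^esub>)"

text \<open>The left-invariant vector field with value x at the unit, in the chosen chart at the unit.\<close>

definition left_inv_field :: "('g, 'e::real_normed_vector) lie_struct \<Rightarrow> 'e \<Rightarrow> 'e \<Rightarrow> 'e" where
  "left_inv_field G x u =
     (let \<kappa> = chart_at (atlas G) \<one>\<^bsub>G\<^esub> in
      frechet_derivative (snd \<kappa> \<circ> (\<lambda>q. chart_inv \<kappa> u \<otimes>\<^bsub>G\<^esub> q) \<circ> chart_inv \<kappa>) (at (snd \<kappa> \<one>\<^bsub>G\<^esub>)) x)"

text \<open>The commutator [X,Y] = DY(X) - DX(Y) of left-invariant vector fields, at the unit.\<close>

definition lie_bracket :: "('g, 'e::real_normed_vector) lie_struct \<Rightarrow> 'e \<Rightarrow> 'e \<Rightarrow> 'e" where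
  "lie_bracket G x y =
     (let u = snd (chart_at (atlas G) \<one>\<^bsub>G\<^esub>) \<one>\<^bsub>G\<^esub> in
      frechet_derivative (left_inv_field G y) (at u) x
      - frechet_derivative (left_inv_field G x) (at u) y)"

definition one_param_subgroup ::
  "('g::topological_space, 'e::real_normed_vector) lie_struct \<Rightarrow> 'e \<Rightarrow> (real \<Rightarrow> 'g) \<Rightarrow> bool" where
  "one_param_subgroup G x \<gamma> \<longleftrightarrow>
     smooth_map vec_atlas (atlas G) UNIV \<gamma> \<and> (\<forall>s t. \<gamma> (s + t) = \<gamma> s \<otimes>\<^bsub>G\<^esub> \<gamma> t) \<and>
     tangent_map vec_atlas (atlas G) \<gamma> 0 1 = x"

definition lie_exp ::
  "('g::topological_space, 'e::real_normed_vector) lie_struct \<Rightarrow> 'e \<Rightarrow> 'g" where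
  "lie_exp G x = (THE \<gamma>. one_param_subgroup G x \<gamma>) 1"

text \<open>The branch of log attached to V is the inverse of exp restricted to V; it is defined on
  exp(V) when exp restricts to a diffeomorphism from V onto the open set exp(V).\<close>

definition lie_log ::
  "('g::topological_space, 'e::real_normed_vector) lie_struct \<Rightarrow> 'e set \<Rightarrow> 'g \<Rightarrow> 'e" where
  "lie_log G V = the_inv_into V (lie_exp G)"

definition log_branch ::
  "('g::topological_space, 'e::real_normed_vector) lie_struct \<Rightarrow> 'e set \<Rightarrow> bool" where
  "log_branch G V \<longleftrightarrow> open V \<and> 0 \<in> V \<and> inj_on (lie_exp G) V \<and> open (lie_exp G ` V) \<and>
     smooth_map vec_atlas (atlas G) V (lie_exp G) \<and>
     smooth_map (atlas G) vec_atlas (lie_exp G ` V) (lie_log G V)"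

definition exp_path ::
  "('g::topological_space, 'e::real_normed_vector) lie_struct \<Rightarrow> 'e set \<Rightarrow> 'g \<Rightarrow> real \<Rightarrow> 'g" where
  "exp_path G V k s = lie_exp G (s *\<^sub>R lie_log G V k)"


section \<open>Representations and Leibniz 2-cocycles\<close>

definition lie_rep ::
  "('g::topological_space, 'e::real_normed_vector) lie_struct \<Rightarrow>
   ('g \<Rightarrow> 'a::banach \<Rightarrow>\<^sub>L 'a) \<Rightarrow> bool" where
  "lie_rep G \<rho> \<longleftrightarrow> (\<exists>B::'a set. finite B \<and> span B = UNIV) \<and>
     \<rho> \<one>\<^bsub>G\<^esub> = id_blinfun \<and> (\<forall>g h. \<rho> (g \<otimes>\<^bsub>G\<^esub> h) = \<rho> g o\<^sub>L \<rho> h) \<and>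
     smooth_map (prod_atlas (atlas G) vec_atlas) vec_atlas UNIV (\<lambda>(g, a). blinfun_apply (\<rho> g) a)"

definition lie_alg_act ::
  "('g, 'e::real_normed_vector) lie_struct \<Rightarrow> ('g \<Rightarrow> 'a::real_normed_vector \<Rightarrow>\<^sub>L 'a) \<Rightarrow>
   'e \<Rightarrow> 'a \<Rightarrow> 'a" where
  "lie_alg_act G \<rho> x a = tangent_map (atlas G) vec_atlas (\<lambda>g. blinfun_apply (\<rho> g) a) \<one>\<^bsub>G\<^esub> x"

definition ZL2 ::
  "('g, 'e::real_normed_vector) lie_struct \<Rightarrow> ('g \<Rightarrow> 'a::real_normed_vector \<Rightarrow>\<^sub>L 'a) \<Rightarrow>
   ('e \<Rightarrow> 'e \<Rightarrow> 'a) set" where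
  "ZL2 G \<rho> = {\<omega>. bilinear \<omega> \<and>
     (\<forall>x y z. lie_alg_act G \<rho> x (\<omega> y z) - lie_alg_act G \<rho> y (\<omega> x z)
        - \<omega> (lie_bracket G x y) z - \<omega> y (lie_bracket G x z) + \<omega> x (lie_bracket G y z) = 0)}"

definition hom_act ::
  "('g, 'e::real_normed_vector) lie_struct \<Rightarrow> ('g \<Rightarrow> 'a::real_normed_vector \<Rightarrow>\<^sub>L 'a) \<Rightarrow>
   'g \<Rightarrow> ('e \<Rightarrow>\<^sub>L 'a) \<Rightarrow> ('e \<Rightarrow>\<^sub>L 'a)" where
  "hom_act G \<rho> g \<alpha> = \<rho> g o\<^sub>L \<alpha> o\<^sub>L Ad G (inv\<^bsub>G\<^esub> g)"

definition equiv_form ::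
  "('g, 'e::real_normed_vector) lie_struct \<Rightarrow> ('g \<Rightarrow> 'v \<Rightarrow> 'v) \<Rightarrow> ('e \<Rightarrow> 'v) \<Rightarrow> 'g \<Rightarrow> 'e \<Rightarrow> 'v" where
  "equiv_form G act \<alpha> h m =
     act h (\<alpha> (tangent_map (atlas G) (atlas G) (\<lambda>q. inv\<^bsub>G\<^esub> h \<otimes>\<^bsub>G\<^esub> q) h m))"

definition tau2 :: "('e::real_normed_vector \<Rightarrow> 'e \<Rightarrow> 'a::real_normed_vector) \<Rightarrow> 'e \<Rightarrow> ('e \<Rightarrow>\<^sub>L 'a)" where
  "tau2 \<omega> x = Blinfun (\<omega> x)"


section \<open>The integration map and the second differential\<close>

text \<open>A family c that is smooth on all of G \<times> {0..1} exists only if G is contractible.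
  Joint smoothness is therefore required near the unit only; this admits every globally
  smooth family and also covers non-contractible groups.\<close>

definition path_family ::
  "('g::topological_space, 'e::real_normed_vector) lie_struct \<Rightarrow> ('g \<Rightarrow> real \<Rightarrow> 'g) \<Rightarrow> bool" where
  "path_family G c \<longleftrightarrow>
     (\<forall>g. smooth_map vec_atlas (atlas G) {0..1} (c g) \<and> c g 0 = \<one>\<^bsub>G\<^esub> \<and> c g 1 = g) \<and>
     (\<forall>t\<in>{0..1}. c \<one>\<^bsub>G\<^esub> t = \<one>\<^bsub>G\<^esub>) \<and>
     (\<exists>W. open W \<and> \<one>\<^bsub>G\<^esub> \<in> W \<and>
        smooth_map (prod_atlas (atlas G) vec_atlas) (atlas G) (W \<times> {0..1}) (\<lambda>(g, t). c g t))"

definition I1 ::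
  "('g, 'e::real_normed_vector) lie_struct \<Rightarrow> ('g \<Rightarrow> 'a::banach \<Rightarrow>\<^sub>L 'a) \<Rightarrow> ('g \<Rightarrow> real \<Rightarrow> 'g) \<Rightarrow>
   ('e \<Rightarrow> 'e \<Rightarrow> 'a) \<Rightarrow> 'g \<Rightarrow> ('e \<Rightarrow>\<^sub>L 'a)" where
  "I1 G \<rho> c \<omega> g = path_integral (atlas G) (equiv_form G (hom_act G \<rho>) (tau2 \<omega>)) (c g)"

definition I2 ::
  "('g::topological_space, 'e::real_normed_vector) lie_struct \<Rightarrow> ('g \<Rightarrow> 'a::banach \<Rightarrow>\<^sub>L 'a) \<Rightarrow>
   ('g \<Rightarrow> real \<Rightarrow> 'g) \<Rightarrow> 'e set \<Rightarrow> ('e \<Rightarrow> 'e \<Rightarrow> 'a) \<Rightarrow> 'g \<times> 'g \<Rightarrow> 'a" where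
  "I2 G \<rho> c V \<omega> = (\<lambda>(g, h).
     path_integral (atlas G)
       (equiv_form G (\<lambda>k. blinfun_apply (\<rho> k)) (blinfun_apply (I1 G \<rho> c \<omega> g)))
       (exp_path G V (conj_by G g h)))"

definition U2loc :: "('g, 'e) lie_struct \<Rightarrow> 'g set \<Rightarrow> ('g \<times> 'g) set" where
  "U2loc G U = {(g, h). h \<in> U \<and> conj_by G g h \<in> U}"

text \<open>The domain of delta2; values outside U2loc are irrelevant.\<close>

definition local_cochains ::
  "('g::topological_space, 'e::real_normed_vector) lie_struct \<Rightarrow> 'g set \<Rightarrow>
   ('g \<times> 'g \<Rightarrow> 'a::real_normed_vector) set" where
  "local_cochains G U = {f.
     (\<exists>W. open W \<and> (\<one>\<^bsub>G\<^esub>, \<one>\<^bsub>G\<^esub>) \<in> W \<and> W \<subseteq> U2loc G U \<and>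
        smooth_map (prod_atlas (atlas G) (atlas G)) vec_atlas W f) \<and>
     (\<forall>g. (g, \<one>\<^bsub>G\<^esub>) \<in> U2loc G U \<longrightarrow> f (g, \<one>\<^bsub>G\<^esub>) = 0) \<and>
     (\<forall>h. (\<one>\<^bsub>G\<^esub>, h) \<in> U2loc G U \<longrightarrow> f (\<one>\<^bsub>G\<^esub>, h) = 0)}"

definition second_differential ::
  "('e::real_normed_vector \<Rightarrow> 'f::real_normed_vector) \<Rightarrow> 'e \<Rightarrow> 'e \<Rightarrow> 'e \<Rightarrow> 'f" where
  "second_differential F p v w =
     frechet_derivative (\<lambda>q. frechet_derivative F (at q) w) (at p) v"

text \<open>The second differential at (1,1) is computed in the chosen chart at the unit. For f in
  local_cochains the first differential at (1,1) vanishes, so the chart does not matter.\<close>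

definition delta2 ::
  "('g, 'e::real_normed_vector) lie_struct \<Rightarrow> ('g \<times> 'g \<Rightarrow> 'a::real_normed_vector) \<Rightarrow>
   'e \<Rightarrow> 'e \<Rightarrow> 'a" where
  "delta2 G f x y =
     (let \<kappa> = chart_at (atlas G) \<one>\<^bsub>G\<^esub>; u = snd \<kappa> \<one>\<^bsub>G\<^esub> in
      second_differential (f \<circ> map_prod (chart_inv \<kappa>) (chart_inv \<kappa>)) (u, u) (x, 0) (0, y))"

end

theory Submission
  imports Defs
begin

text \<open>
  In the chart at the unit write \<open>\<alpha>(g) = I(\<omega>)(g)\<close> and \<open>z(g,h) = log (g h g\<inverse>)\<close>. Along
  \<open>s \<mapsto> exp (s z)\<close> the left logarithmic derivative is constantly \<open>z\<close>, hence
  \<open>I\<^sup>2(\<omega>)(g,h) = \<integral>\<^sub>0\<^sup>1 \<rho>(exp (s z)) (\<alpha>(g) z) ds\<close>. Since \<open>z(g,1) = 0\<close>, the derivative in \<open>h\<close> at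
  \<open>(g,1)\<close> in direction \<open>y\<close> is \<open>\<alpha>(g)\<close> applied to \<open>\<partial>\<^sub>y z(g,1)\<close>. As \<open>\<alpha>(1) = 0\<close> and \<open>\<partial>\<^sub>y z(1,1) = y\<close>,
  differentiating in \<open>g\<close> at the unit in direction \<open>x\<close> leaves only \<open>(D\<alpha>(1) x) y\<close>. Finally \<open>D\<alpha>(1) x = \<tau>\<^sup>2(\<omega>)(x)\<close>:
  the form integrated along \<open>c\<^sub>g\<close> is linear in the velocity, which vanishes for \<open>g = 1\<close>, so only the
  derivative of the velocity contributes, and the velocities of \<open>c\<^sub>g\<close> integrate to \<open>g - 1\<close>.
\<close>

section \<open>Finite-dimensional normed spaces\<close>

text \<open>Only the germ at (1,1) matters, so the computation should live in one chart. Two things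
  stand in the way. \<open>velocity\<close> and \<open>tangent_map\<close> use a chart chosen
  separately at each point; left translation by the inverse of the current point brings every
  tangent vector back to the unit. And the paths c_g run through the group; but c_1 is constant, so
  by compactness of [0,1] the paths c_g with g close to 1 stay in the domain of the unit chart.
  Since the times 0 and 1 are boundary points, smoothness in the time is expressed by extension
  beyond the interval. The model spaces are normed spaces with a finite spanning set and no inner
  product, so bounded coordinate functionals have to come from the norm alone. They serve throughout
  to turn a derivative in a moving direction into finitely many derivatives in fixed directions.
  Existence of one-parameter subgroups is extracted from the branch of the logarithm, and their
  uniqueness from the functional equation.\<close>

definition fin_dim :: "'v::real_normed_vector itself \<Rightarrow> bool" where
  "fin_dim _ \<longleftrightarrow> (\<exists>B::'v set. finite B \<and> span B = UNIV)"

text \<open>The bound makes the coefficients of a convergent sequence of combinations Cauchy in the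
  reals. Hence they converge, and their limits are coefficients of the limit vector.\<close>

lemma closed_span_if_bounded_coeffs:
  fixes B :: "'v::real_normed_vector set"
  assumes B: "finite B" and K: "\<And>r b. b \<in> B \<Longrightarrow> \<bar>r b\<bar> \<le> K * norm (\<Sum>b\<in>B. r b *\<^sub>R b)"
  shows "closed (span B)"
  unfolding closed_sequential_limits
proof (intro allI impI, elim conjE)
  fix f l assume f: "\<forall>n. f n \<in> span B" and l: "f \<longlonglongrightarrow> l"
  have "\<forall>n. \<exists>r. f n = (\<Sum>b\<in>B. r b *\<^sub>R b)"
    using f span_finite[OF B] by auto
  then obtain r where r: "\<And>n. f n = (\<Sum>b\<in>B. r n b *\<^sub>R b)"
    by metis
  have "convergent (\<lambda>n. r n b)" if b: "b \<in> B" for b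
  proof -
    have le: "\<bar>r m b - r n b\<bar> \<le> max K 1 * norm (f m - f n)" for m n
    proof -
      have "\<bar>r m b - r n b\<bar> \<le> K * norm (f m - f n)"
        using K[OF b, of "\<lambda>b. r m b - r n b"]
        by (simp add: r scaleR_left_diff_distrib sum_subtractf)
      \<comment> \<open>\<open>K\<close> need not be positive; \<open>max K 1\<close> is, so that
        \<open>e / max K 1\<close> below is a legitimate tolerance.\<close>
      also have "\<dots> \<le> max K 1 * norm (f m - f n)"
        by (intro mult_right_mono) auto
      finally show ?thesis .
    qed
    have "Cauchy (\<lambda>n. r n b)"
    proof (rule metric_CauchyI)
      fix e :: real assume e: "e > 0"
      have "Cauchy f" using l by (simp add: LIMSEQ_imp_Cauchy)
      then obtain M where M: "\<And>m n. m \<ge> M \<Longrightarrow> n \<ge> M \<Longrightarrow> dist (f m) (f n) < e / max K 1"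
        using metric_CauchyD[of f "e / max K 1"] e by auto
      show "\<exists>M. \<forall>m\<ge>M. \<forall>n\<ge>M. dist (r m b) (r n b) < e"
      proof (intro exI[of _ M] allI impI)
        fix m n assume "m \<ge> M" "n \<ge> M"
        from M[OF this] have "max K 1 * norm (f m - f n) < e"
          by (simp add: dist_norm field_simps)
        then show "dist (r m b) (r n b) < e"
          using le[of m n] by (simp add: dist_real_def)
      qed
    qed
    then show ?thesis by (simp add: Cauchy_convergent_iff)
  qed
  then have "f \<longlonglongrightarrow> (\<Sum>b\<in>B. lim (\<lambda>n. r n b) *\<^sub>R b)"
    unfolding r by (intro tendsto_intros) (auto simp: convergent_LIMSEQ_iff)
  then have "l = (\<Sum>b\<in>B. lim (\<lambda>n. r n b) *\<^sub>R b)"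
    using l LIMSEQ_unique by blast
  then show "l \<in> span B"
    by (auto intro: span_sum span_scale span_base)
qed

text \<open>Induction on the basis. The induction hypothesis makes the span of the old vectors
  closed, so the new vector \<open>b\<close> has positive distance \<open>d\<close> from it, and
  \<open>d\<close> controls the coefficient of \<open>b\<close>. Once that term is subtracted, the
  old bound applies to the rest.\<close>

lemma independent_bounded_coeffs:
  fixes B :: "'v::real_normed_vector set"
  assumes "finite B" "independent B"
  shows "\<exists>K. \<forall>r. \<forall>b\<in>B. \<bar>r b\<bar> \<le> K * norm (\<Sum>b\<in>B. r b *\<^sub>R b)"
  using assms
proof (induction B rule: finite_induct)
  case (insert b B)
  have ind: "independent B" "b \<notin> span B"
    using insert.prems insert.hyps by (auto simp: independent_insert)
  then obtain K0 where K0: "\<And>r b. b \<in> B \<Longrightarrow> \<bar>r b\<bar> \<le> K0 * norm (\<Sum>b\<in>B. r b *\<^sub>R b)"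
    using insert.IH by blast
  define K where "K = max K0 0"
  have K: "\<bar>r b\<bar> \<le> K * norm (\<Sum>b\<in>B. r b *\<^sub>R b)" if "b \<in> B" for r b
    using K0[OF that, of r] mult_right_mono[of K0 K "norm (\<Sum>b\<in>B. r b *\<^sub>R b)"]
    unfolding K_def by fastforce
  have cl: "closed (span B)"
    using closed_span_if_bounded_coeffs[OF insert.hyps(1) K] .
  define d where "d = infdist b (span B)"
  have d: "d > 0"
    unfolding d_def using cl ind span_zero by (intro infdist_pos_not_in_closed) auto
  show ?case
  \<comment> \<open>The coefficient of \<open>b\<close> is at most \<open>norm x / d\<close>.
    Subtracting its term leaves a vector of norm at most \<open>(1 + norm b / d) * norm x\<close>,
    to which \<open>K\<close> applies. The maximum covers both cases.\<close>
  proof (rule exI[of _ "max (1 / d) (K * (1 + norm b / d))"], intro allI ballI)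
    fix r b' assume b': "b' \<in> insert b B"
    define w where "w = (\<Sum>b\<in>B. r b *\<^sub>R b)"
    have w: "w \<in> span B" unfolding w_def by (auto intro: span_sum span_scale span_base)
    define x where "x = r b *\<^sub>R b + w"
    have x: "(\<Sum>b\<in>insert b B. r b *\<^sub>R b) = x"
      using insert.hyps by (simp add: x_def w_def)
    have rb: "\<bar>r b\<bar> * d \<le> norm x"
    proof (cases "r b = 0")
      case False
      \<comment> \<open>Dividing the combination by \<open>r b\<close> turns it into the difference
        of \<open>b\<close> and an element of the span of \<open>B\<close>.\<close>
      have "d \<le> dist b ((- 1 / r b) *\<^sub>R w)"
        unfolding d_def by (intro infdist_le span_scale w)
      then have "\<bar>r b\<bar> * d \<le> \<bar>r b\<bar> * norm (b + (1 / r b) *\<^sub>R w)"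
        by (intro mult_left_mono) (auto simp: dist_norm)
      also have "\<dots> = norm (r b *\<^sub>R (b + (1 / r b) *\<^sub>R w))" by simp
      also have "r b *\<^sub>R (b + (1 / r b) *\<^sub>R w) = x"
        using False by (simp add: x_def scaleR_add_right)
      finally show ?thesis .
    qed auto
    then have rb': "\<bar>r b\<bar> \<le> norm x / d" using d by (simp add: field_simps)
    show "\<bar>r b'\<bar> \<le> max (1 / d) (K * (1 + norm b / d)) * norm (\<Sum>b\<in>insert b B. r b *\<^sub>R b)"
    proof (cases "b' = b")
      case True
      have "\<bar>r b\<bar> \<le> (1 / d) * norm x" using rb' by simp
      also have "\<dots> \<le> max (1 / d) (K * (1 + norm b / d)) * norm x"
        by (intro mult_right_mono) auto
      finally show ?thesis unfolding x True .
    next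
      case False
      have "norm w \<le> norm x + \<bar>r b\<bar> * norm b"
        unfolding x_def using norm_triangle_ineq4[of "r b *\<^sub>R b + w" "r b *\<^sub>R b"] by simp
      also have "\<dots> \<le> norm x + (norm x / d) * norm b"
        using rb' by (intro add_left_mono mult_right_mono) auto
      finally have nw: "norm w \<le> (1 + norm b / d) * norm x" by (simp add: algebra_simps)
      have "\<bar>r b'\<bar> \<le> K * norm w" using K[of b' r] False b' by (auto simp: w_def)
      also have "\<dots> \<le> K * ((1 + norm b / d) * norm x)"
        using nw by (intro mult_left_mono) (auto simp: K_def)
      also have "\<dots> = (K * (1 + norm b / d)) * norm x" by simp
      also have "\<dots> \<le> max (1 / d) (K * (1 + norm b / d)) * norm x"
        by (intro mult_right_mono) auto
      finally show ?thesis unfolding x .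
    qed
  qed
qed simp

text \<open>This is the form in which finite dimension enters the analysis. The basis is a maximal
  independent subset of the given spanning set.\<close>

lemma fin_dim_coordinates:
  assumes "fin_dim TYPE('v::real_normed_vector)"
  obtains B :: "'v::real_normed_vector set"
    and coord :: "'v::real_normed_vector \<Rightarrow> 'v::real_normed_vector \<Rightarrow> real"
  where "finite B" "\<forall>b\<in>B. bounded_linear (coord b)"
    "\<forall>x. x = (\<Sum>b\<in>B. coord b x *\<^sub>R b)"
proof -
  obtain B0 :: "'v set" where B0: "finite B0" "span B0 = UNIV"
    using assms unfolding fin_dim_def by auto
  obtain B where B: "B \<subseteq> B0" "independent B" "B0 \<subseteq> span B"
    using real_vector.maximal_independent_subset by blast
  have fB: "finite B" using B B0 finite_subset by blast
  have sB: "span B = UNIV" using B B0 by (metis span_mono span_span top.extremum_uniqueI)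
  have ex: "x = (\<Sum>b\<in>B. representation B x b *\<^sub>R b)" for x
    using real_vector.sum_representation_eq[OF B(2) _ fB order_refl, of x] sB by auto
  obtain K where K: "\<And>r b. b \<in> B \<Longrightarrow> \<bar>r b\<bar> \<le> K * norm (\<Sum>b\<in>B. r b *\<^sub>R b)"
    using independent_bounded_coeffs[OF fB B(2)] by blast
  have "bounded_linear (\<lambda>x. representation B x b)" if "b \<in> B" for b
  proof (rule bounded_linear_intro[where K = K])
    show "norm (representation B x b) \<le> norm x * K" for x
      using K[OF that, of "representation B x"] ex[of x] by (simp add: mult.commute)
  qed (use B sB in \<open>auto simp: real_vector.representation_add real_vector.representation_scale\<close>)
  with fB ex show thesis by (intro that[of B "\<lambda>b x. representation B x b"]) auto
qed

lemma fin_dim_linear_bounded: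
  fixes f :: "'v::real_normed_vector \<Rightarrow> 'w::real_normed_vector"
  assumes "fin_dim TYPE('v)" "linear f"
  shows "bounded_linear f"
proof -
  obtain B :: "'v set" and coord where "finite B" and **: "\<forall>b\<in>B. bounded_linear (coord b)"
    "\<forall>x. x = (\<Sum>b\<in>B. coord b x *\<^sub>R b)"
    by (rule fin_dim_coordinates[OF assms(1)])
  note * = this(1) **[rule_format]
  have "f x = (\<Sum>b\<in>B. coord b x *\<^sub>R f b)" for x
    by (subst (1) *(3)[of x]) (simp add: linear_sum[OF assms(2)] linear_scale[OF assms(2)])
  then have "f = (\<lambda>x. \<Sum>b\<in>B. coord b x *\<^sub>R f b)" by (rule ext)
  moreover have "bounded_linear (\<lambda>x. \<Sum>b\<in>B. coord b x *\<^sub>R f b)"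
    by (intro bounded_linear_sum bounded_linear_scaleR_const *(2))
  ultimately show ?thesis by simp
qed

text \<open>Expanding the first argument in coordinates leaves finitely many linear maps
  \<open>f b\<close>, each bounded because the second space is finite-dimensional.\<close>

lemma fin_dim_bilinear_bounded:
  fixes f :: "'v::real_normed_vector \<Rightarrow> 'w::real_normed_vector \<Rightarrow> 'z::real_normed_vector"
  assumes "fin_dim TYPE('v)" "fin_dim TYPE('w)" "bilinear f"
  shows "bounded_bilinear f"
proof -
  obtain B :: "'v set" and coord where "finite B" and **: "\<forall>b\<in>B. bounded_linear (coord b)"
    "\<forall>x. x = (\<Sum>b\<in>B. coord b x *\<^sub>R b)"
    by (rule fin_dim_coordinates[OF assms(1)])
  note * = this(1) **[rule_format]
  have lin: "linear (\<lambda>x. f x y)" "linear (f x)" for x y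
    using assms(3) unfolding bilinear_def by auto
  have bl: "bounded_linear (f x)" for x
    using fin_dim_linear_bounded[OF assms(2) lin(2)] .
  have ex: "f x y = (\<Sum>b\<in>B. coord b x *\<^sub>R f b y)" for x y
    by (subst (1) *(3)[of x]) (simp add: linear_sum[OF lin(1)] linear_scale[OF lin(1)])
  have "norm (f x y) \<le> norm x * norm y * (\<Sum>b\<in>B. onorm (coord b) * onorm (f b))" for x y
  proof -
    have "norm (f x y) \<le> (\<Sum>b\<in>B. \<bar>coord b x\<bar> * norm (f b y))"
      unfolding ex[of x y] by (rule order_trans[OF norm_sum]) simp
    also have "\<dots> \<le> (\<Sum>b\<in>B. (onorm (coord b) * norm x) * (onorm (f b) * norm y))"
      using onorm[OF *(2), of _ x] onorm[OF bl]
      by (intro sum_mono mult_mono) (auto intro!: mult_nonneg_nonneg onorm_pos_le *(2))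
    finally show ?thesis by (simp add: sum_distrib_left mult_ac)
  qed
  then show ?thesis
    using lin by unfold_locales
      (auto simp: linear_add linear_scale bilinear_ladd bilinear_radd bilinear_lmul bilinear_rmul assms)
qed

lemma fin_dim_real: "fin_dim TYPE(real)"
  unfolding fin_dim_def
  by (intro exI[of _ "{1}"]) (auto simp: span_singleton image_def)

lemma fin_dim_prod:
  assumes "fin_dim TYPE('v::real_normed_vector)" "fin_dim TYPE('w::real_normed_vector)"
  shows "fin_dim TYPE('v::real_normed_vector \<times> 'w::real_normed_vector)"
proof -
  obtain A :: "'v set" and B :: "'w set" where AB: "finite A" "span A = UNIV" "finite B" "span B = UNIV"
    using assms unfolding fin_dim_def by auto
  have "span (A \<times> {0} \<union> {0} \<times> B) = (UNIV :: ('v \<times> 'w) set)"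
  proof (rule equalityI[OF subset_UNIV subsetI])
    fix p :: "'v \<times> 'w"
    have "linear (\<lambda>x::'v. (x, 0::'w))" "linear (\<lambda>y::'w. (0::'v, y))"
      by (auto intro!: linearI)
    then have "(fst p, 0) \<in> span ((\<lambda>x. (x, 0::'w)) ` A)" "(0, snd p) \<in> span ((\<lambda>y. (0::'v, y)) ` B)"
      using AB by (simp_all add: linear_span_image)
    moreover have "span ((\<lambda>x. (x, 0::'w)) ` A) \<subseteq> span (A \<times> {0} \<union> {0} \<times> B)"
      "span ((\<lambda>y. (0::'v, y)) ` B) \<subseteq> span (A \<times> {0} \<union> {0} \<times> B)"
      by (auto intro!: span_mono)
    ultimately have "(fst p, 0) \<in> span (A \<times> {0} \<union> {0} \<times> B)" "(0, snd p) \<in> span (A \<times> {0} \<union> {0} \<times> B)"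
      by auto
    then have "(fst p, 0) + (0, snd p) \<in> span (A \<times> {0} \<union> {0} \<times> B)"
      by (rule span_add)
    then show "p \<in> span (A \<times> {0} \<union> {0} \<times> B)" by simp
  qed
  then show ?thesis unfolding fin_dim_def using AB by (intro exI[of _ "A \<times> {0} \<union> {0} \<times> B"]) auto
qed

section \<open>Germs of smooth maps\<close>

abbreviation D :: "('e::real_normed_vector \<Rightarrow> 'f::real_normed_vector) \<Rightarrow> 'e \<Rightarrow> 'e \<Rightarrow> 'f" where
  "D f x \<equiv> frechet_derivative f (at x)"

lemma D_eq: "(f has_derivative f') (at x) \<Longrightarrow> D f x = f'"
  using frechet_derivative_at by metis

lemma D_works: "f differentiable at x \<Longrightarrow> (f has_derivative D f x) (at x)"
  by (simp add: frechet_derivative_works)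

lemma has_derivative_cong_nhds:
  assumes "eventually (\<lambda>y. f y = g y) (nhds x)"
  shows "(f has_derivative f') (at x) \<longleftrightarrow> (g has_derivative f') (at x)"
proof -
  have "eventually (\<lambda>y. f y = g y) (at x)" "eventually (\<lambda>y. g y = f y) (at x)" "f x = g x"
    using assms by (auto simp: eventually_nhds_conv_at eq_commute)
  then show ?thesis
    using has_derivative_transform_eventually[of f f' x UNIV g]
      has_derivative_transform_eventually[of g f' x UNIV f] by auto
qed

lemma D_cong: "eventually (\<lambda>y. f y = g y) (nhds x) \<Longrightarrow> D f x = D g x"
  by (simp add: frechet_derivative_def has_derivative_cong_nhds)

lemma differentiable_cong_nhds:
  "eventually (\<lambda>y. f y = g y) (nhds x) \<Longrightarrow> f differentiable at x \<longleftrightarrow> g differentiable at x"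
  by (simp add: differentiable_def has_derivative_cong_nhds)

lemma bounded_linear_D: "f differentiable at x \<Longrightarrow> bounded_linear (D f x)"
  using D_works has_derivative_bounded_linear by blast

lemma Ck_on_subset: "Ck_on k T f \<Longrightarrow> S \<subseteq> T \<Longrightarrow> Ck_on k S f"
  by (induction k arbitrary: f) (auto intro: continuous_on_subset)

lemma Ck_on_cong:
  assumes "open S" "\<And>x. x \<in> S \<Longrightarrow> f x = g x"
  shows "Ck_on k S f \<longleftrightarrow> Ck_on k S g"
  using assms(2)
proof (induction k arbitrary: f g)
  case 0
  then show ?case by (auto cong: continuous_on_cong)
next
  case (Suc k)
  have ev: "eventually (\<lambda>y. f y = g y) (nhds x)" if "x \<in> S" for x
    using Suc.prems assms(1) that by (auto simp: eventually_nhds)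
  have "Ck_on k S (\<lambda>x. D f x v) = Ck_on k S (\<lambda>x. D g x v)" for v
    by (rule Suc.IH) (simp add: D_cong[OF ev])
  then show ?case using differentiable_cong_nhds[OF ev] by auto
qed

lemma Ck_on_SucD: "Ck_on (Suc k) S f \<Longrightarrow> Ck_on k S f"
proof (induction k arbitrary: f)
  case 0
  then show ?case
    by (auto intro!: continuous_at_imp_continuous_on differentiable_imp_continuous_within)
next
  case (Suc k)
  then show ?case by (auto simp del: Ck_on.simps(2) simp: Ck_on.simps(2)[of "Suc k"] Ck_on.simps(2)[of k S f])
qed

text \<open>The derivatives in \<open>Ck_on\<close> are taken at points and not relative to the set,
  so the local statements concern one and the same derivative function and can be glued.\<close>

lemma Ck_on_local:
  assumes "\<And>x. x \<in> S \<Longrightarrow> \<exists>N. open N \<and> x \<in> N \<and> Ck_on k N f"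
  shows "Ck_on k S f"
  using assms
proof (induction k arbitrary: f)
  case 0
  show ?case
    unfolding Ck_on.simps
  proof (rule continuous_at_imp_continuous_on, rule ballI)
    fix x assume "x \<in> S"
    then obtain N where "open N" "x \<in> N" "continuous_on N f" using 0 by auto
    then show "isCont f x" by (simp add: continuous_on_eq_continuous_at)
  qed
next
  case (Suc k)
  show ?case unfolding Ck_on.simps
  proof (intro conjI ballI allI)
    show "f differentiable at x" if "x \<in> S" for x using Suc.prems[OF that] by auto
    show "Ck_on k S (\<lambda>x. D f x v)" for v
      by (rule Suc.IH) (use Suc.prems in fastforce)
  qed
qed

lemma Ck_on_const: "Ck_on k S (\<lambda>x. c)"
  by (induction k arbitrary: c) auto

lemma Ck_on_bounded_linear:
  assumes "bounded_linear A" shows "open S \<Longrightarrow> Ck_on k S f \<Longrightarrow> Ck_on k S (\<lambda>x. A (f x))"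
proof (induction k arbitrary: f)
  case 0
  then show ?case
    using bounded_linear.continuous_on[OF assms] by auto
next
  case (Suc k)
  have d: "((\<lambda>x. A (f x)) has_derivative (\<lambda>v. A (D f x v))) (at x)" if "x \<in> S" for x
    using Suc.prems that by (intro bounded_linear.has_derivative[OF assms] D_works) auto
  have "Ck_on k S (\<lambda>x. D (\<lambda>x. A (f x)) x v)" for v
    using Suc by (subst Ck_on_cong[where g = "\<lambda>x. A (D f x v)"]) (auto simp: D_eq[OF d])
  then show ?case using d by (auto simp: differentiable_def)
qed

lemma Ck_on_linear: "bounded_linear A \<Longrightarrow> Ck_on k S A"
proof (cases k)
  assume A: "bounded_linear A"
  then have "D A x = A" for x by (intro D_eq bounded_linear_imp_has_derivative)
  moreover assume "k = 0"
  ultimately show ?thesis using A by (simp add: linear_continuous_on)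
next
  fix j assume A: "bounded_linear A" and k: "k = Suc j"
  have "D A x = A" for x using A by (intro D_eq bounded_linear_imp_has_derivative)
  then show ?thesis using A by (simp add: k Ck_on_const bounded_linear_imp_differentiable)
qed

lemma Ck_on_add: "open S \<Longrightarrow> Ck_on k S f \<Longrightarrow> Ck_on k S g \<Longrightarrow> Ck_on k S (\<lambda>x. f x + g x)"
proof (induction k arbitrary: f g)
  case 0
  then show ?case by (auto intro: continuous_on_add)
next
  case (Suc k)
  have d: "((\<lambda>x. f x + g x) has_derivative (\<lambda>v. D f x v + D g x v)) (at x)" if "x \<in> S" for x
    using Suc.prems that by (intro has_derivative_add D_works) auto
  have "Ck_on k S (\<lambda>x. D (\<lambda>x. f x + g x) x v)" for v
    using Suc by (subst Ck_on_cong[where g = "\<lambda>x. D f x v + D g x v"]) (auto simp: D_eq[OF d])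
  then show ?case using d by (auto simp: differentiable_def)
qed

lemma Ck_on_bilinear:
  assumes B: "bounded_bilinear B"
  shows "open S \<Longrightarrow> Ck_on k S f \<Longrightarrow> Ck_on k S g \<Longrightarrow> Ck_on k S (\<lambda>x. B (f x) (g x))"
proof (induction k arbitrary: f g)
  case 0
  then show ?case by (auto intro: bounded_bilinear.continuous_on[OF B])
next
  case (Suc k)
  have d: "((\<lambda>x. B (f x) (g x)) has_derivative (\<lambda>v. B (f x) (D g x v) + B (D f x v) (g x))) (at x)"
    if "x \<in> S" for x
    using Suc.prems that by (intro bounded_bilinear.FDERIV[OF B] D_works) auto
  have "Ck_on k S (\<lambda>x. D (\<lambda>x. B (f x) (g x)) x v)" for v
    using Suc.prems Ck_on_SucD[OF Suc.prems(2)] Ck_on_SucD[OF Suc.prems(3)]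
    by (subst Ck_on_cong[where g = "\<lambda>x. B (f x) (D g x v) + B (D f x v) (g x)"])
      (auto simp: D_eq[OF d] intro!: Ck_on_add Suc.IH)
  then show ?case using d by (auto simp: differentiable_def)
qed

lemma Ck_on_sum:
  "open S \<Longrightarrow> (\<And>i. i \<in> I \<Longrightarrow> Ck_on k S (f i)) \<Longrightarrow> Ck_on k S (\<lambda>x. \<Sum>i\<in>I. f i x)"
  by (induction I rule: infinite_finite_induct) (auto intro: Ck_on_const Ck_on_add)

text \<open>The chain rule yields the derivative of \<open>g\<close> in the direction
  \<open>D f x v\<close>, which moves with \<open>x\<close>, whereas \<open>Ck_on\<close> speaks of
  fixed directions only. Expanding the moving direction in coordinates of the middle space gives a
  sum of products to which the induction hypothesis and the product rule apply.\<close>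

lemma Ck_on_compose:
  fixes g :: "'f::real_normed_vector \<Rightarrow> 'h::real_normed_vector"
    and f :: "'e::real_normed_vector \<Rightarrow> 'f"
  assumes fd: "fin_dim TYPE('f)" and S: "open S" and sub: "f ` S \<subseteq> T"
  shows "Ck_on k T g \<Longrightarrow> Ck_on k S f \<Longrightarrow> Ck_on k S (\<lambda>x. g (f x))"
proof (induction k arbitrary: g)
  case 0
  then show ?case using sub by (auto intro: continuous_on_compose2)
next
  case (Suc k)
  obtain B :: "'f set" and coord where "finite B" and **: "\<forall>b\<in>B. bounded_linear (coord b)"
    "\<forall>x. x = (\<Sum>b\<in>B. coord b x *\<^sub>R b)"
    by (rule fin_dim_coordinates[OF fd])
  note * = this(1) **[rule_format]
  have d: "((\<lambda>x. g (f x)) has_derivative (\<lambda>v. D g (f x) (D f x v))) (at x)" if "x \<in> S" for x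
  proof (rule has_derivative_compose[OF D_works D_works])
    show "f differentiable at x" using Suc.prems(2) that by simp
    have "f x \<in> T" using sub that by blast
    then show "g differentiable at (f x)" using Suc.prems(1) by simp
  qed
  have eq: "D (\<lambda>x. g (f x)) x v = (\<Sum>b\<in>B. coord b (D f x v) *\<^sub>R D g (f x) b)" if "x \<in> S" for x v
  proof -
    have "f x \<in> T" using sub that by blast
    then have lin: "linear (D g (f x))"
      using Suc.prems(1) by (intro bounded_linear.linear bounded_linear_D) simp
    show ?thesis
      unfolding D_eq[OF d[OF that]]
      by (subst (1) *(3)[of "D f x v"]) (simp add: linear_sum[OF lin] linear_scale[OF lin])
  qed
  have "Ck_on k S (\<lambda>x. D (\<lambda>x. g (f x)) x v)" for v
  proof -
    have "Ck_on k S (\<lambda>x. \<Sum>b\<in>B. coord b (D f x v) *\<^sub>R D g (f x) b)"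
      using Suc.prems Ck_on_SucD[OF Suc.prems(2)]
      by (intro Ck_on_sum S Ck_on_bilinear[OF bounded_bilinear_scaleR]
          Ck_on_bounded_linear[OF *(2)] Suc.IH) auto
    then show ?thesis by (subst Ck_on_cong[OF S eq])
  qed
  then show ?case using d by (auto simp: differentiable_def)
qed

text \<open>Germs replace sets here because the group operations, read in a chart, are meaningful
  only near a point; compositions then need no bookkeeping of domains.\<close>

definition smooth_near :: "'e::real_normed_vector \<Rightarrow> ('e \<Rightarrow> 'f::real_normed_vector) \<Rightarrow> bool" where
  "smooth_near p f \<longleftrightarrow> (\<exists>N. open N \<and> p \<in> N \<and> smooth_on N f)"

lemma smooth_near_commonN:
  assumes "smooth_near p f" "smooth_near p g"
  obtains N where "open N" "p \<in> N" "smooth_on N f" "smooth_on N g"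
proof -
  obtain M N where *: "open N" "p \<in> N" "smooth_on N f" "open M" "p \<in> M" "smooth_on M g"
    using assms unfolding smooth_near_def by blast
  then have "open (M \<inter> N)" "p \<in> M \<inter> N" "smooth_on (M \<inter> N) f" "smooth_on (M \<inter> N) g"
    unfolding smooth_on_def by (auto intro: Ck_on_subset)
  then show thesis by (rule that)
qed

lemma smooth_on_imp_near: "smooth_on S f \<Longrightarrow> open S \<Longrightarrow> p \<in> S \<Longrightarrow> smooth_near p f"
  unfolding smooth_near_def by auto

lemma smooth_near_imp_on: "(\<And>p. p \<in> S \<Longrightarrow> smooth_near p f) \<Longrightarrow> smooth_on S f"
  unfolding smooth_on_def by (intro allI Ck_on_local) (metis smooth_near_def smooth_on_def)

lemma smooth_near_eventually: "smooth_near p f \<Longrightarrow> eventually (\<lambda>q. smooth_near q f) (nhds p)"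
  unfolding smooth_near_def eventually_nhds by blast

lemma smooth_near_cong:
  assumes "smooth_near p f" "eventually (\<lambda>q. g q = f q) (nhds p)"
  shows "smooth_near p g"
proof -
  obtain N where *: "open N" "p \<in> N" "smooth_on N f" using assms(1) unfolding smooth_near_def by blast
  obtain M where M: "open M" "p \<in> M" "\<And>x. x \<in> M \<Longrightarrow> g x = f x"
    using assms(2) unfolding eventually_nhds by blast
  have "open (M \<inter> N)" using * M by auto
  then have "smooth_on (M \<inter> N) g"
    using * M Ck_on_cong[of "M \<inter> N" g f] Ck_on_subset[of _ N f "M \<inter> N"] unfolding smooth_on_def by auto
  then show ?thesis using * M unfolding smooth_near_def by (intro exI[of _ "M \<inter> N"]) auto
qed

lemma smooth_near_differentiable: "smooth_near p f \<Longrightarrow> f differentiable at p"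
  unfolding smooth_near_def smooth_on_def using Ck_on.simps(2)[of 0] by blast

lemma smooth_near_has_derivative: "smooth_near p f \<Longrightarrow> (f has_derivative D f p) (at p)"
  by (simp add: D_works smooth_near_differentiable)

lemma smooth_near_isCont: "smooth_near p f \<Longrightarrow> isCont f p"
  using smooth_near_differentiable differentiable_imp_continuous_within by blast

lemma smooth_near_tendsto: "smooth_near p f \<Longrightarrow> filterlim f (nhds (f p)) (nhds p)"
  using smooth_near_isCont continuous_at tendsto_at_iff_tendsto_nhds by blast

lemma smooth_near_eventually_compose:
  "smooth_near p f \<Longrightarrow> eventually P (nhds (f p)) \<Longrightarrow> eventually (\<lambda>x. P (f x)) (nhds p)"
  using smooth_near_tendsto[of p f] unfolding filterlim_iff by blast

lemma smooth_near_const: "smooth_near p (\<lambda>x. c)"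
  unfolding smooth_near_def smooth_on_def using Ck_on_const by blast

lemma smooth_near_linear: "bounded_linear A \<Longrightarrow> smooth_near p A"
  unfolding smooth_near_def smooth_on_def using Ck_on_linear by blast

lemma smooth_near_ident: "smooth_near p (\<lambda>x. x)"
  by (rule smooth_near_linear) (rule bounded_linear_ident)

lemma smooth_near_bounded_linear: "bounded_linear A \<Longrightarrow> smooth_near p f \<Longrightarrow> smooth_near p (\<lambda>x. A (f x))"
  unfolding smooth_near_def smooth_on_def using Ck_on_bounded_linear by blast

lemma smooth_near_bilinear:
  "bounded_bilinear B \<Longrightarrow> smooth_near p f \<Longrightarrow> smooth_near p g \<Longrightarrow> smooth_near p (\<lambda>x. B (f x) (g x))"
  by (rule smooth_near_commonN[of p f g], assumption, assumption)
    (auto simp: smooth_near_def smooth_on_def intro: Ck_on_bilinear)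

lemma smooth_near_add:
  "smooth_near p f \<Longrightarrow> smooth_near p g \<Longrightarrow> smooth_near p (\<lambda>x. f x + g x)"
  by (rule smooth_near_commonN[of p f g], assumption, assumption)
    (auto simp: smooth_near_def smooth_on_def intro: Ck_on_add)

lemma smooth_near_sum:
  "(\<And>i. i \<in> I \<Longrightarrow> smooth_near p (f i)) \<Longrightarrow> smooth_near p (\<lambda>x. \<Sum>i\<in>I. f i x)"
  by (induction I rule: infinite_finite_induct) (auto intro: smooth_near_const smooth_near_add)

lemma smooth_near_Pair:
  assumes "smooth_near p f" "smooth_near p g"
  shows "smooth_near p (\<lambda>x. (f x, g x))"
proof -
  have "bounded_linear (\<lambda>x::'b. (x, 0::'c))" "bounded_linear (\<lambda>y::'c. (0::'b, y))"
    by (intro bounded_linear_Pair bounded_linear_ident bounded_linear_zero)+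
  from smooth_near_add[OF smooth_near_bounded_linear[OF this(1) assms(1)]
      smooth_near_bounded_linear[OF this(2) assms(2)]]
  show ?thesis by simp
qed

lemma smooth_near_compose:
  fixes g :: "'f::real_normed_vector \<Rightarrow> 'h::real_normed_vector"
    and f :: "'e::real_normed_vector \<Rightarrow> 'f"
  assumes fd: "fin_dim TYPE('f)" and f: "smooth_near p f" and g: "smooth_near (f p) g"
  shows "smooth_near p (\<lambda>x. g (f x))"
proof -
  obtain M where M: "open M" "f p \<in> M" "smooth_on M g" using g unfolding smooth_near_def by blast
  have "eventually (\<lambda>x. f x \<in> M) (nhds p)"
    using smooth_near_eventually_compose[OF f, of "\<lambda>y. y \<in> M"] M by (simp add: eventually_nhds_in_open)
  then obtain N' where N': "open N'" "p \<in> N'" "\<And>x. x \<in> N' \<Longrightarrow> f x \<in> M"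
    unfolding eventually_nhds by blast
  obtain N where N: "open N" "p \<in> N" "smooth_on N f" using f unfolding smooth_near_def by blast
  have "Ck_on k (N \<inter> N') (\<lambda>x. g (f x))" for k
  proof (rule Ck_on_compose[where T = M, OF fd])
    show "open (N \<inter> N')" using N(1) N'(1) by (rule open_Int)
    show "f ` (N \<inter> N') \<subseteq> M" using N'(3) by blast
    show "Ck_on k M g" using M(3) by (simp add: smooth_on_def)
    show "Ck_on k (N \<inter> N') f" using N(3) Ck_on_subset[of k N f] by (simp add: smooth_on_def)
  qed
  then show ?thesis unfolding smooth_near_def smooth_on_def using N N'
    by (intro exI[of _ "N \<inter> N'"]) auto
qed

lemma smooth_near_D: "smooth_near p f \<Longrightarrow> smooth_near p (\<lambda>x. D f x v)"
  unfolding smooth_near_def smooth_on_def using Ck_on.simps(2) by metis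

lemma D_compose:
  assumes "smooth_near p f" "smooth_near (f p) g"
  shows "D (\<lambda>x. g (f x)) p v = D g (f p) (D f p v)"
  using has_derivative_compose[OF smooth_near_has_derivative[OF assms(1)] smooth_near_has_derivative[OF assms(2)]]
  by (simp add: D_eq)

text \<open>As in the chain rule, a direction depending on the point is resolved into fixed basis
  directions. This covers differentials of translations taken along a moving base point.\<close>

lemma smooth_near_D_apply:
  fixes g :: "'f::real_normed_vector \<Rightarrow> 'h::real_normed_vector"
    and f w :: "'e::real_normed_vector \<Rightarrow> 'f"
  assumes fd: "fin_dim TYPE('f)" and f: "smooth_near p f" and g: "smooth_near (f p) g"
    and w: "smooth_near p w"
  shows "smooth_near p (\<lambda>x. D g (f x) (w x))"
proof -
  obtain B :: "'f set" and coord where "finite B" and **: "\<forall>b\<in>B. bounded_linear (coord b)"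
    "\<forall>x. x = (\<Sum>b\<in>B. coord b x *\<^sub>R b)"
    by (rule fin_dim_coordinates[OF fd])
  note * = this(1) **[rule_format]
  have "eventually (\<lambda>y. g differentiable at y) (nhds (f p))"
    using smooth_near_eventually[OF g] by eventually_elim (rule smooth_near_differentiable)
  then have "eventually (\<lambda>x. g differentiable at (f x)) (nhds p)"
    by (rule smooth_near_eventually_compose[OF f])
  then have ev: "eventually (\<lambda>x. D g (f x) (w x) = (\<Sum>b\<in>B. coord b (w x) *\<^sub>R D g (f x) b)) (nhds p)"
  proof eventually_elim
    case (elim x)
    then have lin: "linear (D g (f x))" by (intro bounded_linear.linear bounded_linear_D)
    show ?case
      by (subst (1) *(3)[of "w x"]) (simp add: linear_sum[OF lin] linear_scale[OF lin])
  qed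
  have "smooth_near p (\<lambda>x. \<Sum>b\<in>B. coord b (w x) *\<^sub>R D g (f x) b)"
    by (intro smooth_near_sum smooth_near_bilinear[OF bounded_bilinear_scaleR]
        smooth_near_bounded_linear[OF *(2)] w
        smooth_near_compose[where g = "\<lambda>y. D g y b" for b, OF fd f] smooth_near_D g)
  then show ?thesis using ev by (rule smooth_near_cong)
qed

section \<open>Smooth integrals depending on parameters\<close>

text \<open>Smoothness at a point of \<open>E \<times> [0,1]\<close>: the values outside \<open>[0,1]\<close> are irrelevant, and at
  the end points a smooth extension beyond the interval is required.\<close>

definition smooth_ext :: "'e::real_normed_vector \<times> real \<Rightarrow> ('e \<times> real \<Rightarrow> 'f::real_normed_vector) \<Rightarrow> bool" where
  "smooth_ext p Q \<longleftrightarrow>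
     (\<exists>F. smooth_near p F \<and> eventually (\<lambda>q. snd q \<in> {0..1} \<longrightarrow> Q q = F q) (nhds p))"

lemma smooth_near_imp_ext: "smooth_near p Q \<Longrightarrow> smooth_ext p Q"
  unfolding smooth_ext_def by auto

lemma smooth_ext_eventually:
  assumes "smooth_ext p Q" shows "eventually (\<lambda>q. smooth_ext q Q) (nhds p)"
proof -
  obtain F where F: "smooth_near p F" "eventually (\<lambda>q. snd q \<in> {0..1} \<longrightarrow> Q q = F q) (nhds p)"
    using assms(1) unfolding smooth_ext_def by blast
  from smooth_near_eventually[OF F(1)] F(2)[THEN eventually_eventually[THEN iffD2]]
  show ?thesis by eventually_elim (auto simp: smooth_ext_def)
qed

lemma smooth_ext_compose:
  fixes Q :: "'e::real_normed_vector \<times> real \<Rightarrow> 'f::real_normed_vector"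
  assumes "fin_dim TYPE('f)" "smooth_ext p Q" "snd p \<in> {0..1}" "smooth_near (Q p) g"
  shows "smooth_ext p (\<lambda>q. g (Q q))"
proof -
  obtain F where F: "smooth_near p F" "eventually (\<lambda>q. snd q \<in> {0..1} \<longrightarrow> Q q = F q) (nhds p)"
    using assms(2) unfolding smooth_ext_def by blast
  \<comment> \<open>The extension agrees with \<open>Q\<close> only at times in [0,1]; as
    \<open>p\<close> has such a time, smoothness of \<open>g\<close> at \<open>Q p\<close> is
    smoothness at \<open>F p\<close>.\<close>
  have "Q p = F p" using eventually_nhds_x_imp_x[OF F(2)] assms(3) by auto
  then have "smooth_near p (\<lambda>q. g (F q))"
    using smooth_near_compose[OF assms(1) F(1)] assms(4) by simp
  moreover have "eventually (\<lambda>q. snd q \<in> {0..1} \<longrightarrow> g (Q q) = g (F q)) (nhds p)"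
    using F(2) by eventually_elim auto
  ultimately show ?thesis unfolding smooth_ext_def by blast
qed

lemma smooth_ext_Pair:
  assumes "smooth_ext p Q" "smooth_ext p R"
  shows "smooth_ext p (\<lambda>q. (Q q, R q))"
proof -
  obtain F where F: "smooth_near p F" "eventually (\<lambda>q. snd q \<in> {0..1} \<longrightarrow> Q q = F q) (nhds p)"
    using assms(1) unfolding smooth_ext_def by blast
  obtain H where H: "smooth_near p H" "eventually (\<lambda>q. snd q \<in> {0..1} \<longrightarrow> R q = H q) (nhds p)"
    using assms(2) unfolding smooth_ext_def by blast
  have "eventually (\<lambda>q. snd q \<in> {0..1} \<longrightarrow> (Q q, R q) = (F q, H q)) (nhds p)"
    using F(2) H(2) by eventually_elim auto
  then show ?thesis unfolding smooth_ext_def using smooth_near_Pair[OF F(1) H(1)]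
    by (intro exI[of _ "\<lambda>q. (F q, H q)"]) simp
qed

lemma eventually_nhds_Pair1:
  "eventually P (nhds (a, b)) \<Longrightarrow> eventually (\<lambda>x. P (x, b)) (nhds a)"
  by (rule eventually_compose_filterlim[where f = "\<lambda>x. (x, b)"])
    (auto intro!: tendsto_Pair simp: filterlim_ident)

lemma eventually_nhds_Pair2:
  "eventually P (nhds (a, b)) \<Longrightarrow> eventually (\<lambda>x. P (a, x)) (nhds b)"
  by (rule eventually_compose_filterlim[where f = "\<lambda>x. (a, x)"])
    (auto intro!: tendsto_Pair simp: filterlim_ident)

lemma has_derivative_slice1:
  assumes "smooth_near (a, b) F"
  shows "((\<lambda>x. F (x, b)) has_derivative (\<lambda>v. D F (a, b) (v, 0))) (at a)"
  by (rule has_derivative_compose[where f = "\<lambda>x. (x, b)" and g = F])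
    (use smooth_near_has_derivative[OF assms] in \<open>auto intro!: derivative_eq_intros\<close>)

lemma has_derivative_slice2:
  assumes "smooth_near (a, b) F"
  shows "((\<lambda>x. F (a, x)) has_derivative (\<lambda>v. D F (a, b) (0, v))) (at b)"
  by (rule has_derivative_compose[where f = "\<lambda>x. (a, x)" and g = F])
    (use smooth_near_has_derivative[OF assms] in \<open>auto intro!: derivative_eq_intros\<close>)

text \<open>Both partial derivatives of \<open>Q\<close> are read off from the extension
  \<open>F\<close>. For a fixed time in [0,1] the two agree at all nearby \<open>x\<close>, so the
  derivative in \<open>x\<close> is an ordinary one; in time only the derivative within the interval
  is determined, one-sided at its ends.\<close>

lemma smooth_ext_slice:
  assumes F: "smooth_near (a, t) F" and ev: "eventually (\<lambda>q. snd q \<in> {0..1} \<longrightarrow> Q q = F q) (nhds (a, t))"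
    and t: "t \<in> {0..1}"
  shows "((\<lambda>x. Q (x, t)) has_derivative (\<lambda>v. D F (a, t) (v, 0))) (at a)"
    and "((\<lambda>r. Q (a, r)) has_vector_derivative D F (a, t) (0, 1)) (at t within {0..1})"
proof -
  have "eventually (\<lambda>x. Q (x, t) = F (x, t)) (nhds a)"
    using eventually_nhds_Pair1[OF ev] t by simp
  then show "((\<lambda>x. Q (x, t)) has_derivative (\<lambda>v. D F (a, t) (v, 0))) (at a)"
    using has_derivative_slice1[OF F] by (subst has_derivative_cong_nhds) auto
  have "eventually (\<lambda>r. r \<in> {0..1} \<longrightarrow> Q (a, r) = F (a, r)) (nhds t)"
    using eventually_nhds_Pair2[OF ev] by simp
  then obtain d where d: "d > 0" "\<And>r. dist r t < d \<Longrightarrow> r \<in> {0..1} \<Longrightarrow> Q (a, r) = F (a, r)"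
    unfolding eventually_nhds_metric by blast
  have "D F (a, t) (0, v) = v *\<^sub>R D F (a, t) (0, 1)" for v
    using linear_scale[OF bounded_linear.linear[OF bounded_linear_D[OF smooth_near_differentiable[OF F]]], of v "(0, 1)"]
    by simp
  then have eq: "(\<lambda>v. D F (a, t) (0, v)) = (\<lambda>v. v *\<^sub>R D F (a, t) (0, 1))" by (rule ext)
  have "((\<lambda>r. F (a, r)) has_vector_derivative D F (a, t) (0, 1)) (at t)"
    using has_derivative_slice2[OF F] unfolding has_vector_derivative_def eq .
  then have "((\<lambda>r. F (a, r)) has_vector_derivative D F (a, t) (0, 1)) (at t within {0..1})"
    by (rule has_vector_derivative_at_within)
  then show "((\<lambda>r. Q (a, r)) has_vector_derivative D F (a, t) (0, 1)) (at t within {0..1})"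
    by (rule has_vector_derivative_transform_within[OF _ d(1) t]) (simp add: d(2))
qed

lemma smooth_ext_smooth_near_slice:
  assumes "fin_dim TYPE('e::real_normed_vector)" "smooth_ext (a :: 'e, t) Q" "t \<in> {0..1}"
  shows "smooth_near a (\<lambda>x. Q (x, t))"
proof -
  obtain F where F: "smooth_near (a, t) F" "eventually (\<lambda>q. snd q \<in> {0..1} \<longrightarrow> Q q = F q) (nhds (a, t))"
    using assms(2) unfolding smooth_ext_def by blast
  have "smooth_near a (\<lambda>x. F (x, t))"
    by (rule smooth_near_compose[where g = F, OF fin_dim_prod[OF assms(1) fin_dim_real]
          smooth_near_Pair[OF smooth_near_ident smooth_near_const] F(1)])
  moreover have "eventually (\<lambda>x. Q (x, t) = F (x, t)) (nhds a)"
    using eventually_nhds_Pair1[OF F(2)] assms(3) by simp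
  ultimately show ?thesis by (rule smooth_near_cong)
qed

lemma smooth_ext_D1:
  assumes "smooth_ext (a, t) Q"
  shows "smooth_ext (a, t) (\<lambda>q. D (\<lambda>x. Q (x, snd q)) (fst q) v)"
proof -
  obtain F where F: "smooth_near (a, t) F" "eventually (\<lambda>q. snd q \<in> {0..1} \<longrightarrow> Q q = F q) (nhds (a, t))"
    using assms(1) unfolding smooth_ext_def by blast
  \<comment> \<open>Agreement of \<open>Q\<close> and \<open>F\<close> holds around every point
    close to \<open>(a, t)\<close>, so the derivatives can be compared at all these points.\<close>
  from smooth_near_eventually[OF F(1)] F(2)[THEN eventually_eventually[THEN iffD2]]
  have "eventually (\<lambda>q. snd q \<in> {0..1} \<longrightarrow> D (\<lambda>x. Q (x, snd q)) (fst q) v = D F q (v, 0)) (nhds (a, t))"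
  proof eventually_elim
    case (elim q)
    then show ?case
      using D_eq[OF smooth_ext_slice(1)[of "fst q" "snd q" F Q]] by simp
  qed
  then show ?thesis using smooth_near_D[OF F(1)] unfolding smooth_ext_def by blast
qed

abbreviation vderiv01 :: "(real \<Rightarrow> 'f::real_normed_vector) \<Rightarrow> real \<Rightarrow> 'f" where
  "vderiv01 f t \<equiv> vector_derivative f (at t within {0..1})"

lemma vderiv01_eq:
  "(f has_vector_derivative f') (at t within {0..1}) \<Longrightarrow> t \<in> {0..1} \<Longrightarrow> vderiv01 f t = f'"
  using vector_derivative_within_cbox[of 0 1 t f f'] by simp

lemma smooth_ext_dt:
  assumes "smooth_ext (a, t) Q"
  shows "smooth_ext (a, t) (\<lambda>q. vderiv01 (\<lambda>r. Q (fst q, r)) (snd q))"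
proof -
  obtain F where F: "smooth_near (a, t) F" "eventually (\<lambda>q. snd q \<in> {0..1} \<longrightarrow> Q q = F q) (nhds (a, t))"
    using assms(1) unfolding smooth_ext_def by blast
  from smooth_near_eventually[OF F(1)] F(2)[THEN eventually_eventually[THEN iffD2]]
  have "eventually (\<lambda>q. snd q \<in> {0..1} \<longrightarrow> vderiv01 (\<lambda>r. Q (fst q, r)) (snd q) = D F q (0, 1)) (nhds (a, t))"
  proof eventually_elim
    case (elim q)
    then show ?case
      using vderiv01_eq[OF smooth_ext_slice(2)[of "fst q" "snd q" F Q]] by simp
  qed
  then show ?thesis using smooth_near_D[OF F(1)] unfolding smooth_ext_def by blast
qed

lemma smooth_ext_has_vector_derivative:
  assumes "smooth_ext (a, t) Q" "t \<in> {0..1}"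
  shows "((\<lambda>r. Q (a, r)) has_vector_derivative vderiv01 (\<lambda>r. Q (a, r)) t) (at t within {0..1})"
proof -
  obtain F where F: "smooth_near (a, t) F" "eventually (\<lambda>q. snd q \<in> {0..1} \<longrightarrow> Q q = F q) (nhds (a, t))"
    using assms(1) unfolding smooth_ext_def by blast
  show ?thesis using smooth_ext_slice(2)[OF F assms(2)] vderiv01_eq[OF _ assms(2)] by metis
qed

lemma smooth_ext_continuous_on:
  assumes "\<And>q. q \<in> S \<times> {0..1} \<Longrightarrow> smooth_ext q Q"
  shows "continuous_on (S \<times> {0..1}) Q"
  unfolding continuous_on_eq_continuous_within
proof
  fix q assume q: "q \<in> S \<times> {0..1::real}"
  obtain F where F: "smooth_near q F" "eventually (\<lambda>q. snd q \<in> {0..1} \<longrightarrow> Q q = F q) (nhds q)"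
    using assms[OF q] unfolding smooth_ext_def by blast
  have "Q q = F q" using eventually_nhds_x_imp_x[OF F(2)] q by auto
  moreover have "(F \<longlongrightarrow> F q) (at q within S \<times> {0..1})"
    using smooth_near_isCont[OF F(1)] by (auto simp: isCont_def intro: tendsto_within_subset)
  moreover have "eventually (\<lambda>p. F p = Q p) (at q within S \<times> {0..1})"
    unfolding eventually_at_filter using F(2) by eventually_elim auto
  ultimately show "continuous (at q within S \<times> {0..1}) Q"
    unfolding continuous_within by (metis (mono_tags, lifting) tendsto_cong)
qed

text \<open>The points around which \<open>P\<close> holds form an open set containing the compact
  segment over \<open>a\<close>, and the tube lemma provides a product neighbourhood. In this way
  conditions near each time become one condition on the parameter.\<close>

lemma eventually_nhds_uniform01:
  fixes a :: "'e::topological_space"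
  assumes "\<And>t. t \<in> {0..1::real} \<Longrightarrow> eventually P (nhds (a, t))"
  shows "eventually (\<lambda>x. \<forall>t\<in>{0..1}. P (x, t)) (nhds a)"
proof -
  define W where "W = {q. eventually P (nhds q)}"
  have "open W" unfolding W_def
    by (subst open_subopen) (force simp: eventually_nhds)
  moreover have "{a} \<times> {0..1} \<subseteq> W" using assms by (auto simp: W_def)
  ultimately obtain X where X: "a \<in> X" "open X" "X \<times> {0..1} \<subseteq> W"
    using Elementary_Topology.tube_lemma[of "{0..1::real}" W a] by auto
  have "P (x, t)" if "x \<in> X" "t \<in> {0..1}" for x t
    using X(3) that eventually_nhds_x_imp_x[of P "(x, t)"] unfolding W_def by blast
  with X show ?thesis unfolding eventually_nhds by blast
qed

section \<open>Differentiation under the integral sign\<close>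

abbreviation int01 :: "(real \<Rightarrow> 'f::banach) \<Rightarrow> 'f" where
  "int01 f \<equiv> integral {0..1} f"

text \<open>The Leibniz rule asks for a continuous derivative with values in the bounded operators,
  while continuity is known direction by direction. The operator \<open>fx\<close> is therefore
  assembled from the derivatives along a basis and the coordinate functionals.\<close>

lemma has_derivative_int01:
  fixes Q :: "'e::banach \<times> real \<Rightarrow> 'f::banach"
  assumes fd: "fin_dim TYPE('e)" and S: "open S" "convex S"
    and Q: "\<And>q. q \<in> S \<times> {0..1} \<Longrightarrow> smooth_ext q Q" and a: "a \<in> S"
  shows "((\<lambda>x. int01 (\<lambda>t. Q (x, t))) has_derivative (\<lambda>v. int01 (\<lambda>t. D (\<lambda>x. Q (x, t)) a v))) (at a)"
proof -
  obtain B :: "'e set" and coord where "finite B" and **: "\<forall>b\<in>B. bounded_linear (coord b)"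
    "\<forall>x. x = (\<Sum>b\<in>B. coord b x *\<^sub>R b)"
    by (rule fin_dim_coordinates[OF fd])
  note * = this(1) **[rule_format]
  define fx where "fx = (\<lambda>q. \<Sum>b\<in>B. blinfun_scaleR_left (D (\<lambda>x. Q (x, snd q)) (fst q) b) o\<^sub>L Blinfun (coord b))"
  have cont: "continuous_on (S \<times> {0..1}) Q"
    using Q by (rule smooth_ext_continuous_on)
  have cD: "continuous_on (S \<times> {0..1}) (\<lambda>q. D (\<lambda>x. Q (x, snd q)) (fst q) b)" for b
  proof (rule smooth_ext_continuous_on)
    fix q assume "q \<in> S \<times> {0..1::real}"
    then show "smooth_ext q (\<lambda>q. D (\<lambda>x. Q (x, snd q)) (fst q) b)"
      using smooth_ext_D1[of "fst q" "snd q" Q b] Q by simp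
  qed
  have cfx: "continuous_on (S \<times> {0..1}) fx"
    unfolding fx_def
    by (intro continuous_intros bounded_linear.continuous_on[OF bounded_linear_blinfun_scaleR_left] cD)
  have diff: "(\<lambda>x. Q (x, t)) differentiable at x" if "x \<in> S" "t \<in> {0..1}" for x t
    using smooth_ext_smooth_near_slice[OF fd Q] that by (auto intro: smooth_near_differentiable)
  have fx_app: "blinfun_apply (fx (x, t)) = D (\<lambda>x. Q (x, t)) x" if "x \<in> S" "t \<in> {0..1}" for x t
  proof
    fix v
    have lin: "linear (D (\<lambda>x. Q (x, t)) x)"
      using diff[OF that] by (intro bounded_linear.linear bounded_linear_D)
    show "blinfun_apply (fx (x, t)) v = D (\<lambda>x. Q (x, t)) x v"
      unfolding fx_def
      by (subst (2) *(3)[of v])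
        (simp add: linear_sum[OF lin] linear_scale[OF lin] blinfun.sum_left bounded_linear_Blinfun_apply[OF *(2)])
  qed
  have slice: "continuous_on {0..1} (\<lambda>t. h (x, t))" if "continuous_on (S \<times> {0..1}) h" "x \<in> S"
    for h :: "'e \<times> real \<Rightarrow> 'z::topological_space" and x
    using that by (auto intro!: continuous_on_compose2[OF that(1)] continuous_intros)
  have "((\<lambda>x. integral (cbox 0 1) (\<lambda>t. Q (x, t))) has_derivative
      blinfun_apply (integral (cbox 0 1) (\<lambda>t. fx (a, t)))) (at a within S)"
  proof (rule leibniz_rule[where fx = "\<lambda>x t. fx (x, t)"])
    show "((\<lambda>x. Q (x, t)) has_derivative blinfun_apply (fx (x, t))) (at x within S)"
      if "x \<in> S" "t \<in> cbox 0 1" for x t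
      using D_works[OF diff] fx_app that by (auto intro: has_derivative_at_withinI)
    show "(\<lambda>t. Q (x, t)) integrable_on cbox 0 1" if "x \<in> S" for x
      using slice[OF cont that] by (auto intro: integrable_continuous_real)
    show "continuous_on (S \<times> cbox 0 1) (\<lambda>(x, t). fx (x, t))"
      using cfx by simp
  qed (use S a in auto)
  moreover have "blinfun_apply (integral (cbox 0 1) (\<lambda>t. fx (a, t))) = (\<lambda>v. int01 (\<lambda>t. D (\<lambda>x. Q (x, t)) a v))"
  proof
    fix v
    have "(\<lambda>t. fx (a, t)) integrable_on {0..1}"
      using slice[OF cfx a] by (rule integrable_continuous_real)
    show "blinfun_apply (integral (cbox 0 1) (\<lambda>t. fx (a, t))) v = int01 (\<lambda>t. D (\<lambda>x. Q (x, t)) a v)"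
      unfolding cbox_interval blinfun_apply_integral[OF \<open>(\<lambda>t. fx (a, t)) integrable_on {0..1}\<close>]
      by (intro integral_cong) (simp only: fx_app[OF a])
  qed
  ultimately show ?thesis
    unfolding at_within_open[OF a S(1)] by (metis cbox_interval)
qed

text \<open>The derivative of the integral in direction \<open>v\<close> is an integral of the same
  kind, whose integrand inherits the hypothesis by \<open>smooth_ext_D1\<close>; hence the induction
  on \<open>k\<close> with \<open>Q\<close> arbitrary.\<close>

lemma Ck_on_int01:
  fixes Q :: "'e::banach \<times> real \<Rightarrow> 'f::banach"
  assumes fd: "fin_dim TYPE('e)" and S: "open S" "convex S"
  shows "(\<And>q. q \<in> S \<times> {0..1} \<Longrightarrow> smooth_ext q Q) \<Longrightarrow> Ck_on k S (\<lambda>x. int01 (\<lambda>t. Q (x, t)))"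
proof (induction k arbitrary: Q)
  case 0
  then have "continuous_on (S \<times> cbox 0 1) (\<lambda>(x, t). Q (x, t))"
    using smooth_ext_continuous_on[of S Q] by simp
  from integral_continuous_on_param[OF this] show ?case by simp
next
  case (Suc k)
  note d = has_derivative_int01[OF fd S Suc.prems]
  have "Ck_on k S (\<lambda>x. int01 (\<lambda>t. D (\<lambda>x. Q (x, t)) x v))" for v
  proof (rule Suc.IH[where Q = "\<lambda>q. D (\<lambda>x. Q (x, snd q)) (fst q) v", simplified fst_conv snd_conv])
    fix q assume "q \<in> S \<times> {0..1::real}"
    then show "smooth_ext q (\<lambda>q. D (\<lambda>x. Q (x, snd q)) (fst q) v)"
      using smooth_ext_D1[of "fst q" "snd q" Q v] Suc.prems by simp
  qed
  then have "Ck_on k S (\<lambda>x. D (\<lambda>x. int01 (\<lambda>t. Q (x, t))) x v)" for v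
    by (subst Ck_on_cong[OF S(1), where g = "\<lambda>x. int01 (\<lambda>t. D (\<lambda>x. Q (x, t)) x v)"]) (auto simp: D_eq[OF d])
  then show ?case using d by (auto simp: differentiable_def)
qed

text \<open>Provides the open convex parameter set required for differentiating under the integral,
  from information over the single point \<open>a\<close>.\<close>

lemma smooth_ext_ball:
  assumes "\<And>t. t \<in> {0..1} \<Longrightarrow> smooth_ext (a, t) Q"
  obtains r where "r > 0" "\<forall>q\<in>ball a r \<times> {0..1}. smooth_ext q Q"
proof -
  have "eventually (\<lambda>x. \<forall>t\<in>{0..1}. smooth_ext (x, t) Q) (nhds a)"
    by (rule eventually_nhds_uniform01) (rule smooth_ext_eventually[OF assms])
  then obtain r where "r > 0" "\<And>x. dist x a < r \<Longrightarrow> \<forall>t\<in>{0..1}. smooth_ext (x, t) Q"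
    unfolding eventually_nhds_metric by blast
  then show thesis by (intro that[of r]) (auto simp: dist_commute)
qed

lemma smooth_near_int01:
  fixes Q :: "'e::banach \<times> real \<Rightarrow> 'f::banach"
  assumes fd: "fin_dim TYPE('e)" and Q: "\<And>t. t \<in> {0..1} \<Longrightarrow> smooth_ext (a, t) Q"
  shows "smooth_near a (\<lambda>x. int01 (\<lambda>t. Q (x, t)))"
    and "D (\<lambda>x. int01 (\<lambda>t. Q (x, t))) a v = int01 (\<lambda>t. D (\<lambda>x. Q (x, t)) a v)"
proof -
  obtain r where "r > 0" and *: "\<forall>q\<in>ball a r \<times> {0..1}. smooth_ext q Q"
    by (rule smooth_ext_ball[OF Q])
  note r = this(1) *[rule_format]
  show "smooth_near a (\<lambda>x. int01 (\<lambda>t. Q (x, t)))"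
    unfolding smooth_near_def smooth_on_def
    using Ck_on_int01[OF fd open_ball convex_ball r(2)] r(1) by (intro exI[of _ "ball a r"]) auto
  show "D (\<lambda>x. int01 (\<lambda>t. Q (x, t))) a v = int01 (\<lambda>t. D (\<lambda>x. Q (x, t)) a v)"
    using D_eq[OF has_derivative_int01[OF fd open_ball convex_ball r(2) centre_in_ball[THEN iffD2, OF r(1)]]] by simp
qed

lemma smooth_ext_integrable:
  fixes Q :: "'e::real_normed_vector \<times> real \<Rightarrow> 'f::banach"
  assumes "\<And>t. t \<in> {0..1} \<Longrightarrow> smooth_ext (a, t) Q"
  shows "(\<lambda>t. Q (a, t)) integrable_on {0..1}"
proof -
  have "continuous_on ({a} \<times> {0..1}) Q"
    using assms by (intro smooth_ext_continuous_on) auto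
  then show ?thesis
    by (intro integrable_continuous_real continuous_on_compose2[of "{a} \<times> {0..1}" Q "{0..1}" "Pair a"])
      (auto intro!: continuous_intros)
qed

lemma smooth_ext_eventually_compose:
  assumes "smooth_ext p Q" "snd p \<in> {0..1}" "eventually P (nhds (Q p))"
  shows "eventually (\<lambda>q. snd q \<in> {0..1} \<longrightarrow> P (Q q)) (nhds p)"
proof -
  obtain F where F: "smooth_near p F" "eventually (\<lambda>q. snd q \<in> {0..1} \<longrightarrow> Q q = F q) (nhds p)"
    using assms(1) unfolding smooth_ext_def by blast
  have "Q p = F p" using eventually_nhds_x_imp_x[OF F(2)] assms(2) by auto
  then have "eventually (\<lambda>q. P (F q)) (nhds p)"
    using smooth_near_eventually_compose[OF F(1)] assms(3) by simp
  then show ?thesis using F(2) by eventually_elim auto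
qed

section \<open>Smooth maps in charts\<close>

lemma is_chartD:
  assumes "is_chart \<kappa>"
  shows "open (fst \<kappa>)" "open (snd \<kappa> ` fst \<kappa>)" "continuous_on (fst \<kappa>) (snd \<kappa>)"
    "continuous_on (snd \<kappa> ` fst \<kappa>) (chart_inv \<kappa>)"
    "p \<in> fst \<kappa> \<Longrightarrow> chart_inv \<kappa> (snd \<kappa> p) = p"
    "a \<in> snd \<kappa> ` fst \<kappa> \<Longrightarrow> snd \<kappa> (chart_inv \<kappa> a) = a"
    "a \<in> snd \<kappa> ` fst \<kappa> \<Longrightarrow> chart_inv \<kappa> a \<in> fst \<kappa>"
    "inj_on (snd \<kappa>) (fst \<kappa>)"
  using assms unfolding is_chart_def homeomorphism_def by (auto intro: inj_on_inverseI)

lemma is_chartI: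
  assumes "open S" "open (f ` S)" "inj_on f S" "continuous_on S f"
    "continuous_on (f ` S) g" "\<And>x. x \<in> S \<Longrightarrow> g (f x) = x"
  shows "is_chart (S, f)"
proof -
  have "continuous_on (f ` S) (the_inv_into S f)"
    using assms(5) by (rule continuous_on_eq) (use assms in \<open>auto simp: the_inv_into_f_f\<close>)
  then show ?thesis
    using assms unfolding is_chart_def homeomorphism_def
    by (auto simp: the_inv_into_f_f image_image)
qed

lemma is_chart_prod:
  assumes \<kappa>: "is_chart \<kappa>" and \<mu>: "is_chart \<mu>"
  shows "is_chart (fst \<kappa> \<times> fst \<mu>, map_prod (snd \<kappa>) (snd \<mu>))"
proof (rule is_chartI[where g = "map_prod (chart_inv \<kappa>) (chart_inv \<mu>)"])
  note k = is_chartD[OF \<kappa>] and m = is_chartD[OF \<mu>]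
  have im: "map_prod (snd \<kappa>) (snd \<mu>) ` (fst \<kappa> \<times> fst \<mu>) = snd \<kappa> ` fst \<kappa> \<times> snd \<mu> ` fst \<mu>"
    by (rule map_prod_image)
  show "open (fst \<kappa> \<times> fst \<mu>)" using k m by (intro open_Times)
  show "open (map_prod (snd \<kappa>) (snd \<mu>) ` (fst \<kappa> \<times> fst \<mu>))"
    unfolding im using k m by (intro open_Times)
  show "inj_on (map_prod (snd \<kappa>) (snd \<mu>)) (fst \<kappa> \<times> fst \<mu>)"
    using k m by (intro map_prod_inj_on)
  show "continuous_on (fst \<kappa> \<times> fst \<mu>) (map_prod (snd \<kappa>) (snd \<mu>))"
    unfolding map_prod_def case_prod_beta
    by (intro continuous_on_Pair continuous_on_compose2[OF k(3)] continuous_on_compose2[OF m(3)]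
        continuous_intros) auto
  show "continuous_on (map_prod (snd \<kappa>) (snd \<mu>) ` (fst \<kappa> \<times> fst \<mu>)) (map_prod (chart_inv \<kappa>) (chart_inv \<mu>))"
    unfolding map_prod_def case_prod_beta
    by (intro continuous_on_Pair continuous_on_compose2[OF k(4)] continuous_on_compose2[OF m(4)]
        continuous_intros) auto
  show "map_prod (chart_inv \<kappa>) (chart_inv \<mu>) (map_prod (snd \<kappa>) (snd \<mu>) x) = x"
    if "x \<in> fst \<kappa> \<times> fst \<mu>" for x
    using k(5) m(5) that by auto
qed

text \<open>The inverse of the product chart is specified only on its image, whence the two
  membership assumptions.\<close>

lemma chart_inv_prod:
  assumes \<kappa>: "is_chart \<kappa>" and \<mu>: "is_chart \<mu>"
    and "a \<in> snd \<kappa> ` fst \<kappa>" "b \<in> snd \<mu> ` fst \<mu>"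
  shows "chart_inv (fst \<kappa> \<times> fst \<mu>, map_prod (snd \<kappa>) (snd \<mu>)) (a, b) = (chart_inv \<kappa> a, chart_inv \<mu> b)"
proof -
  note k = is_chartD[OF \<kappa>] and m = is_chartD[OF \<mu>] and p = is_chartD[OF is_chart_prod[OF \<kappa> \<mu>]]
  have "(a, b) = map_prod (snd \<kappa>) (snd \<mu>) (chart_inv \<kappa> a, chart_inv \<mu> b)"
    using k(6) m(6) assms by simp
  then show ?thesis
    using p(5)[of "(chart_inv \<kappa> a, chart_inv \<mu> b)"] k(7) m(7) assms by simp
qed

lemma is_chart_vec: "is_chart (UNIV, id)"
  by (rule is_chartI[where g = id]) auto

lemma chart_inv_vec [simp]: "the_inv_into UNIV id = id"
  by (rule ext) (metis id_apply inj_on_id the_inv_into_f_f UNIV_I)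

lemma chart_at_vec [simp]: "chart_at vec_atlas p = (UNIV, id)"
  unfolding chart_at_def vec_atlas_def by (rule some_equality) auto

lemma eventually_chart_inv:
  assumes "is_chart \<kappa>" "p \<in> fst \<kappa>"
  shows "eventually (\<lambda>a. a \<in> snd \<kappa> ` fst \<kappa>) (nhds (snd \<kappa> p))"
    and "eventually P (nhds p) \<Longrightarrow> eventually (\<lambda>a. P (chart_inv \<kappa> a)) (nhds (snd \<kappa> p))"
proof -
  note k = is_chartD[OF assms(1)]
  show *: "eventually (\<lambda>a. a \<in> snd \<kappa> ` fst \<kappa>) (nhds (snd \<kappa> p))"
    using k(2) assms(2) by (intro eventually_nhds_in_open) auto
  assume "eventually P (nhds p)"
  moreover have "isCont (chart_inv \<kappa>) (snd \<kappa> p)"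
    using k(2,4) assms(2) by (auto simp: continuous_on_eq_continuous_at)
  then have "filterlim (chart_inv \<kappa>) (nhds p) (nhds (snd \<kappa> p))"
    using k(5)[OF assms(2)] tendsto_at_iff_tendsto_nhds[of "chart_inv \<kappa>" "snd \<kappa> p"]
    by (simp add: continuous_at)
  ultimately show "eventually (\<lambda>a. P (chart_inv \<kappa> a)) (nhds (snd \<kappa> p))"
    by (rule eventually_compose_filterlim)
qed

lemma open_chart_image:
  assumes "is_chart \<kappa>" "open W" "W \<subseteq> fst \<kappa>"
  shows "open (snd \<kappa> ` W)"
proof -
  note k = is_chartD[OF assms(1)]
  have "snd \<kappa> ` W = (snd \<kappa> ` fst \<kappa>) \<inter> chart_inv \<kappa> -` W"
    using k(5,6) assms(3) by (auto intro!: image_eqI)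
  then show ?thesis
    using continuous_open_preimage[OF k(4) k(2) assms(2)] by simp
qed

text \<open>The map is given on \<open>S\<close> only, so its chart expression can be compared with
  the smooth germ \<open>F\<close> just where \<open>chart_inv \<kappa>\<close> lands in
  \<open>S\<close>. For \<open>S\<close> a product with [0,1] this leads to
  \<open>smooth_ext\<close>, for open \<open>S\<close> to smoothness of the chart expression
  itself.\<close>

lemma smooth_map_chart:
  assumes f: "smooth_map A B S f" and p: "p \<in> S"
    and \<kappa>: "\<kappa> \<in> A" "is_chart \<kappa>" "p \<in> fst \<kappa>" and \<mu>: "\<mu> \<in> B" "is_chart \<mu>" "f p \<in> fst \<mu>"
  obtains F where "smooth_near (snd \<kappa> p) F"
    "eventually (\<lambda>a. chart_inv \<kappa> a \<in> S \<longrightarrow>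
       f (chart_inv \<kappa> a) \<in> fst \<mu> \<and> snd \<mu> (f (chart_inv \<kappa> a)) = F a) (nhds (snd \<kappa> p))"
proof -
  obtain N F where N: "p \<in> N" "smooth_map_open A B N F" "\<forall>q\<in>N \<inter> S. F q = f q"
    using f p unfolding smooth_map_def by blast
  \<comment> \<open>\<open>smooth_map_open\<close> gives smoothness on the chart image of exactly
    this set; once the set is open, that image is a neighbourhood of
    \<open>snd \<kappa> p\<close>.\<close>
  define W where "W = {q \<in> N \<inter> fst \<kappa>. F q \<in> fst \<mu>}"
  have oN: "open N" "continuous_on N F" using N unfolding smooth_map_open_def by auto
  have "W = fst \<kappa> \<inter> (N \<inter> F -` fst \<mu>)" unfolding W_def by auto
  then have W: "open W"
    using continuous_open_preimage[OF oN(2,1) is_chartD(1)[OF \<mu>(2)]] is_chartD(1)[OF \<kappa>(2)]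
    by auto
  have pW: "p \<in> W" using N p \<kappa> \<mu> by (auto simp: W_def)
  have sub: "W \<subseteq> fst \<kappa>" by (auto simp: W_def)
  have "smooth_on (snd \<kappa> ` W) (snd \<mu> \<circ> F \<circ> chart_inv \<kappa>)"
    using N(2) \<kappa>(1) \<mu>(1) unfolding smooth_map_open_def W_def by blast
  then have "smooth_near (snd \<kappa> p) (snd \<mu> \<circ> F \<circ> chart_inv \<kappa>)"
    using open_chart_image[OF \<kappa>(2) W sub] pW by (intro smooth_on_imp_near) auto
  moreover have "eventually (\<lambda>q. q \<in> W) (nhds p)" using W pW by (rule eventually_nhds_in_open)
  from eventually_chart_inv(2)[OF \<kappa>(2,3) this]
  have "eventually (\<lambda>a. chart_inv \<kappa> a \<in> S \<longrightarrow> f (chart_inv \<kappa> a) \<in> fst \<mu> \<and>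
      snd \<mu> (f (chart_inv \<kappa> a)) = (snd \<mu> \<circ> F \<circ> chart_inv \<kappa>) a) (nhds (snd \<kappa> p))"
    by eventually_elim (use N(3) in \<open>force simp: W_def\<close>)
  ultimately show thesis by (rule that)
qed

lemma smooth_map_chart_open:
  assumes f: "smooth_map A B S f" and p: "p \<in> S" "open S"
    and \<kappa>: "\<kappa> \<in> A" "is_chart \<kappa>" "p \<in> fst \<kappa>" and \<mu>: "\<mu> \<in> B" "is_chart \<mu>" "f p \<in> fst \<mu>"
  shows "smooth_near (snd \<kappa> p) (\<lambda>a. snd \<mu> (f (chart_inv \<kappa> a)))"
    and "eventually (\<lambda>a. f (chart_inv \<kappa> a) \<in> fst \<mu>) (nhds (snd \<kappa> p))"
proof -
  obtain F where F: "smooth_near (snd \<kappa> p) F" and ev: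
    "eventually (\<lambda>a. chart_inv \<kappa> a \<in> S \<longrightarrow>
       f (chart_inv \<kappa> a) \<in> fst \<mu> \<and> snd \<mu> (f (chart_inv \<kappa> a)) = F a) (nhds (snd \<kappa> p))"
    by (rule smooth_map_chart[OF f p(1) \<kappa> \<mu>])
  have "eventually (\<lambda>a. chart_inv \<kappa> a \<in> S) (nhds (snd \<kappa> p))"
    by (rule eventually_chart_inv(2)[OF \<kappa>(2,3)]) (rule eventually_nhds_in_open[OF p(2,1)])
  with ev have *: "eventually (\<lambda>a. f (chart_inv \<kappa> a) \<in> fst \<mu> \<and> snd \<mu> (f (chart_inv \<kappa> a)) = F a) (nhds (snd \<kappa> p))"
    by eventually_elim auto
  then have "eventually (\<lambda>a. snd \<mu> (f (chart_inv \<kappa> a)) = F a) (nhds (snd \<kappa> p))"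
    by eventually_elim auto
  with F show "smooth_near (snd \<kappa> p) (\<lambda>a. snd \<mu> (f (chart_inv \<kappa> a)))"
    by (rule smooth_near_cong)
  show "eventually (\<lambda>a. f (chart_inv \<kappa> a) \<in> fst \<mu>) (nhds (snd \<kappa> p))"
    using * by eventually_elim auto
qed

lemma smooth_map_isCont:
  assumes "smooth_map A B S f" "open S" "p \<in> S"
  shows "isCont f p"
proof -
  obtain N F where N: "p \<in> N" "smooth_map_open A B N F" "\<forall>q\<in>N \<inter> S. F q = f q"
    using assms unfolding smooth_map_def by blast
  then have "continuous_on (N \<inter> S) F" "open (N \<inter> S)"
    using assms(2) unfolding smooth_map_open_def by (auto intro: continuous_on_subset)
  moreover from this(1) have "continuous_on (N \<inter> S) f"
    by (rule continuous_on_eq) (use N in auto)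
  ultimately show ?thesis using N(1) assms(3) by (auto simp: continuous_on_eq_continuous_at)
qed

lemma smooth_map_prod_chart:
  assumes f: "smooth_map (prod_atlas A B) C UNIV f"
    and \<kappa>: "\<kappa> \<in> A" "is_chart \<kappa>" "p \<in> fst \<kappa>" and \<mu>: "\<mu> \<in> B" "is_chart \<mu>" "q \<in> fst \<mu>"
    and \<nu>: "\<nu> \<in> C" "is_chart \<nu>" "f (p, q) \<in> fst \<nu>"
  shows "smooth_near (snd \<kappa> p, snd \<mu> q) (\<lambda>(a, b). snd \<nu> (f (chart_inv \<kappa> a, chart_inv \<mu> b)))"
    and "eventually (\<lambda>(a, b). f (chart_inv \<kappa> a, chart_inv \<mu> b) \<in> fst \<nu>) (nhds (snd \<kappa> p, snd \<mu> q))"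
proof -
  let ?\<pi> = "(fst \<kappa> \<times> fst \<mu>, map_prod (snd \<kappa>) (snd \<mu>))"
  have \<pi>: "?\<pi> \<in> prod_atlas A B" using \<kappa>(1) \<mu>(1) unfolding prod_atlas_def by blast
  have pq: "(p, q) \<in> fst ?\<pi>" using \<kappa> \<mu> by simp
  have c: "smooth_near (snd \<kappa> p, snd \<mu> q) (\<lambda>x. snd \<nu> (f (chart_inv ?\<pi> x)))"
    "eventually (\<lambda>x. f (chart_inv ?\<pi> x) \<in> fst \<nu>) (nhds (snd \<kappa> p, snd \<mu> q))"
    using smooth_map_chart_open[OF f UNIV_I open_UNIV \<pi> is_chart_prod[OF \<kappa>(2) \<mu>(2)] pq \<nu>] by simp_all
  have "eventually (\<lambda>ab. ab \<in> snd \<kappa> ` fst \<kappa> \<times> snd \<mu> ` fst \<mu>) (nhds (snd \<kappa> p, snd \<mu> q))"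
    using is_chartD(2)[OF \<kappa>(2)] is_chartD(2)[OF \<mu>(2)] \<kappa>(3) \<mu>(3)
    by (intro eventually_nhds_in_open open_Times) auto
  then have ev: "eventually (\<lambda>(a, b). chart_inv ?\<pi> (a, b) = (chart_inv \<kappa> a, chart_inv \<mu> b)) (nhds (snd \<kappa> p, snd \<mu> q))"
    by eventually_elim (use chart_inv_prod[OF \<kappa>(2) \<mu>(2)] in auto)
  have *: "eventually (\<lambda>x. (case x of (a, b) \<Rightarrow> snd \<nu> (f (chart_inv \<kappa> a, chart_inv \<mu> b))) =
      snd \<nu> (f (chart_inv ?\<pi> x))) (nhds (snd \<kappa> p, snd \<mu> q))"
    using ev by eventually_elim (clarsimp split: prod.split)
  show "smooth_near (snd \<kappa> p, snd \<mu> q) (\<lambda>(a, b). snd \<nu> (f (chart_inv \<kappa> a, chart_inv \<mu> b)))"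
    using smooth_near_cong[OF c(1) *] .
  show "eventually (\<lambda>(a, b). f (chart_inv \<kappa> a, chart_inv \<mu> b) \<in> fst \<nu>) (nhds (snd \<kappa> p, snd \<mu> q))"
    using c(2) ev by eventually_elim (clarsimp split: prod.split)
qed

lemma smooth_map_vecI:
  assumes "continuous_on UNIV \<gamma>"
    and "\<And>t \<mu>. \<mu> \<in> B \<Longrightarrow> \<gamma> t \<in> fst \<mu> \<Longrightarrow> smooth_near t (\<lambda>s. snd \<mu> (\<gamma> s))"
  shows "smooth_map vec_atlas B UNIV \<gamma>"
proof -
  have "smooth_map_open vec_atlas B UNIV \<gamma>"
    unfolding smooth_map_open_def vec_atlas_def
    using assms by (auto simp: o_def intro!: smooth_near_imp_on)
  then show ?thesis unfolding smooth_map_def by blast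
qed

text \<open>An operator is a finite sum of rank-one operators built from its values on a basis and
  the coordinate functionals, so smoothness of operator-valued maps can be tested on
  vectors.\<close>

lemma smooth_near_blinfunI:
  fixes f :: "'x::real_normed_vector \<Rightarrow> 'e::real_normed_vector \<Rightarrow>\<^sub>L 'a::real_normed_vector"
  assumes fd: "fin_dim TYPE('e)" and f: "\<And>y. smooth_near p (\<lambda>x. blinfun_apply (f x) y)"
  shows "smooth_near p f"
proof -
  obtain B :: "'e set" and coord where "finite B" and **: "\<forall>b\<in>B. bounded_linear (coord b)"
    "\<forall>x. x = (\<Sum>b\<in>B. coord b x *\<^sub>R b)"
    by (rule fin_dim_coordinates[OF fd])
  note * = this(1) **[rule_format]
  have "f x = (\<Sum>b\<in>B. blinfun_scaleR_left (blinfun_apply (f x) b) o\<^sub>L Blinfun (coord b))" for x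
  proof (rule blinfun_eqI)
    fix v
    show "blinfun_apply (f x) v =
      blinfun_apply (\<Sum>b\<in>B. blinfun_scaleR_left (blinfun_apply (f x) b) o\<^sub>L Blinfun (coord b)) v"
      by (subst (1) *(3)[of v])
        (simp add: blinfun.sum_left blinfun.sum_right blinfun.scaleR_right bounded_linear_Blinfun_apply[OF *(2)])
  qed
  then have "f = (\<lambda>x. \<Sum>b\<in>B. blinfun_scaleR_left (blinfun_apply (f x) b) o\<^sub>L Blinfun (coord b))"
    by (rule ext)
  moreover have "smooth_near p (\<lambda>x. \<Sum>b\<in>B. blinfun_scaleR_left (blinfun_apply (f x) b) o\<^sub>L Blinfun (coord b))"
    by (intro smooth_near_sum smooth_near_bilinear[OF bounded_bilinear_blinfun_compose] smooth_near_const
        smooth_near_bounded_linear[OF bounded_linear_blinfun_scaleR_left] f)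
  ultimately show ?thesis by simp
qed

text \<open>The term of the product rule that contains the vanishing factor drops out. Each of the
  two differentiations behind the second differential takes place at such a zero.\<close>

lemma D_bilinear_vanishing:
  assumes B: "bounded_bilinear B" and f: "f differentiable at p" and g: "g differentiable at p"
  shows "g p = 0 \<Longrightarrow> D (\<lambda>x. B (f x) (g x)) p v = B (f p) (D g p v)"
    and "f p = 0 \<Longrightarrow> D (\<lambda>x. B (f x) (g x)) p v = B (D f p v) (g p)"
  using D_eq[OF bounded_bilinear.FDERIV[OF B D_works[OF f] D_works[OF g]]]
  by (simp_all add: bounded_bilinear.zero_left[OF B] bounded_bilinear.zero_right[OF B])

lemma smooth_map_continuous_within:
  fixes f :: "'m::t2_space \<Rightarrow> 'n::topological_space"
  assumes "smooth_map A B S f" "p \<in> S"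
  shows "(f \<longlongrightarrow> f p) (at p within S)"
proof -
  obtain N F where N: "p \<in> N" "smooth_map_open A B N F" "\<forall>q\<in>N \<inter> S. F q = f q"
    using assms unfolding smooth_map_def by blast
  then have "isCont F p" "open N"
    unfolding smooth_map_open_def by (auto simp: continuous_on_eq_continuous_at)
  then have "(F \<longlongrightarrow> f p) (at p within S)"
    using N(1,3) assms(2) by (auto simp: isCont_def intro: tendsto_within_subset)
  moreover have "eventually (\<lambda>q. F q = f q) (at p within S)"
    using eventually_nhds_in_open[OF \<open>open N\<close> N(1)] N(3) by (auto simp: eventually_at_filter elim: eventually_mono)
  ultimately show ?thesis by (metis (mono_tags, lifting) tendsto_cong)
qed

section \<open>The chart at the unit and one-parameter subgroups\<close>

lemma smooth_map_vec_chart: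
  assumes "smooth_map vec_atlas B S f" "t \<in> S" "open S" "\<mu> \<in> B" "is_chart \<mu>" "f t \<in> fst \<mu>"
  shows "smooth_near t (\<lambda>a. snd \<mu> (f a))" "eventually (\<lambda>a. f a \<in> fst \<mu>) (nhds t)"
proof -
  have "(UNIV, id) \<in> vec_atlas" by (simp add: vec_atlas_def)
  from smooth_map_chart_open[OF assms(1,2,3) this is_chart_vec _ assms(4-6)]
  show "smooth_near t (\<lambda>a. snd \<mu> (f a))" "eventually (\<lambda>a. f a \<in> fst \<mu>) (nhds t)" by simp_all
qed

context lie_group
begin

declare carrier_UNIV [simp]

text \<open>This is the chart by which \<open>tangent_map\<close> and \<open>delta2\<close> identify
  the tangent space at the unit with the model space, so differentials there are plain derivatives
  of chart expressions. Its value \<open>u\<close> at the unit need not be 0.\<close>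

definition unit_chart :: "('g, 'e) chart" where
  "unit_chart = chart_at (atlas G) \<one>"

abbreviation "phi \<equiv> snd unit_chart"
abbreviation "psi \<equiv> chart_inv unit_chart"
abbreviation "dom1 \<equiv> fst unit_chart"
abbreviation "u \<equiv> phi \<one>"

lemma fin_dim_model: "fin_dim TYPE('e)"
  using finite_dim by (simp add: fin_dim_def)

lemma chart_at_G: "chart_at (atlas G) g \<in> atlas G" "g \<in> fst (chart_at (atlas G) g)"
  "is_chart (chart_at (atlas G) g)"
proof -
  obtain \<kappa> where "\<kappa> \<in> atlas G \<and> g \<in> fst \<kappa>"
    using atlas unfolding smooth_atlas_def by (metis UNIV_I UN_E)
  from someI[where P = "\<lambda>\<kappa>. \<kappa> \<in> atlas G \<and> g \<in> fst \<kappa>", OF this]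
  show 1: "chart_at (atlas G) g \<in> atlas G" "g \<in> fst (chart_at (atlas G) g)"
    unfolding chart_at_def by auto
  show "is_chart (chart_at (atlas G) g)"
    using atlas 1(1) unfolding smooth_atlas_def by blast
qed

lemmas unit_chart = chart_at_G[of \<one>, folded unit_chart_def]
lemmas unit_chartD = is_chartD[OF unit_chart(3)]

lemma eventually_phi_psi: "eventually (\<lambda>a. psi a \<in> dom1 \<and> phi (psi a) = a) (nhds u)"
  using eventually_chart_inv(1)[OF unit_chart(3,2)]
  by eventually_elim (use unit_chartD(6,7) in blast)

lemma mult_cancel [simp]: "inv h \<otimes> (h \<otimes> g) = g" "h \<otimes> (inv h \<otimes> g) = g"
  by (simp_all add: m_assoc[symmetric])

lemma tendsto_mult_G:
  assumes "(f \<longlongrightarrow> a) F" "(g \<longlongrightarrow> b) F"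
  shows "((\<lambda>x. f x \<otimes> g x) \<longlongrightarrow> a \<otimes> b) F"
proof -
  have "isCont (\<lambda>(g, h). g \<otimes> h) (a, b)"
    using smooth_map_isCont[OF smooth_mult] by simp
  from isCont_tendsto_compose[OF this tendsto_Pair[OF assms]] show ?thesis by simp
qed

text \<open>The last condition is independent of the second: outside its domain \<open>phi\<close>
  is arbitrary, and only inside does \<open>psi\<close> recover \<open>f x\<close> from
  \<open>phi (f x)\<close>.\<close>

definition unit_germ :: "'x::real_normed_vector \<Rightarrow> ('x \<Rightarrow> 'g) \<Rightarrow> bool" where
  "unit_germ p f \<longleftrightarrow> f p = \<one> \<and> smooth_near p (\<lambda>x. phi (f x)) \<and> eventually (\<lambda>x. f x \<in> dom1) (nhds p)"

lemma unit_germD: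
  assumes "unit_germ p f"
  shows "f p = \<one>" "smooth_near p (\<lambda>x. phi (f x))" "eventually (\<lambda>x. f x \<in> dom1) (nhds p)"
    "eventually (\<lambda>x. psi (phi (f x)) = f x) (nhds p)"
proof -
  show "f p = \<one>" "smooth_near p (\<lambda>x. phi (f x))" and *: "eventually (\<lambda>x. f x \<in> dom1) (nhds p)"
    using assms unfolding unit_germ_def by auto
  show "eventually (\<lambda>x. psi (phi (f x)) = f x) (nhds p)"
    using * by eventually_elim (rule unit_chartD(5))
qed

lemma unit_germ_psi: "unit_germ u psi"
  unfolding unit_germ_def
proof (intro conjI)
  show "psi u = \<one>" by (rule unit_chartD(5)[OF unit_chart(2)])
  have "eventually (\<lambda>a. phi (psi a) = a) (nhds u)" using eventually_phi_psi by eventually_elim auto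
  with smooth_near_ident show "smooth_near u (\<lambda>a. phi (psi a))" by (rule smooth_near_cong)
  show "eventually (\<lambda>a. psi a \<in> dom1) (nhds u)" using eventually_phi_psi by eventually_elim auto
qed

lemma unit_germ_compose:
  fixes k :: "'x::real_normed_vector \<Rightarrow> 'y::real_normed_vector"
  assumes "fin_dim TYPE('y)" "smooth_near p k" "unit_germ (k p) f"
  shows "unit_germ p (\<lambda>x. f (k x))"
  using unit_germD(1,2)[OF assms(3)] smooth_near_compose[OF assms(1,2) unit_germD(2)[OF assms(3)]]
    smooth_near_eventually_compose[OF assms(2) unit_germD(3)[OF assms(3)]]
  unfolding unit_germ_def by simp

lemma unit_germ_psi_compose: "smooth_near p k \<Longrightarrow> k p = u \<Longrightarrow> unit_germ p (\<lambda>x. psi (k x))"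
  using unit_germ_compose[OF fin_dim_model, of p k psi] unit_germ_psi by simp

section \<open>Group operations near the unit\<close>

lemma mult_chart:
  "smooth_near (u, u) (\<lambda>(a, b). phi (psi a \<otimes> psi b))"
  "eventually (\<lambda>(a, b). psi a \<otimes> psi b \<in> dom1) (nhds (u, u))"
proof -
  have "(case (\<one>, \<one>) of (g, h) \<Rightarrow> g \<otimes> h) \<in> dom1" using unit_chart(2) by simp
  from smooth_map_prod_chart[OF smooth_mult unit_chart(1,3,2) unit_chart(1,3,2) unit_chart(1,3) this]
  show "smooth_near (u, u) (\<lambda>(a, b). phi (psi a \<otimes> psi b))"
    "eventually (\<lambda>(a, b). psi a \<otimes> psi b \<in> dom1) (nhds (u, u))"
    by simp_all
qed

text \<open>Multiplication read in the chart has \<open>u\<close> as a two-sided unit, so both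
  partial derivatives at \<open>(u, u)\<close> are the identity and the differential of
  multiplication is addition.\<close>

lemma unit_germ_mult:
  assumes f: "unit_germ p f" and g: "unit_germ p g"
  shows "unit_germ p (\<lambda>x. f x \<otimes> g x)"
    and "D (\<lambda>x. phi (f x \<otimes> g x)) p v = D (\<lambda>x. phi (f x)) p v + D (\<lambda>x. phi (g x)) p v"
proof -
  let ?k = "\<lambda>x. (phi (f x), phi (g x))" and ?m = "\<lambda>(a, b). phi (psi a \<otimes> psi b)"
  have k: "smooth_near p ?k" using unit_germD(2)[OF f] unit_germD(2)[OF g] by (rule smooth_near_Pair)
  have kp: "?k p = (u, u)" using unit_germD(1)[OF f] unit_germD(1)[OF g] by simp
  note ev = unit_germD(4)[OF f] unit_germD(4)[OF g]
  have eq: "eventually (\<lambda>x. phi (f x \<otimes> g x) = ?m (?k x)) (nhds p)"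
    using ev by eventually_elim simp
  have m: "smooth_near (?k p) ?m" unfolding kp by (rule mult_chart)
  have "smooth_near p (\<lambda>x. ?m (?k x))"
    by (rule smooth_near_compose[OF fin_dim_prod[OF fin_dim_model fin_dim_model] k m])
  then have 1: "smooth_near p (\<lambda>x. phi (f x \<otimes> g x))" using eq by (rule smooth_near_cong)
  have "eventually (\<lambda>ab. psi (fst ab) \<otimes> psi (snd ab) \<in> dom1) (nhds (?k p))"
    unfolding kp using mult_chart(2) by (simp add: case_prod_unfold)
  from smooth_near_eventually_compose[OF k this] ev
  have 2: "eventually (\<lambda>x. f x \<otimes> g x \<in> dom1) (nhds p)"
    by eventually_elim simp
  show "unit_germ p (\<lambda>x. f x \<otimes> g x)" unfolding unit_germ_def using 1 2 unit_germD(1)[OF f] unit_germD(1)[OF g] by simp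
  have pu: "psi u = \<one>" by (rule unit_germD(1)[OF unit_germ_psi])
  have lin: "linear (D ?m (u, u))"
    by (intro bounded_linear.linear bounded_linear_D smooth_near_differentiable mult_chart)
  have s1: "D ?m (u, u) (w, 0) = w" for w
  proof -
    have "eventually (\<lambda>a. ?m (a, u) = a) (nhds u)"
      using eventually_phi_psi by eventually_elim (simp add: pu)
    then have "((\<lambda>a. ?m (a, u)) has_derivative (\<lambda>w. w)) (at u)"
      by (subst has_derivative_cong_nhds[where g = "\<lambda>a. a"]) auto
    then have "D (\<lambda>a. ?m (a, u)) u = (\<lambda>w. w)" by (rule D_eq)
    moreover have "D (\<lambda>a. ?m (a, u)) u = (\<lambda>w. D ?m (u, u) (w, 0))"
      by (rule D_eq[OF has_derivative_slice1[OF mult_chart(1)]])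
    ultimately show ?thesis by metis
  qed
  have s2: "D ?m (u, u) (0, w) = w" for w
  proof -
    have "eventually (\<lambda>a. ?m (u, a) = a) (nhds u)"
      using eventually_phi_psi by eventually_elim (simp add: pu)
    then have "((\<lambda>a. ?m (u, a)) has_derivative (\<lambda>w. w)) (at u)"
      by (subst has_derivative_cong_nhds[where g = "\<lambda>a. a"]) auto
    then have "D (\<lambda>a. ?m (u, a)) u = (\<lambda>w. w)" by (rule D_eq)
    moreover have "D (\<lambda>a. ?m (u, a)) u = (\<lambda>w. D ?m (u, u) (0, w))"
      by (rule D_eq[OF has_derivative_slice2[OF mult_chart(1)]])
    ultimately show ?thesis by metis
  qed
  have sum: "D ?m (u, u) (w, w') = w + w'" for w w'
    using linear_add[OF lin, of "(w, 0)" "(0, w')"] s1 s2 by simp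
  have "D ?k p v = (D (\<lambda>x. phi (f x)) p v, D (\<lambda>x. phi (g x)) p v)"
    using D_eq[OF has_derivative_Pair[OF smooth_near_has_derivative[OF unit_germD(2)[OF f]]
          smooth_near_has_derivative[OF unit_germD(2)[OF g]]]] by simp
  moreover have "D (\<lambda>x. phi (f x \<otimes> g x)) p v = D (\<lambda>x. ?m (?k x)) p v"
    using D_cong[OF eq] by simp
  moreover have "D (\<lambda>x. ?m (?k x)) p v = D ?m (u, u) (D ?k p v)"
    using D_compose[OF k m] kp by simp
  ultimately show "D (\<lambda>x. phi (f x \<otimes> g x)) p v = D (\<lambda>x. phi (f x)) p v + D (\<lambda>x. phi (g x)) p v"
    using sum by simp
qed

lemma unit_germ_inv:
  assumes f: "unit_germ p f"
  shows "unit_germ p (\<lambda>x. inv (f x))"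
proof -
  have "inv \<one> \<in> dom1" using unit_chart(2) by simp
  note c = smooth_map_chart_open[OF smooth_inv UNIV_I open_UNIV unit_chart(1,3,2) unit_chart(1,3) this]
  have fp: "phi (f p) = u" using unit_germD(1)[OF f] by simp
  have "smooth_near p (\<lambda>x. phi (inv (psi (phi (f x)))))"
    using smooth_near_compose[OF fin_dim_model unit_germD(2)[OF f], of "\<lambda>a. phi (inv (psi a))"] c(1) fp by simp
  moreover have "eventually (\<lambda>x. phi (inv (f x)) = phi (inv (psi (phi (f x))))) (nhds p)"
    using unit_germD(4)[OF f] by eventually_elim simp
  ultimately have 1: "smooth_near p (\<lambda>x. phi (inv (f x)))" by (rule smooth_near_cong)
  have "eventually (\<lambda>x. inv (psi (phi (f x))) \<in> dom1) (nhds p)"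
    using smooth_near_eventually_compose[OF unit_germD(2)[OF f], of "\<lambda>a. inv (psi a) \<in> dom1"] c(2) fp by simp
  then have "eventually (\<lambda>x. inv (f x) \<in> dom1) (nhds p)"
    using unit_germD(4)[OF f] by eventually_elim simp
  with 1 show ?thesis unfolding unit_germ_def using unit_germD(1)[OF f] by simp
qed

lemma unit_germ_conj: "unit_germ p f \<Longrightarrow> unit_germ p g \<Longrightarrow> unit_germ p (\<lambda>x. conj_by G (f x) (g x))"
  unfolding conj_by_def by (intro unit_germ_mult unit_germ_inv)

text \<open>In contrast to \<open>mult_chart\<close> this applies at arbitrary group elements: in
  the joint smoothness of multiplication the left factor is held fixed at its coordinate in the
  chart at \<open>g\<close>.\<close>

lemma smooth_left_mult:
  assumes \<kappa>: "\<kappa> \<in> atlas G" "is_chart \<kappa>" "p \<in> fst \<kappa>" and \<mu>: "\<mu> \<in> atlas G" "is_chart \<mu>" "g \<otimes> p \<in> fst \<mu>"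
  shows "smooth_near (snd \<kappa> p) (\<lambda>a. snd \<mu> (g \<otimes> chart_inv \<kappa> a))"
    and "eventually (\<lambda>a. g \<otimes> chart_inv \<kappa> a \<in> fst \<mu>) (nhds (snd \<kappa> p))"
proof -
  let ?\<nu> = "chart_at (atlas G) g"
  have "(case (g, p) of (g, h) \<Rightarrow> g \<otimes> h) \<in> fst \<mu>" using \<mu> by simp
  note c = smooth_map_prod_chart[OF smooth_mult chart_at_G(1,3,2)[of g] \<kappa> \<mu>(1,2) this]
  have e: "chart_inv ?\<nu> (snd ?\<nu> g) = g" by (rule is_chartD(5)[OF chart_at_G(3,2)])
  have k: "smooth_near (snd \<kappa> p) (\<lambda>a. (snd ?\<nu> g, a))"
    by (intro smooth_near_Pair smooth_near_const smooth_near_ident)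
  show "smooth_near (snd \<kappa> p) (\<lambda>a. snd \<mu> (g \<otimes> chart_inv \<kappa> a))"
    using smooth_near_compose[OF fin_dim_prod[OF fin_dim_model fin_dim_model] k c(1)] by (simp add: e)
  show "eventually (\<lambda>a. g \<otimes> chart_inv \<kappa> a \<in> fst \<mu>) (nhds (snd \<kappa> p))"
    using smooth_near_eventually_compose[OF k c(2)] by (simp add: e)
qed

text \<open>Since \<open>velocity\<close> and \<open>tangent_map\<close> use a different chart at each point, this is what
  makes the integrals along paths computable in the single chart at the unit.\<close>

lemma tangent_velocity:
  assumes t: "t \<in> {0..1}" and cont: "(\<gamma> \<longlongrightarrow> \<gamma> t) (at t within {0..1})"
    and w: "((\<lambda>s. phi (inv (\<gamma> t) \<otimes> \<gamma> s)) has_vector_derivative w) (at t within {0..1})"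
  shows "tangent_map (atlas G) (atlas G) (\<lambda>q. inv (\<gamma> t) \<otimes> q) (\<gamma> t) (velocity (atlas G) \<gamma> t) = w"
proof -
  let ?\<mu> = "chart_at (atlas G) (\<gamma> t)"
  \<comment> \<open>\<open>P\<close> is left translation by \<open>\<gamma> t\<close> from the unit
    chart to the chart at \<open>\<gamma> t\<close>, and \<open>N\<close> is the inverse
    translation. The velocity is \<open>D P u w\<close>, the tangent map is
    \<open>D N (P u)\<close>, and the chain rule for the identity germ \<open>N (P b) = b\<close>
    cancels one against the other.\<close>
  define P where "P = (\<lambda>b. snd ?\<mu> (\<gamma> t \<otimes> psi b))"
  define N where "N = (\<lambda>a. phi (inv (\<gamma> t) \<otimes> chart_inv ?\<mu> a))"
  define a where "a = (\<lambda>s. phi (inv (\<gamma> t) \<otimes> \<gamma> s))"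
  have at: "a t = u" by (simp add: a_def)
  have m: "\<gamma> t \<otimes> \<one> \<in> fst ?\<mu>" using chart_at_G(2) by simp
  note P = smooth_left_mult[OF unit_chart(1,3,2) chart_at_G(1,3) m]
  have sP: "smooth_near u P" unfolding P_def by (rule P(1))
  have Pu: "P u = snd ?\<mu> (\<gamma> t)" using unit_germD(1)[OF unit_germ_psi] by (simp add: P_def)
  have "inv (\<gamma> t) \<otimes> \<gamma> t \<in> dom1" using unit_chart(2) by simp
  note N = smooth_left_mult[OF chart_at_G(1,3,2) unit_chart(1,3) this]
  have sN: "smooth_near (P u) N" unfolding N_def Pu by (rule N(1))
  \<comment> \<open>Continuity keeps the translated path in the domain of the unit chart, where
    \<open>psi\<close> undoes \<open>phi\<close>.\<close>
  have "((\<lambda>s. inv (\<gamma> t) \<otimes> \<gamma> s) \<longlongrightarrow> inv (\<gamma> t) \<otimes> \<gamma> t) (at t within {0..1})"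
    by (intro tendsto_mult_G cont tendsto_const)
  then have "eventually (\<lambda>s. inv (\<gamma> t) \<otimes> \<gamma> s \<in> dom1) (at t within {0..1})"
    using unit_chart(2) unit_chartD(1) by (auto simp: tendsto_def)
  then have ev: "eventually (\<lambda>s. P (a s) = snd ?\<mu> (\<gamma> s)) (at t within {0..1})"
    by eventually_elim (simp add: P_def a_def unit_chartD(5))
  have "((\<lambda>s. P (a s)) has_derivative (\<lambda>r. D P u (r *\<^sub>R w))) (at t within {0..1})"
    using has_derivative_compose[where f = a and g = P and s = "{0..1}" and x = t]
      w smooth_near_has_derivative[OF sP] at
    unfolding a_def[symmetric] has_vector_derivative_def by simp
  then have "((\<lambda>s. snd ?\<mu> (\<gamma> s)) has_derivative (\<lambda>r. D P u (r *\<^sub>R w))) (at t within {0..1})"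
    by (rule has_derivative_transform_eventually[OF _ ev _ t]) (simp add: at Pu)
  moreover have "D P u (r *\<^sub>R w) = r *\<^sub>R D P u w" for r
    by (rule linear_scale[OF bounded_linear.linear[OF bounded_linear_D[OF smooth_near_differentiable[OF sP]]]])
  ultimately have "((\<lambda>s. snd ?\<mu> (\<gamma> s)) has_vector_derivative D P u w) (at t within {0..1})"
    unfolding has_vector_derivative_def by (simp only:)
  then have v: "velocity (atlas G) \<gamma> t = D P u w"
    unfolding velocity_def o_def using vderiv01_eq t by blast
  have "eventually (\<lambda>b. N (P b) = b) (nhds u)"
    using P(2) eventually_phi_psi
  proof eventually_elim
    case (elim b)
    then show ?case using is_chartD(5)[OF chart_at_G(3)] by (simp add: N_def P_def)
  qed
  then have "D (\<lambda>b. N (P b)) u = D (\<lambda>b. b) u" by (rule D_cong)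
  then have "D N (P u) (D P u w) = w" using D_compose[OF sP sN] by (simp add: D_eq)
  moreover have "tangent_map (atlas G) (atlas G) (\<lambda>q. inv (\<gamma> t) \<otimes> q) (\<gamma> t) = D N (P u)"
    unfolding tangent_map_def N_def Pu by (simp add: o_def unit_chart_def)
  ultimately show ?thesis using v by simp
qed

section \<open>One-parameter subgroups and the exponential map\<close>

lemma one_paramD:
  assumes "one_param_subgroup G x \<gamma>"
  shows "\<gamma> (s + t) = \<gamma> s \<otimes> \<gamma> t" "\<gamma> 0 = \<one>" "unit_germ 0 \<gamma>" "D (\<lambda>t. phi (\<gamma> t)) 0 1 = x"
    "isCont \<gamma> t" "inv (\<gamma> t) = \<gamma> (- t)"
proof -
  have sm: "smooth_map vec_atlas (atlas G) UNIV \<gamma>" and hom: "\<And>s t. \<gamma> (s + t) = \<gamma> s \<otimes> \<gamma> t"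
    and tan: "tangent_map vec_atlas (atlas G) \<gamma> 0 1 = x"
    using assms unfolding one_param_subgroup_def by auto
  show "\<gamma> (s + t) = \<gamma> s \<otimes> \<gamma> t" by (rule hom)
  show 0: "\<gamma> 0 = \<one>" using hom[of 0 0] by simp
  show "unit_germ 0 \<gamma>"
    using smooth_map_vec_chart[OF sm UNIV_I open_UNIV unit_chart(1,3), of 0] 0 unit_chart(2)
    unfolding unit_germ_def by simp
  show "D (\<lambda>t. phi (\<gamma> t)) 0 1 = x"
    using tan 0 unfolding tangent_map_def by (simp add: o_def unit_chart_def)
  show "isCont \<gamma> t" by (rule smooth_map_isCont[OF sm]) auto
  have "\<gamma> (- t) \<otimes> \<gamma> t = \<one>" using hom[of "- t" t] 0 by simp
  then show "inv (\<gamma> t) = \<gamma> (- t)" by (intro inv_equality) auto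
qed

lemma one_param_scale:
  assumes "one_param_subgroup G x \<gamma>"
  shows "one_param_subgroup G (r *\<^sub>R x) (\<lambda>t. \<gamma> (r * t))"
  unfolding one_param_subgroup_def
proof (intro conjI allI)
  note g = one_paramD[OF assms]
  have sm: "smooth_map vec_atlas (atlas G) UNIV \<gamma>" using assms unfolding one_param_subgroup_def by auto
  have lin: "smooth_near t (\<lambda>s::real. r * s)" for t
    by (rule smooth_near_linear) (rule bounded_linear_mult_right)
  show "smooth_map vec_atlas (atlas G) UNIV (\<lambda>t. \<gamma> (r * t))"
  proof (rule smooth_map_vecI)
    show "continuous_on UNIV (\<lambda>t. \<gamma> (r * t))"
      by (rule continuous_on_compose2[of UNIV \<gamma>])
        (auto intro!: continuous_at_imp_continuous_on g(5) continuous_intros)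
    fix t \<mu> assume \<mu>: "\<mu> \<in> atlas G" "\<gamma> (r * t) \<in> fst \<mu>"
    have "is_chart \<mu>" using atlas \<mu>(1) unfolding smooth_atlas_def by blast
    from smooth_map_vec_chart(1)[OF sm UNIV_I open_UNIV \<mu>(1) this \<mu>(2)]
    show "smooth_near t (\<lambda>s. snd \<mu> (\<gamma> (r * s)))"
      by (rule smooth_near_compose[OF fin_dim_real lin])
  qed
  show "\<gamma> (r * (s + t)) = \<gamma> (r * s) \<otimes> \<gamma> (r * t)" for s t
    using g(1) by (simp add: distrib_left)
  have s0: "smooth_near (r * 0) (\<lambda>t. phi (\<gamma> t))" using unit_germD(2)[OF g(3)] by simp
  have "D (\<lambda>t. phi (\<gamma> (r * t))) 0 1 = D (\<lambda>t. phi (\<gamma> t)) 0 (D (\<lambda>s. r * s) 0 1)"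
    using D_compose[OF lin s0] by simp
  also have "D (\<lambda>s. r * s) 0 1 = r *\<^sub>R 1"
    by (subst D_eq[OF bounded_linear_imp_has_derivative[OF bounded_linear_mult_right]]) simp
  also have "D (\<lambda>t. phi (\<gamma> t)) 0 (r *\<^sub>R 1) = r *\<^sub>R x"
    using linear_scale[OF bounded_linear.linear[OF bounded_linear_D[OF smooth_near_differentiable[OF unit_germD(2)[OF g(3)]]]], of r 1]
    by (simp only: g(4))
  finally show "tangent_map vec_atlas (atlas G) (\<lambda>t. \<gamma> (r * t)) 0 1 = r *\<^sub>R x"
    unfolding tangent_map_def by (simp add: o_def g(2) unit_chart_def)
qed

lemma one_param_zero: "one_param_subgroup G 0 (\<lambda>t. \<one>)"
  unfolding one_param_subgroup_def
  by (auto simp: tangent_map_def o_def intro!: smooth_map_vecI smooth_near_const)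

text \<open>The discrepancy \<open>p t = \<gamma> (- t) \<otimes> \<beta> t\<close> starts at the
  unit with velocity -x + x = 0. The identity
  \<open>p (t + s) = \<gamma> (- t) \<otimes> p s \<otimes> \<beta> t\<close> carries the vanishing
  of the velocity from time 0 to time \<open>t\<close>, so \<open>p\<close> is constant while it
  stays in the chart.\<close>

lemma one_param_unique_near_0:
  assumes "one_param_subgroup G x \<gamma>" "one_param_subgroup G x \<beta>"
  shows "\<exists>e>0. \<forall>t. \<bar>t\<bar> < e \<longrightarrow> \<gamma> t = \<beta> t"
proof -
  note g = one_paramD[OF assms(1)] and b = one_paramD[OF assms(2)]
  define p where "p = (\<lambda>t. \<gamma> (- t) \<otimes> \<beta> t)"
  define a where "a = (\<lambda>t. phi (p t))"
  have neg: "smooth_near t (\<lambda>s::real. - s)" for t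
    by (rule smooth_near_linear) (rule bounded_linear_minus[OF bounded_linear_ident])
  have gm: "unit_germ 0 (\<lambda>t. \<gamma> (- t))"
    using unit_germ_compose[OF fin_dim_real neg, of 0 \<gamma>] g(3) by simp
  have gp: "unit_germ 0 p" unfolding p_def using gm b(3) by (rule unit_germ_mult)
  have sg: "smooth_near (- 0) (\<lambda>t. phi (\<gamma> t))" using unit_germD(2)[OF g(3)] by simp
  have "D (\<lambda>t. phi (\<gamma> (- t))) 0 1 = D (\<lambda>t. phi (\<gamma> t)) 0 (D uminus 0 1)"
    using D_compose[OF neg sg] by simp
  also have "D uminus (0::real) 1 = (- 1) *\<^sub>R 1"
    by (subst D_eq[OF bounded_linear_imp_has_derivative[OF bounded_linear_minus[OF bounded_linear_ident]]]) simp
  also have "D (\<lambda>t. phi (\<gamma> t)) 0 ((- 1) *\<^sub>R 1) = - x"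
    using linear_scale[OF bounded_linear.linear[OF bounded_linear_D[OF smooth_near_differentiable[OF unit_germD(2)[OF g(3)]]]], of "-1" 1]
    by (simp only: g(4) scaleR_minus_left scaleR_one)
  finally have da1: "D a 0 1 = 0"
    unfolding a_def p_def unit_germ_mult(2)[OF gm b(3)] by (simp add: b(4))
  have lin: "linear (D a 0)"
    unfolding a_def by (intro bounded_linear.linear bounded_linear_D smooth_near_differentiable unit_germD(2) gp)
  have da: "D a 0 r = 0" for r
    using linear_scale[OF lin, of r 1] da1 by simp
  \<comment> \<open>Translation on both sides, read in the chart, with the time as a further
    variable. Joint smoothness at time 0 gives one \<open>e\<close> that serves all small
    times.\<close>
  define \<Theta> where "\<Theta> = (\<lambda>tb. phi (\<gamma> (- fst tb) \<otimes> psi (snd tb) \<otimes> \<beta> (fst tb)))"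
  have "unit_germ (0, u) (\<lambda>tb. \<gamma> (- fst tb) \<otimes> psi (snd tb) \<otimes> \<beta> (fst tb))"
  proof (intro unit_germ_mult)
    have f: "smooth_near (0::real, u) fst" by (rule smooth_near_linear) (rule bounded_linear_fst)
    show "unit_germ (0, u) (\<lambda>tb. \<gamma> (- fst tb))"
      using unit_germ_compose[OF fin_dim_real f, of "\<lambda>t. \<gamma> (- t)"] gm by simp
    show "unit_germ (0, u) (\<lambda>tb. \<beta> (fst tb))"
      using unit_germ_compose[OF fin_dim_real f, of \<beta>] b(3) by simp
    show "unit_germ (0, u) (\<lambda>tb::real \<times> 'e. psi (snd tb))"
      by (rule unit_germ_psi_compose) (auto intro: smooth_near_linear bounded_linear_snd)
  qed
  from unit_germD(2)[OF this] have "smooth_near (0, u) \<Theta>" unfolding \<Theta>_def .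
  from eventually_nhds_Pair1[OF smooth_near_eventually[OF this]]
  have "eventually (\<lambda>t. smooth_near (t, u) \<Theta>) (nhds 0)" .
  with unit_germD(3)[OF gp] have "eventually (\<lambda>t. smooth_near (t, u) \<Theta> \<and> p t \<in> dom1) (nhds 0)"
    by eventually_elim simp
  then obtain e where e: "e > 0" "\<And>t. dist t 0 < e \<Longrightarrow> smooth_near (t, u) \<Theta> \<and> p t \<in> dom1"
    unfolding eventually_nhds_metric by blast
  have der: "(a has_derivative (\<lambda>_. 0)) (at t)" if t: "t \<in> ball 0 e" for t
  proof -
    have a0: "a 0 = u" using unit_germD(1)[OF gp] by (simp add: a_def)
    have \<Theta>: "smooth_near (t, u) \<Theta>" using e(2)[of t] t by (simp add: dist_commute)
    have "((\<lambda>s. \<Theta> (t, a s)) has_derivative (\<lambda>r. D \<Theta> (t, u) (0, D a 0 r))) (at 0)"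
    proof (rule has_derivative_compose[where f = a and g = "\<lambda>b. \<Theta> (t, b)" and f' = "D a 0"
            and g' = "\<lambda>v. D \<Theta> (t, u) (0, v)"])
      show "(a has_derivative D a 0) (at 0)"
        unfolding a_def by (intro smooth_near_has_derivative unit_germD(2) gp)
      show "((\<lambda>b. \<Theta> (t, b)) has_derivative (\<lambda>v. D \<Theta> (t, u) (0, v))) (at (a 0))"
        unfolding a0 by (rule has_derivative_slice2[OF \<Theta>])
    qed
    moreover have "D \<Theta> (t, u) (0, D a 0 r) = 0" for r
      using linear_0[OF bounded_linear.linear[OF bounded_linear_D[OF smooth_near_differentiable[OF \<Theta>]]]]
      by (simp add: da zero_prod_def)
    ultimately have d\<Theta>: "((\<lambda>s. \<Theta> (t, a s)) has_derivative (\<lambda>r. 0)) (at 0)"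
      by simp
    have "eventually (\<lambda>s. a (t + s) = \<Theta> (t, a s)) (nhds 0)"
      using unit_germD(4)[OF gp]
    proof eventually_elim
      case (elim s)
      have "\<gamma> (- (t + s)) = \<gamma> (- t) \<otimes> \<gamma> (- s)" using g(1)[of "- t" "- s"] by simp
      moreover have "\<beta> (t + s) = \<beta> s \<otimes> \<beta> t" using b(1)[of s t] by (simp add: add.commute)
      ultimately have "p (t + s) = \<gamma> (- t) \<otimes> p s \<otimes> \<beta> t"
        unfolding p_def by (simp add: m_assoc)
      then show ?case unfolding a_def \<Theta>_def using elim by simp
    qed
    then have "((\<lambda>s. a (t + s)) has_derivative (\<lambda>r. 0)) (at 0)"
      using d\<Theta> by (subst has_derivative_cong_nhds)
    then have "((\<lambda>s. a (t + s)) has_derivative (\<lambda>r. 0)) (at (t - t))" by simp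
    then have "((\<lambda>s. a (t + (s - t))) has_derivative (\<lambda>r. 0)) (at t)"
      by (rule has_derivative_compose[where f = "\<lambda>s. s - t" and g = "\<lambda>s. a (t + s)", rotated])
        (auto intro!: derivative_eq_intros)
    then show ?thesis by simp
  qed
  have "\<gamma> t = \<beta> t" if t: "\<bar>t\<bar> < e" for t
  proof -
    have "\<And>x. x \<in> ball 0 e \<Longrightarrow> (a has_derivative (\<lambda>_. 0)) (at x within ball 0 e)"
      using der by (auto intro: has_derivative_at_withinI)
    from has_derivative_zero_constant[OF convex_ball this]
    obtain c where "\<And>x. x \<in> ball 0 e \<Longrightarrow> a x = c" by blast
    then have "a t = a 0" using t e(1) by simp
    then have "phi (p t) = phi \<one>" using unit_germD(1)[OF gp] by (simp add: a_def)
    then have "p t = \<one>"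
      using unit_chartD(8) e(2)[of t] t unit_chart(2) by (auto dest: inj_onD)
    then have "inv (\<gamma> t) \<otimes> \<beta> t = \<one>" unfolding p_def g(6) .
    then have "\<gamma> t \<otimes> (inv (\<gamma> t) \<otimes> \<beta> t) = \<gamma> t \<otimes> \<one>" by simp
    then show ?thesis by simp
  qed
  with e(1) show ?thesis by blast
qed

text \<open>The value at \<open>t\<close> is the square of the value at \<open>t / 2\<close>, so
  agreement spreads from an interval around 0 to the doubled interval, and these intervals exhaust
  the line.\<close>

lemma one_param_unique:
  assumes "one_param_subgroup G x \<gamma>" "one_param_subgroup G x \<beta>"
  shows "\<gamma> = \<beta>"
proof
  fix t
  obtain e where e: "e > 0" "\<And>t. \<bar>t\<bar> < e \<Longrightarrow> \<gamma> t = \<beta> t"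
    using one_param_unique_near_0[OF assms] by blast
  have dbl: "\<bar>t\<bar> < 2 ^ n * e \<Longrightarrow> \<gamma> t = \<beta> t" for n t
  proof (induction n arbitrary: t)
    case (Suc n)
    then have "\<gamma> (t / 2) = \<beta> (t / 2)" by (intro Suc.IH) simp
    then show ?case
      using one_paramD(1)[OF assms(1), of "t / 2" "t / 2"] one_paramD(1)[OF assms(2), of "t / 2" "t / 2"]
      by simp
  qed (use e in simp)
  obtain n where "\<bar>t\<bar> / e < 2 ^ n" using real_arch_pow[of 2 "\<bar>t\<bar> / e"] by auto
  then have "\<bar>t\<bar> < 2 ^ n * e" using e(1) by (simp add: field_simps)
  then show "\<gamma> t = \<beta> t" by (rule dbl)
qed

text \<open>Uniqueness makes the description in \<open>lie_exp\<close> denote the subgroup with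
  rescaled time, which is then evaluated at 1.\<close>

lemma lie_exp_eq:
  assumes "one_param_subgroup G x \<gamma>"
  shows "lie_exp G (t *\<^sub>R x) = \<gamma> t"
proof -
  have "one_param_subgroup G (t *\<^sub>R x) (\<lambda>s. \<gamma> (t * s))" by (rule one_param_scale[OF assms])
  then have "(THE \<gamma>. one_param_subgroup G (t *\<^sub>R x) \<gamma>) = (\<lambda>s. \<gamma> (t * s))"
    using one_param_unique by blast
  then show ?thesis by (simp add: lie_exp_def)
qed

lemma lie_exp_0: "lie_exp G 0 = \<one>"
  using lie_exp_eq[OF one_param_zero, of 1] by simp

text \<open>Where no one-parameter subgroup exists, \<open>lie_exp\<close> takes a fixed junk value, so its
  injectivity on the open set V leaves room for at most one such vector; but such vectors come
  in whole lines. This replaces the usual appeal to the existence theorem for differential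
  equations.\<close>

lemma one_param_exists:
  assumes V: "log_branch G V"
  shows "\<exists>\<gamma>. one_param_subgroup G x \<gamma>"
proof -
  have oV: "open V" "0 \<in> V" "inj_on (lie_exp G) V" using V unfolding log_branch_def by auto
  have near: "\<exists>r. r > 0 \<and> r < 1 \<and> y + r *\<^sub>R z \<in> V" if "y \<in> V" for y z
  proof -
    have "((\<lambda>r. y + r *\<^sub>R z) \<longlongrightarrow> y + 0 *\<^sub>R z) (at_right 0)"
      by (intro tendsto_intros)
    then have "eventually (\<lambda>r. y + r *\<^sub>R z \<in> V) (at_right 0)"
      using that oV(1) by (auto simp: tendsto_def)
    then have "eventually (\<lambda>r. r > 0 \<and> r < 1 \<and> y + r *\<^sub>R z \<in> V) (at_right (0::real))"
      using eventually_at_right_real[OF zero_less_one]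
      by eventually_elim auto
    then show ?thesis using eventually_happens by fastforce
  qed
  have scale: "(\<exists>\<gamma>. one_param_subgroup G y \<gamma>) \<longleftrightarrow> (\<exists>\<gamma>. one_param_subgroup G (r *\<^sub>R y) \<gamma>)"
    if "r \<noteq> 0" for r y
  proof
    show "\<exists>\<gamma>. one_param_subgroup G (r *\<^sub>R y) \<gamma>" if "\<exists>\<gamma>. one_param_subgroup G y \<gamma>"
      using that one_param_scale by blast
    assume "\<exists>\<gamma>. one_param_subgroup G (r *\<^sub>R y) \<gamma>"
    then obtain \<gamma> where "one_param_subgroup G (r *\<^sub>R y) \<gamma>" ..
    from one_param_scale[OF this, of "1 / r"] show "\<exists>\<gamma>. one_param_subgroup G y \<gamma>"
      using that by auto
  qed
  have inV: "\<exists>\<gamma>. one_param_subgroup G y \<gamma>" if y: "y \<in> V" for y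
  proof (rule ccontr)
    assume bad: "\<not> (\<exists>\<gamma>. one_param_subgroup G y \<gamma>)"
    then have y0: "y \<noteq> 0" using one_param_zero by blast
    obtain r where r: "r > 0" "y + r *\<^sub>R y \<in> V" using near[OF y] by blast
    have yr: "y + r *\<^sub>R y = (1 + r) *\<^sub>R y" by (simp add: scaleR_add_left)
    have bad': "\<not> (\<exists>\<gamma>. one_param_subgroup G (y + r *\<^sub>R y) \<gamma>)"
      unfolding yr using bad scale[of "1 + r" y] r(1) by simp
    \<comment> \<open>Both predicates are constantly false, hence equal as functions, so the
      description operator returns the same value for \<open>y\<close> and
      \<open>y + r *\<^sub>R y\<close>.\<close>
    have "one_param_subgroup G y = one_param_subgroup G (y + r *\<^sub>R y)"
      using bad bad' by (intro ext) blast
    then have "lie_exp G y = lie_exp G (y + r *\<^sub>R y)" by (simp add: lie_exp_def)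
    then have "y = y + r *\<^sub>R y" using oV(3) y r(2) by (auto dest: inj_onD)
    then show False using y0 r(1) by simp
  qed
  obtain r where "r > 0" "0 + r *\<^sub>R x \<in> V" using near[OF oV(2)] by blast
  then show ?thesis using inV[of "r *\<^sub>R x"] scale[of r x] by simp
qed

end

section \<open>The integration map and its second differential\<close>

context lie_group
begin

lemma unit_germ_eventually: "unit_germ p f \<Longrightarrow> open W \<Longrightarrow> \<one> \<in> W \<Longrightarrow> eventually (\<lambda>x. f x \<in> W) (nhds p)"
proof -
  assume f: "unit_germ p f" and W: "open W" "\<one> \<in> W"
  have "eventually (\<lambda>a. psi a \<in> W) (nhds (phi (f p)))"
    using eventually_chart_inv(2)[OF unit_chart(3,2) eventually_nhds_in_open[OF W]] unit_germD(1)[OF f] by simp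
  from smooth_near_eventually_compose[OF unit_germD(2)[OF f] this] unit_germD(4)[OF f]
  show ?thesis by eventually_elim simp
qed

lemma conj_one [simp]: "conj_by G \<one> g = g" "conj_by G g \<one> = \<one>"
  by (simp_all add: conj_by_def)

text \<open>On the diagonal, the derivative in the second variable is the differential of left
  translation back to the unit: the left Maurer-Cartan form in the chart.\<close>

definition left_quot :: "'e \<times> 'e \<Rightarrow> 'e" where
  "left_quot = (\<lambda>p. phi (inv (psi (fst p)) \<otimes> psi (snd p)))"

text \<open>Its derivative in the second variable at \<open>(a, u)\<close> is the \<open>Ad\<close>
  of the inverse of \<open>psi a\<close>, as it occurs in \<open>hom_act\<close>.\<close>

definition conj_inv :: "'e \<times> 'e \<Rightarrow> 'e" where
  "conj_inv = (\<lambda>p. phi (conj_by G (inv (psi (fst p))) (psi (snd p))))"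

lemma unit_germ_psi_fst: "unit_germ (u, b) (\<lambda>p. psi (fst p))" and unit_germ_psi_snd: "unit_germ (a, u) (\<lambda>p. psi (snd p))"
  by (rule unit_germ_psi_compose; simp add: smooth_near_linear bounded_linear_fst bounded_linear_snd)+

lemma smooth_left_quot: "smooth_near (u, u) left_quot"
  unfolding left_quot_def by (intro unit_germD(2) unit_germ_mult(1) unit_germ_inv unit_germ_psi_fst unit_germ_psi_snd)

lemma smooth_conj_inv: "smooth_near (u, u) conj_inv"
  unfolding conj_inv_def by (intro unit_germD(2) unit_germ_conj unit_germ_inv unit_germ_psi_fst unit_germ_psi_snd)

lemma psi_u: "psi u = \<one>"
  by (rule unit_germD(1)[OF unit_germ_psi])

lemma D_left_quot: "D left_quot (u, u) (0, v) = v"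
proof -
  have "eventually (\<lambda>b. left_quot (u, b) = b) (nhds u)"
    using eventually_phi_psi by eventually_elim (simp add: left_quot_def psi_u)
  then have "D (\<lambda>b. left_quot (u, b)) u = D (\<lambda>b. b) u" by (rule D_cong)
  then show ?thesis using D_eq[OF has_derivative_slice2[OF smooth_left_quot]]
    by (metis D_eq has_derivative_ident)
qed

text \<open>\<open>Blinfun\<close> denotes the intended operator only when its argument is bounded
  linear; smoothness of \<open>conj_inv\<close> at \<open>(a, u)\<close> guarantees this.\<close>

lemma Ad_apply:
  assumes "smooth_near (a, u) conj_inv"
  shows "blinfun_apply (Ad G (inv (psi a))) y = D conj_inv (a, u) (0, y)"
proof -
  have d: "((\<lambda>b. conj_inv (a, b)) has_derivative (\<lambda>v. D conj_inv (a, u) (0, v))) (at u)"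
    by (rule has_derivative_slice2[OF assms])
  have "tangent_map (atlas G) (atlas G) (conj_by G (inv (psi a))) \<one> = D (\<lambda>b. conj_inv (a, b)) u"
    by (simp add: tangent_map_def o_def conj_inv_def flip: unit_chart_def)
  then show ?thesis
    unfolding Ad_def using D_eq[OF d] has_derivative_bounded_linear[OF d]
    by (simp add: bounded_linear_Blinfun_apply)
qed

lemma Ad_one: "Ad G \<one> = id_blinfun"
proof (rule blinfun_eqI)
  fix y
  have "eventually (\<lambda>b. conj_inv (u, b) = b) (nhds u)"
    using eventually_phi_psi by eventually_elim (simp add: conj_inv_def psi_u)
  then have "D (\<lambda>b. conj_inv (u, b)) u = D (\<lambda>b. b) u" by (rule D_cong)
  then have "D conj_inv (u, u) (0, y) = y" using D_eq[OF has_derivative_slice2[OF smooth_conj_inv]]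
    by (metis D_eq has_derivative_ident)
  then show "blinfun_apply (Ad G \<one>) y = blinfun_apply id_blinfun y"
    using Ad_apply[OF smooth_conj_inv, of y] by (simp add: psi_u)
qed

end

locale leibniz_integration = lie_group G
  for G :: "('g::{t2_space, second_countable_topology}, 'e::banach) lie_struct" (structure) +
  fixes \<rho> :: "'g \<Rightarrow> 'a::banach \<Rightarrow>\<^sub>L 'a" and V :: "'e set" and c :: "'g \<Rightarrow> real \<Rightarrow> 'g"
    and \<omega> :: "'e \<Rightarrow> 'e \<Rightarrow> 'a"
  assumes log_branch: "log_branch G V" and rep: "lie_rep G \<rho>" and path: "path_family G c"
    and bilin: "bilinear \<omega>"
begin

lemma rep_one: "\<rho> \<one> = id_blinfun"
  using rep by (simp add: lie_rep_def)

lemma smooth_rep: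
  assumes f: "unit_germ p f" and w: "smooth_near p w"
  shows "smooth_near p (\<lambda>x. blinfun_apply (\<rho> (f x)) (w x))"
proof -
  have fda: "fin_dim TYPE('a)" using rep by (simp add: lie_rep_def fin_dim_def)
  have v: "(UNIV, id) \<in> vec_atlas" by (simp add: vec_atlas_def)
  have sm: "smooth_map (prod_atlas (atlas G) vec_atlas) vec_atlas UNIV (\<lambda>(g, a). blinfun_apply (\<rho> g) a)"
    using rep by (simp add: lie_rep_def)
  have "smooth_near (u, w p) (\<lambda>(a, b). blinfun_apply (\<rho> (psi a)) b)"
    using smooth_map_prod_chart(1)[OF sm unit_chart(1,3,2) v is_chart_vec _ v is_chart_vec, of "w p"] by simp
  then have "smooth_near (phi (f p), w p) (\<lambda>(a, b). blinfun_apply (\<rho> (psi a)) b)"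
    using unit_germD(1)[OF f] by simp
  from smooth_near_compose[OF fin_dim_prod[OF fin_dim_model fda] smooth_near_Pair[OF unit_germD(2)[OF f] w] this]
  have "smooth_near p (\<lambda>x. blinfun_apply (\<rho> (psi (phi (f x)))) (w x))" by simp
  moreover have "eventually (\<lambda>x. blinfun_apply (\<rho> (f x)) (w x) = blinfun_apply (\<rho> (psi (phi (f x)))) (w x)) (nhds p)"
    using unit_germD(4)[OF f] by eventually_elim simp
  ultimately show ?thesis by (rule smooth_near_cong)
qed

lemma smooth_rep_blinfun: "unit_germ p f \<Longrightarrow> smooth_near p (\<lambda>x. \<rho> (f x))"
proof -
  have "fin_dim TYPE('a)" using rep by (simp add: lie_rep_def fin_dim_def)
  then show "unit_germ p f \<Longrightarrow> smooth_near p (\<lambda>x. \<rho> (f x))"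
    by (rule smooth_near_blinfunI) (rule smooth_rep[OF _ smooth_near_const])
qed

section \<open>Exponential and logarithm at the unit\<close>

lemma unit_germ_lie_exp: "unit_germ 0 (lie_exp G)"
proof -
  have "open V" "0 \<in> V" "smooth_map vec_atlas (atlas G) V (lie_exp G)"
    using log_branch unfolding log_branch_def by auto
  from smooth_map_vec_chart[OF this(3,2,1) unit_chart(1,3)] show ?thesis
    unfolding unit_germ_def using lie_exp_0 unit_chart(2) by simp
qed

lemma unit_germ_exp: "smooth_near p z \<Longrightarrow> z p = 0 \<Longrightarrow> unit_germ p (\<lambda>x. lie_exp G (z x))"
  using unit_germ_compose[OF fin_dim_model, of p z "lie_exp G"] unit_germ_lie_exp by simp

lemma log_exp: "x \<in> V \<Longrightarrow> lie_log G V (lie_exp G x) = x"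
  using log_branch unfolding log_branch_def lie_log_def by (auto intro: the_inv_into_f_f)

lemma log_one: "lie_log G V \<one> = 0"
  using log_exp[of 0] lie_exp_0 log_branch unfolding log_branch_def by simp

lemma smooth_log: "smooth_near u (\<lambda>a. lie_log G V (psi a))"
proof -
  have V: "open (lie_exp G ` V)" "0 \<in> V" "smooth_map (atlas G) vec_atlas (lie_exp G ` V) (lie_log G V)"
    using log_branch unfolding log_branch_def by auto
  have v: "(UNIV, id) \<in> vec_atlas" by (simp add: vec_atlas_def)
  have "\<one> \<in> lie_exp G ` V" using lie_exp_0 V(2) by (metis imageI)
  from smooth_map_chart_open(1)[OF V(3) this V(1) unit_chart(1,3,2) v is_chart_vec]
  show ?thesis by simp
qed

text \<open>On the line through \<open>x\<close> the exponential is the one-parameter subgroup with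
  velocity \<open>x\<close> at time 0.\<close>

lemma D_exp: "D (\<lambda>x. phi (lie_exp G x)) 0 x = x"
proof -
  obtain \<gamma> where \<gamma>: "one_param_subgroup G x \<gamma>" using one_param_exists[OF log_branch] by blast
  have lin: "bounded_linear (\<lambda>t::real. t *\<^sub>R x)" by (rule bounded_linear_scaleR_left)
  have "smooth_near (0 *\<^sub>R x) (\<lambda>x. phi (lie_exp G x))" using unit_germD(2)[OF unit_germ_lie_exp] by simp
  from D_compose[OF smooth_near_linear[OF lin] this]
  have "D (\<lambda>t. phi (lie_exp G (t *\<^sub>R x))) 0 1 = D (\<lambda>x. phi (lie_exp G x)) 0 x"
    by (simp add: D_eq[OF bounded_linear_imp_has_derivative[OF lin]])
  then show ?thesis using lie_exp_eq[OF \<gamma>] one_paramD(4)[OF \<gamma>] by simp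
qed

lemma D_log: "D (\<lambda>a. lie_log G V (psi a)) u x = x"
proof -
  have "open V" "0 \<in> V" using log_branch unfolding log_branch_def by auto
  from eventually_nhds_in_open[OF this] unit_germD(4)[OF unit_germ_lie_exp]
  have "eventually (\<lambda>x. lie_log G V (psi (phi (lie_exp G x))) = x) (nhds 0)"
    by eventually_elim (simp add: log_exp)
  then have *: "D (\<lambda>x. lie_log G V (psi (phi (lie_exp G x)))) 0 = D (\<lambda>x. x) 0" by (rule D_cong)
  have "smooth_near (phi (lie_exp G 0)) (\<lambda>a. lie_log G V (psi a))"
    using smooth_log lie_exp_0 by simp
  from D_compose[OF unit_germD(2)[OF unit_germ_lie_exp] this, of x]
  show ?thesis unfolding * by (simp add: D_exp lie_exp_0 D_eq)
qed

text \<open>By the functional equation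
  \<open>inv (\<gamma> t) \<otimes> \<gamma> s = \<gamma> (s - t)\<close>, so translating back
  always shows the subgroup near time 0. Whatever \<open>k\<close> is, \<open>lie_log G V k\<close>
  is some vector and the path is the subgroup belonging to it.\<close>

lemma tangent_velocity_exp_path:
  assumes t: "t \<in> {0..1}"
  shows "tangent_map (atlas G) (atlas G) (\<lambda>q. inv (exp_path G V k t) \<otimes> q) (exp_path G V k t)
    (velocity (atlas G) (exp_path G V k) t) = lie_log G V k"
proof -
  obtain \<gamma> where \<gamma>: "one_param_subgroup G (lie_log G V k) \<gamma>"
    using one_param_exists[OF log_branch] by blast
  note g = one_paramD[OF \<gamma>]
  have e: "exp_path G V k = \<gamma>" unfolding exp_path_def using lie_exp_eq[OF \<gamma>] by auto
  have "((\<lambda>s. phi (\<gamma> s)) has_derivative (\<lambda>r. r *\<^sub>R lie_log G V k)) (at (t - t))"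
  proof -
    have "linear (D (\<lambda>s. phi (\<gamma> s)) 0)"
      by (intro bounded_linear.linear bounded_linear_D smooth_near_differentiable unit_germD(2) g(3))
    from linear_scale[OF this, of _ 1]
    have "D (\<lambda>s. phi (\<gamma> s)) 0 = (\<lambda>r. r *\<^sub>R lie_log G V k)" by (intro ext) (simp add: g(4))
    then show ?thesis using smooth_near_has_derivative[OF unit_germD(2)[OF g(3)]] by simp
  qed
  then have "((\<lambda>s. phi (\<gamma> (s - t))) has_derivative (\<lambda>r. r *\<^sub>R lie_log G V k)) (at t within {0..1})"
    by (rule has_derivative_compose[where f = "\<lambda>s. s - t" and g = "\<lambda>s. phi (\<gamma> s)", rotated])
      (auto intro!: derivative_eq_intros)
  moreover have "inv (\<gamma> t) \<otimes> \<gamma> s = \<gamma> (s - t)" for s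
    using g(1)[of "- t" s] g(6) by simp
  ultimately have "((\<lambda>s. phi (inv (\<gamma> t) \<otimes> \<gamma> s)) has_vector_derivative lie_log G V k) (at t within {0..1})"
    unfolding has_vector_derivative_def by simp
  then show ?thesis
    unfolding e using g(5)[of t] t
    by (intro tangent_velocity) (auto simp: isCont_def intro: tendsto_within_subset)
qed

lemma I2_eq:
  "I2 G \<rho> c V \<omega> (g, h) =
    int01 (\<lambda>s. blinfun_apply (\<rho> (lie_exp G (s *\<^sub>R lie_log G V (conj_by G g h))))
      (blinfun_apply (I1 G \<rho> c \<omega> g) (lie_log G V (conj_by G g h))))"
  unfolding I2_def path_integral_def case_prod_conv
  by (intro integral_cong) (simp only: equiv_form_def tangent_velocity_exp_path, simp only: exp_path_def)

section \<open>The paths and the integrated form in the unit chart\<close>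

definition cchart :: "'e \<times> real \<Rightarrow> 'e" where
  "cchart = (\<lambda>q. phi (c (psi (fst q)) (snd q)))"

text \<open>The derivative is taken within [0,1], in accordance with \<open>velocity\<close> at the
  end points.\<close>

definition cdot :: "'e \<times> real \<Rightarrow> 'e" where
  "cdot = (\<lambda>q. vderiv01 (\<lambda>s. cchart (fst q, s)) (snd q))"

text \<open>The family is constant over the unit, so all points \<open>(u, t)\<close> of the segment
  are sent to the unit and the single unit chart serves at every time.\<close>

lemma cchart_ext:
  assumes t: "t \<in> {0..1}"
  shows "smooth_ext (u, t) cchart"
    and "eventually (\<lambda>q. snd q \<in> {0..1} \<longrightarrow> c (psi (fst q)) (snd q) \<in> dom1) (nhds (u, t))"
proof -
  obtain W where W: "open W" "\<one> \<in> W"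
    "smooth_map (prod_atlas (atlas G) vec_atlas) (atlas G) (W \<times> {0..1}) (\<lambda>(g, t). c g t)"
    and c1: "\<forall>t\<in>{0..1}. c \<one> t = \<one>"
    using path unfolding path_family_def by blast
  let ?v = "(UNIV :: real set, id :: real \<Rightarrow> real)"
  let ?\<kappa> = "(dom1 \<times> fst ?v, map_prod phi (snd ?v))"
  have \<kappa>: "?\<kappa> \<in> prod_atlas (atlas G) vec_atlas"
    unfolding prod_atlas_def vec_atlas_def using unit_chart(1) by blast
  have ch: "is_chart ?\<kappa>" by (rule is_chart_prod[OF unit_chart(3) is_chart_vec])
  have p: "(\<one>, t) \<in> W \<times> {0..1}" "(\<one>, t) \<in> fst ?\<kappa>" "(case (\<one>, t) of (g, t) \<Rightarrow> c g t) \<in> dom1"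
    using W(2) t c1 unit_chart(2) by auto
  obtain F where F: "smooth_near (snd ?\<kappa> (\<one>, t)) F" and ev: "eventually (\<lambda>a. chart_inv ?\<kappa> a \<in> W \<times> {0..1} \<longrightarrow>
     (case chart_inv ?\<kappa> a of (g, t) \<Rightarrow> c g t) \<in> dom1 \<and>
     phi (case chart_inv ?\<kappa> a of (g, t) \<Rightarrow> c g t) = F a) (nhds (snd ?\<kappa> (\<one>, t)))"
    by (rule smooth_map_chart[OF W(3) p(1) \<kappa> ch p(2) unit_chart(1,3) p(3)])
  have pt: "snd ?\<kappa> (\<one>, t) = (u, t)" by simp
  have "eventually (\<lambda>a. psi a \<in> W \<and> a \<in> phi ` dom1) (nhds u)"
    using unit_germ_eventually[OF unit_germ_psi W(1,2)] eventually_chart_inv(1)[OF unit_chart(3,2)]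
    by eventually_elim simp
  then have "eventually (\<lambda>q. psi (fst q) \<in> W \<and> fst q \<in> phi ` dom1) (nhds (u, t))"
    by (intro smooth_near_eventually_compose[of _ fst]) (auto intro: smooth_near_linear bounded_linear_fst)
  with ev[unfolded pt] have *: "eventually (\<lambda>q. snd q \<in> {0..1} \<longrightarrow>
      c (psi (fst q)) (snd q) \<in> dom1 \<and> cchart q = F q) (nhds (u, t))"
  proof eventually_elim
    case (elim q)
    have "chart_inv ?\<kappa> (fst q, snd q) = (psi (fst q), chart_inv ?v (snd q))"
      using elim by (intro chart_inv_prod[OF unit_chart(3) is_chart_vec]) auto
    then have "chart_inv ?\<kappa> q = (psi (fst q), snd q)" by simp
    then show ?case using elim unfolding cchart_def by simp
  qed
  have "eventually (\<lambda>q. snd q \<in> {0..1} \<longrightarrow> cchart q = F q) (nhds (u, t))"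
    using * by eventually_elim blast
  then show "smooth_ext (u, t) cchart" using F unfolding smooth_ext_def pt by blast
  show "eventually (\<lambda>q. snd q \<in> {0..1} \<longrightarrow> c (psi (fst q)) (snd q) \<in> dom1) (nhds (u, t))"
    using * by eventually_elim blast
qed

lemma cdot_ext: "smooth_ext (a, t) cchart \<Longrightarrow> smooth_ext (a, t) cdot"
  unfolding cdot_def by (rule smooth_ext_dt)

lemma cchart_u: "t \<in> {0..1} \<Longrightarrow> cchart (u, t) = u"
  using path unfolding path_family_def cchart_def by (simp add: psi_u)

lemma cdot_u:
  assumes t: "t \<in> {0..1}"
  shows "cdot (u, t) = 0"
proof -
  have "((\<lambda>s. cchart (u, s)) has_vector_derivative 0) (at t within {0..1})"
    by (rule has_vector_derivative_transform_within[OF has_vector_derivative_const zero_less_one t])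
      (simp add: cchart_u)
  then show ?thesis unfolding cdot_def using vderiv01_eq t by simp
qed

text \<open>The equivariant form of \<open>tau2 \<omega>\<close> at the point \<open>psi a\<close>,
  applied to a vector given in the coordinates of the unit chart; \<open>D left_quot\<close>
  translates that vector back to the unit.\<close>

definition I1_form :: "'e \<times> 'e \<Rightarrow> 'e \<Rightarrow>\<^sub>L 'a" where
  "I1_form = (\<lambda>p. hom_act G \<rho> (psi (fst p)) (tau2 \<omega> (D left_quot (fst p, fst p) (0, snd p))))"

lemma bilin_bounded: "bounded_bilinear \<omega>"
  by (rule fin_dim_bilinear_bounded[OF fin_dim_model fin_dim_model bilin])

lemma tau2_apply [simp]: "blinfun_apply (tau2 \<omega> x) y = \<omega> x y"
  unfolding tau2_def
  by (simp add: bounded_linear_Blinfun_apply bounded_bilinear.bounded_linear_right[OF bilin_bounded])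

lemma bounded_linear_tau2: "bounded_linear (tau2 \<omega>)"
proof (rule fin_dim_linear_bounded[OF fin_dim_model linearI])
  show "tau2 \<omega> (x + y) = tau2 \<omega> x + tau2 \<omega> y" for x y
    by (rule blinfun_eqI) (simp add: blinfun.add_left bilinear_ladd[OF bilin])
  show "tau2 \<omega> (r *\<^sub>R x) = r *\<^sub>R tau2 \<omega> x" for r x
    by (rule blinfun_eqI) (simp add: blinfun.scaleR_left bilinear_lmul[OF bilin])
qed

lemma smooth_left_quot_diag: "eventually (\<lambda>a. smooth_near (a, a) left_quot) (nhds u)"
  by (rule smooth_near_eventually_compose[OF smooth_near_Pair[OF smooth_near_ident smooth_near_ident]
        smooth_near_eventually[OF smooth_left_quot]])

text \<open>Tested on vectors \<open>y\<close>. Near \<open>u\<close> the operator \<open>Ad\<close>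
  is a partial derivative of \<open>conj_inv\<close>, after which all ingredients are the
  representation, \<open>\<omega>\<close>, and derivatives at smoothly moving points.\<close>

lemma smooth_I1_form: "smooth_near (u, v) I1_form"
proof (rule smooth_near_blinfunI[OF fin_dim_model])
  fix y
  have f: "smooth_near (u, v) fst" and s: "smooth_near (u, v) snd"
    by (simp_all add: smooth_near_linear bounded_linear_fst bounded_linear_snd)
  have "eventually (\<lambda>a. smooth_near (a, u) conj_inv) (nhds u)"
    by (rule eventually_nhds_Pair1[OF smooth_near_eventually[OF smooth_conj_inv]])
  then have ev: "eventually (\<lambda>p. smooth_near (fst p, u) conj_inv) (nhds (u, v))"
    by (intro smooth_near_eventually_compose[OF f]) simp
  have "smooth_near (u, v) (\<lambda>p. blinfun_apply (\<rho> (psi (fst p)))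
      (\<omega> (D left_quot (fst p, fst p) (0, snd p)) (D conj_inv (fst p, u) (0, y))))"
  proof (intro smooth_rep unit_germ_psi_fst smooth_near_bilinear[OF bilin_bounded])
    show "smooth_near (u, v) (\<lambda>p. D left_quot (fst p, fst p) (0, snd p))"
      by (rule smooth_near_D_apply[OF fin_dim_prod[OF fin_dim_model fin_dim_model] smooth_near_Pair[OF f f] _
            smooth_near_Pair[OF smooth_near_const s]]) (simp add: smooth_left_quot)
    show "smooth_near (u, v) (\<lambda>p. D conj_inv (fst p, u) (0, y))"
      by (rule smooth_near_D_apply[OF fin_dim_prod[OF fin_dim_model fin_dim_model] smooth_near_Pair[OF f smooth_near_const] _
            smooth_near_const]) (simp add: smooth_conj_inv)
  qed
  then show "smooth_near (u, v) (\<lambda>p. blinfun_apply (I1_form p) y)"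
    by (rule smooth_near_cong) (use ev in eventually_elim, simp add: I1_form_def hom_act_def Ad_apply)
qed

lemma I1_form_u: "I1_form (u, v) = tau2 \<omega> v"
  by (rule blinfun_eqI) (simp add: I1_form_def hom_act_def psi_u rep_one Ad_one D_left_quot)

text \<open>At every base point near \<open>u\<close> the form vanishes on the zero vector, and at
  \<open>u\<close> it is the linear map \<open>tau2 \<omega>\<close>; so the motion of the base
  point contributes nothing.\<close>

lemma D_I1_form: "D I1_form (u, 0) (v, w) = tau2 \<omega> w"
proof -
  have lin: "linear (D I1_form (u, 0))"
    by (intro bounded_linear.linear bounded_linear_D smooth_near_differentiable smooth_I1_form)
  have "eventually (\<lambda>a. I1_form (a, 0) = 0) (nhds u)"
    using smooth_left_quot_diag
  proof eventually_elim
    case (elim a)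
    have "D left_quot (a, a) (0, 0) = 0"
      using linear_0[OF bounded_linear.linear[OF bounded_linear_D[OF smooth_near_differentiable[OF elim]]]]
      by (simp add: zero_prod_def)
    then show ?case
      by (intro blinfun_eqI) (simp add: I1_form_def hom_act_def bilinear_lzero[OF bilin] blinfun.zero_right)
  qed
  then have "D (\<lambda>a. I1_form (a, 0)) u = D (\<lambda>a. 0) u" by (rule D_cong)
  then have "D I1_form (u, 0) (v, 0) = 0"
    using D_eq[OF has_derivative_slice1[OF smooth_I1_form]] by (metis frechet_derivative_const)
  moreover have "D I1_form (u, 0) (0, w) = tau2 \<omega> w"
  proof -
    have "((\<lambda>b. I1_form (u, b)) has_derivative tau2 \<omega>) (at 0)"
      unfolding I1_form_u by (rule bounded_linear_imp_has_derivative[OF bounded_linear_tau2])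
    then show ?thesis
      using D_eq[OF has_derivative_slice2[OF smooth_I1_form]] by (metis D_eq)
  qed
  ultimately show ?thesis using linear_add[OF lin, of "(v, 0)" "(0, w)"] by simp
qed

text \<open>Compactness of the time interval yields a neighbourhood of \<open>u\<close> over which
  whole paths lie in the unit chart. There \<open>tangent_velocity\<close> evaluates the integrand,
  although the chart used by \<open>velocity\<close> changes along the path.\<close>

lemma I1_chart:
  "eventually (\<lambda>a. I1 G \<rho> c \<omega> (psi a) = int01 (\<lambda>t. I1_form (cchart (a, t), cdot (a, t)))) (nhds u)"
proof -
  let ?P = "\<lambda>q. smooth_ext q cchart \<and> (snd q \<in> {0..1} \<longrightarrow> c (psi (fst q)) (snd q) \<in> dom1 \<and> smooth_near (cchart q, cchart q) left_quot)"
  have "eventually (\<lambda>a. \<forall>t\<in>{0..1}. ?P (a, t)) (nhds u)"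
  proof (rule eventually_nhds_uniform01)
    fix t :: real assume t: "t \<in> {0..1}"
    have "eventually (\<lambda>q. snd q \<in> {0..1} \<longrightarrow> smooth_near (cchart q, cchart q) left_quot) (nhds (u, t))"
      using smooth_left_quot_diag t
      by (intro smooth_ext_eventually_compose[where P = "\<lambda>b. smooth_near (b, b) left_quot"] cchart_ext(1)) (auto simp: cchart_u)
    with smooth_ext_eventually[OF cchart_ext(1)[OF t]] cchart_ext(2)[OF t]
    show "eventually ?P (nhds (u, t))" by eventually_elim blast
  qed
  then show ?thesis
  proof eventually_elim
    case (elim a)
    have ext: "smooth_ext (a, t) cchart" and dom: "c (psi a) t \<in> dom1" and M: "smooth_near (cchart (a, t), cchart (a, t)) left_quot"
      if "t \<in> {0..1}" for t
      using elim that by auto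
    have psi_cchart: "psi (cchart (a, t)) = c (psi a) t" if "t \<in> {0..1}" for t
      using dom[OF that] unit_chartD(5) by (simp add: cchart_def)
    show ?case
      unfolding I1_def path_integral_def
    proof (rule integral_cong)
      fix t :: real assume t: "t \<in> {0..1}"
      let ?w = "D left_quot (cchart (a, t), cchart (a, t)) (0, cdot (a, t))"
      \<comment> \<open>With time \<open>t\<close> frozen in the first slot this is the path
        translated back by its own value at \<open>t\<close>; its derivative at \<open>s = t\<close>
        is what \<open>tangent_velocity\<close> asks for.\<close>
      have "((\<lambda>s. left_quot (cchart (a, t), cchart (a, s))) has_derivative
          (\<lambda>r. D left_quot (cchart (a, t), cchart (a, t)) (0, r *\<^sub>R cdot (a, t)))) (at t within {0..1})"
        using smooth_ext_has_vector_derivative[OF ext[OF t] t]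
        unfolding has_vector_derivative_def cdot_def fst_conv snd_conv
        by (rule has_derivative_compose[where g = "\<lambda>b. left_quot (cchart (a, t), b)"
              and g' = "\<lambda>v. D left_quot (cchart (a, t), cchart (a, t)) (0, v)"]) (rule has_derivative_slice2[OF M[OF t]])
      moreover have "D left_quot (cchart (a, t), cchart (a, t)) (0, r *\<^sub>R cdot (a, t)) = r *\<^sub>R ?w" for r
        using linear_scale[OF bounded_linear.linear[OF bounded_linear_D[OF smooth_near_differentiable[OF M[OF t]]]], of r "(0, cdot (a, t))"]
        by simp
      ultimately have "((\<lambda>s. left_quot (cchart (a, t), cchart (a, s))) has_vector_derivative ?w) (at t within {0..1})"
        unfolding has_vector_derivative_def by (simp only:)
      then have "((\<lambda>s. phi (inv (c (psi a) t) \<otimes> c (psi a) s)) has_vector_derivative ?w) (at t within {0..1})"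
        by (rule has_vector_derivative_transform_within[OF _ zero_less_one t]) (simp add: left_quot_def psi_cchart psi_cchart[OF t])
      moreover have "smooth_map vec_atlas (atlas G) {0..1} (c (psi a))"
        using path unfolding path_family_def by blast
      ultimately have "tangent_map (atlas G) (atlas G) (\<lambda>q. inv (c (psi a) t) \<otimes> q) (c (psi a) t)
          (velocity (atlas G) (c (psi a)) t) = ?w"
        by (intro tangent_velocity[OF t] smooth_map_continuous_within[OF _ t])
      then show "equiv_form G (hom_act G \<rho>) (tau2 \<omega>) (c (psi a) t) (velocity (atlas G) (c (psi a)) t)
          = I1_form (cchart (a, t), cdot (a, t))"
        unfolding equiv_form_def I1_form_def by (simp add: psi_cchart[OF t])
    qed
  qed
qed

text \<open>Over \<open>u\<close> the arguments are \<open>(u, 0)\<close> at all times, so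
  smoothness of the form at this one point is enough.\<close>

lemma I1_form_ext:
  assumes t: "t \<in> {0..1}"
  shows "smooth_ext (u, t) (\<lambda>q. I1_form (cchart q, cdot q))"
  using smooth_ext_compose[OF fin_dim_prod[OF fin_dim_model fin_dim_model] smooth_ext_Pair[OF cchart_ext(1)[OF t] cdot_ext[OF cchart_ext(1)[OF t]]],
      of I1_form] t smooth_I1_form[of 0]
  by (simp add: cchart_u cdot_u)

lemma smooth_I1: "smooth_near u (\<lambda>a. I1 G \<rho> c \<omega> (psi a))"
  using smooth_near_int01(1)[OF fin_dim_model I1_form_ext] I1_chart by (rule smooth_near_cong)

lemma I1_one: "I1 G \<rho> c \<omega> \<one> = 0"
proof -
  have "I1 G \<rho> c \<omega> (psi u) = int01 (\<lambda>t. I1_form (cchart (u, t), cdot (u, t)))"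
    by (rule eventually_nhds_x_imp_x[OF I1_chart])
  also have "\<dots> = int01 (\<lambda>t. 0)"
    by (intro integral_cong) (simp add: cchart_u cdot_u I1_form_u linear_0[OF bounded_linear.linear[OF bounded_linear_tau2]])
  finally show ?thesis by (simp add: psi_u)
qed

lemma D_I1: "D (\<lambda>a. I1 G \<rho> c \<omega> (psi a)) u x = tau2 \<omega> x"
proof -
  \<comment> \<open>\<open>\<xi> t\<close> is the variation of the velocity at time \<open>t\<close>
    when the end point moves in direction \<open>x\<close>. Differentiating the integral of the
    velocity, which equals \<open>a - u\<close>, shows that \<open>\<xi>\<close> integrates to
    \<open>x\<close>.\<close>
  define \<xi> where "\<xi> = (\<lambda>t. D (\<lambda>a. cdot (a, t)) u x)"
  have Cte: "smooth_ext (u, t) cdot" if "t \<in> {0..1}" for t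
    using cdot_ext[OF cchart_ext(1)[OF that]] .
  have "eventually (\<lambda>a. int01 (\<lambda>t. cdot (a, t)) = a - u) (nhds u)"
  proof -
    have "eventually (\<lambda>a. \<forall>t\<in>{0..1}. smooth_ext (a, t) cchart) (nhds u)"
      by (rule eventually_nhds_uniform01) (rule smooth_ext_eventually[OF cchart_ext(1)])
    then show ?thesis using eventually_phi_psi
    proof eventually_elim
      case (elim a)
      have "((\<lambda>t. cdot (a, t)) has_integral cchart (a, 1) - cchart (a, 0)) {0..1}"
        using elim(1) smooth_ext_has_vector_derivative[of a _ cchart]
        by (intro fundamental_theorem_of_calculus) (auto simp: cdot_def)
      moreover have "cchart (a, 1) = a" "cchart (a, 0) = u"
        using path elim(2) unfolding path_family_def cchart_def by auto
      ultimately show ?case by (simp add: integral_unique)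
    qed
  qed
  then have "D (\<lambda>a. int01 (\<lambda>t. cdot (a, t))) u = D (\<lambda>a. a - u) u" by (rule D_cong)
  also have "\<dots> = (\<lambda>v. v)" by (rule D_eq) (auto intro!: derivative_eq_intros)
  finally have int\<xi>: "int01 \<xi> = x"
    using smooth_near_int01(2)[OF fin_dim_model Cte, of x] unfolding \<xi>_def by simp
  \<comment> \<open>Integrability allows the bounded linear map \<open>tau2 \<omega>\<close> to be
    pulled out of the integral.\<close>
  have "\<xi> integrable_on {0..1}"
    unfolding \<xi>_def using smooth_ext_integrable[of u "\<lambda>q. D (\<lambda>a. cdot (a, snd q)) (fst q) x"]
      smooth_ext_D1[OF Cte] by simp
  from integral_linear[OF this bounded_linear_tau2]
  have tau: "int01 (\<lambda>t. tau2 \<omega> (\<xi> t)) = tau2 \<omega> x" by (simp add: o_def int\<xi>)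
  have "D (\<lambda>a. I1 G \<rho> c \<omega> (psi a)) u x = D (\<lambda>a. int01 (\<lambda>t. I1_form (cchart (a, t), cdot (a, t)))) u x"
    using D_cong[OF I1_chart] by simp
  also have "\<dots> = int01 (\<lambda>t. D (\<lambda>a. I1_form (cchart (a, t), cdot (a, t))) u x)"
    using smooth_near_int01(2)[OF fin_dim_model I1_form_ext, of x] by simp
  also have "\<dots> = int01 (\<lambda>t. tau2 \<omega> (\<xi> t))"
  proof (rule integral_cong)
    fix t :: real assume t: "t \<in> {0..1}"
    have sC: "smooth_near u (\<lambda>a. cchart (a, t))" and sCt: "smooth_near u (\<lambda>a. cdot (a, t))"
      using smooth_ext_smooth_near_slice[OF fin_dim_model _ t] cchart_ext(1)[OF t] Cte[OF t] by auto
    have k: "smooth_near u (\<lambda>a. (cchart (a, t), cdot (a, t)))" by (rule smooth_near_Pair[OF sC sCt])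
    have "D (\<lambda>a. (cchart (a, t), cdot (a, t))) u x = (D (\<lambda>a. cchart (a, t)) u x, \<xi> t)"
      using D_eq[OF has_derivative_Pair[OF smooth_near_has_derivative[OF sC] smooth_near_has_derivative[OF sCt]]]
      unfolding \<xi>_def by simp
    moreover have "smooth_near (cchart (u, t), cdot (u, t)) I1_form" using t by (simp add: cchart_u cdot_u smooth_I1_form)
    from D_compose[OF k this, of x]
    have "D (\<lambda>a. I1_form (cchart (a, t), cdot (a, t))) u x = D I1_form (u, 0) (D (\<lambda>a. (cchart (a, t), cdot (a, t))) u x)"
      using t by (simp add: cchart_u cdot_u)
    ultimately show "D (\<lambda>a. I1_form (cchart (a, t), cdot (a, t))) u x = tau2 \<omega> (\<xi> t)" by (simp add: D_I1_form)
  qed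
  finally show ?thesis using tau by simp
qed

section \<open>The second differential of \<open>I2\<close>\<close>

definition log_conj :: "'e \<times> 'e \<Rightarrow> 'e" where
  "log_conj = (\<lambda>p. lie_log G V (conj_by G (psi (fst p)) (psi (snd p))))"

definition I2_chart :: "'e \<times> 'e \<Rightarrow> 'a" where
  "I2_chart = (\<lambda>p. I2 G \<rho> c V \<omega> (psi (fst p), psi (snd p)))"

definition rep_exp :: "('e \<times> 'e) \<times> real \<Rightarrow> 'a \<Rightarrow>\<^sub>L 'a" where
  "rep_exp = (\<lambda>r. \<rho> (lie_exp G (snd r *\<^sub>R log_conj (fst r))))"

text \<open>This factor carries both zeros on which the computation rests: the logarithm vanishes
  for h = 1, and \<open>I1\<close> vanishes for g = 1.\<close>

definition I1_log :: "'e \<times> 'e \<Rightarrow> 'a" where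
  "I1_log = (\<lambda>p. blinfun_apply (I1 G \<rho> c \<omega> (psi (fst p))) (log_conj p))"

lemma unit_germ_conj_psi: "unit_germ (u, u) (\<lambda>p. conj_by G (psi (fst p)) (psi (snd p)))"
  by (intro unit_germ_conj unit_germ_psi_fst unit_germ_psi_snd)

lemma smooth_log_conj: "smooth_near (u, u) log_conj"
proof -
  let ?k = "\<lambda>p. conj_by G (psi (fst p)) (psi (snd p))"
  note k = unit_germD[OF unit_germ_conj_psi]
  have "smooth_near (u, u) (\<lambda>p. lie_log G V (psi (phi (?k p))))"
    using smooth_near_compose[OF fin_dim_model k(2), of "\<lambda>a. lie_log G V (psi a)"] smooth_log k(1) by simp
  then show ?thesis
    by (rule smooth_near_cong) (use k(4) in eventually_elim, simp add: log_conj_def)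
qed

lemma log_conj_u: "log_conj (a, u) = 0"
  by (simp add: log_conj_def psi_u log_one)

lemma D_log_conj: "D log_conj (u, u) (0, y) = y"
proof -
  have "(\<lambda>b. log_conj (u, b)) = (\<lambda>b. lie_log G V (psi b))" by (simp add: log_conj_def psi_u)
  then show ?thesis using D_eq[OF has_derivative_slice2[OF smooth_log_conj]] D_log by metis
qed

lemma I2_chart_eq: "I2_chart p = int01 (\<lambda>s. blinfun_apply (rep_exp (p, s)) (I1_log p))"
  unfolding I2_chart_def I2_eq rep_exp_def I1_log_def log_conj_def by simp

text \<open>At \<open>(u, u)\<close> the logarithm is 0, so its multiple by any \<open>s\<close> is
  0 and smoothness of the exponential at 0 suffices for all \<open>s\<close>.\<close>

lemma smooth_rep_exp: "smooth_near ((u, u), s) rep_exp"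
  unfolding rep_exp_def
proof (intro smooth_rep_blinfun unit_germ_exp smooth_near_bilinear[OF bounded_bilinear_scaleR])
  show "smooth_near ((u, u), s) (\<lambda>r. log_conj (fst r))"
    using smooth_near_compose[OF fin_dim_prod[OF fin_dim_model fin_dim_model], of "((u, u), s)" fst log_conj] smooth_log_conj
    by (simp add: smooth_near_linear bounded_linear_fst)
qed (simp_all add: log_conj_u smooth_near_linear bounded_linear_snd)

lemma smooth_I1_log: "smooth_near (u, u) I1_log"
  unfolding I1_log_def
proof (intro smooth_near_bilinear[OF bounded_bilinear_blinfun_apply] smooth_log_conj)
  show "smooth_near (u, u) (\<lambda>p. I1 G \<rho> c \<omega> (psi (fst p)))"
    using smooth_near_compose[OF fin_dim_model, of "(u, u)" fst "\<lambda>a. I1 G \<rho> c \<omega> (psi a)"] smooth_I1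
    by (simp add: smooth_near_linear bounded_linear_fst)
qed

lemma smooth_integrand:
  "smooth_near ((a, b), s) rep_exp \<Longrightarrow> smooth_near (a, b) I1_log \<Longrightarrow>
   smooth_near ((a, b), s) (\<lambda>r. blinfun_apply (rep_exp r) (I1_log (fst r)))"
  using smooth_near_bilinear[OF bounded_bilinear_blinfun_apply, of "((a, b), s)" rep_exp "\<lambda>r. I1_log (fst r)"]
    smooth_near_compose[OF fin_dim_prod[OF fin_dim_model fin_dim_model], of "((a, b), s)" fst I1_log]
  by (simp add: smooth_near_linear bounded_linear_fst)

lemma smooth_I2_chart: "smooth_near (u, u) I2_chart"
proof -
  have "smooth_near (u, u) (\<lambda>p. int01 (\<lambda>s. blinfun_apply (rep_exp (p, s)) (I1_log (fst (p, s)))))"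
    by (rule smooth_near_int01(1)[OF fin_dim_prod[OF fin_dim_model fin_dim_model]])
      (intro smooth_near_imp_ext smooth_integrand smooth_rep_exp smooth_I1_log)
  then show ?thesis using I2_chart_eq by (simp add: smooth_near_cong)
qed

text \<open>Stated for all \<open>a\<close> near \<open>u\<close> because it is to be differentiated
  in \<open>a\<close>. At \<open>(a, u)\<close> the factor \<open>I1_log\<close> vanishes, so the
  derivative of \<open>rep_exp\<close> does not contribute; and \<open>rep_exp\<close> is the
  identity there, so the remaining integrand is independent of \<open>s\<close>.\<close>

lemma D_I2_chart:
  "eventually (\<lambda>a. D I2_chart (a, u) (0, y) = blinfun_apply (I1 G \<rho> c \<omega> (psi a)) (D log_conj (a, u) (0, y))) (nhds u)"
proof -
  \<comment> \<open>Differentiation under the integral is needed at each \<open>(a, u)\<close> and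
    not only at \<open>(u, u)\<close>, hence a neighbourhood uniform in \<open>s\<close>.\<close>
  have "eventually (\<lambda>p. \<forall>s\<in>{0..1}. smooth_near (p, s) rep_exp) (nhds (u, u))"
    by (rule eventually_nhds_uniform01[where P = "\<lambda>r. smooth_near r rep_exp"]) (rule smooth_near_eventually[OF smooth_rep_exp])
  with smooth_near_eventually[OF smooth_I1_log] smooth_near_eventually[OF smooth_log_conj]
  have "eventually (\<lambda>p. (\<forall>s\<in>{0..1}. smooth_near (p, s) rep_exp) \<and> smooth_near p I1_log \<and> smooth_near p log_conj) (nhds (u, u))"
    by eventually_elim blast
  from eventually_nhds_Pair1[OF this] smooth_near_eventually[OF smooth_I1]
  show ?thesis
  proof eventually_elim
    case (elim a)
    let ?\<alpha> = "\<lambda>a. I1 G \<rho> c \<omega> (psi a)"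
    have W0: "I1_log (a, u) = 0" by (simp add: I1_log_def log_conj_u blinfun.zero_right)
    have "smooth_near (a, u) (\<lambda>p. ?\<alpha> (fst p))"
      using smooth_near_compose[OF fin_dim_model, of "(a, u)" fst ?\<alpha>] elim(2)
      by (simp add: smooth_near_linear bounded_linear_fst)
    then have DW: "D I1_log (a, u) (0, y) = blinfun_apply (?\<alpha> a) (D log_conj (a, u) (0, y))"
      unfolding I1_log_def
      using D_bilinear_vanishing(1)[OF bounded_bilinear_blinfun_apply, of "\<lambda>p. ?\<alpha> (fst p)" "(a, u)" log_conj "(0, y)"] elim(1)
      by (simp add: smooth_near_differentiable log_conj_u)
    have ext: "smooth_ext ((a, u), s) (\<lambda>r. blinfun_apply (rep_exp r) (I1_log (fst r)))" if "s \<in> {0..1}" for s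
      using elim(1) that by (intro smooth_near_imp_ext smooth_integrand) auto
    have "D I2_chart (a, u) (0, y) = int01 (\<lambda>s. D (\<lambda>p. blinfun_apply (rep_exp (p, s)) (I1_log p)) (a, u) (0, y))"
      using smooth_near_int01(2)[OF fin_dim_prod[OF fin_dim_model fin_dim_model] ext, of "(0, y)"]
      unfolding I2_chart_eq[abs_def] by simp
    also have "\<dots> = int01 (\<lambda>s. D I1_log (a, u) (0, y))"
    proof (rule integral_cong)
      fix s :: real assume s: "s \<in> {0..1}"
      have "smooth_near (a, u) (\<lambda>p. rep_exp (p, s))"
        using smooth_ext_smooth_near_slice[OF fin_dim_prod[OF fin_dim_model fin_dim_model] smooth_near_imp_ext s, of "(a, u)" rep_exp] elim(1) s
        by blast
      then have "D (\<lambda>p. blinfun_apply (rep_exp (p, s)) (I1_log p)) (a, u) (0, y) = blinfun_apply (rep_exp ((a, u), s)) (D I1_log (a, u) (0, y))"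
        using elim(1) W0
        by (intro D_bilinear_vanishing(1)[OF bounded_bilinear_blinfun_apply]) (auto intro: smooth_near_differentiable)
      then show "D (\<lambda>p. blinfun_apply (rep_exp (p, s)) (I1_log p)) (a, u) (0, y) = D I1_log (a, u) (0, y)"
        by (simp add: rep_exp_def log_conj_u lie_exp_0 rep_one)
    qed
    finally show ?case by (simp add: DW)
  qed
qed

text \<open>The direction \<open>(0, y)\<close> belongs to the inner derivative, so differentiation
  in the second group variable comes first; the outer derivative in direction \<open>(x, 0)\<close>
  then sees only the slice of points \<open>(a, u)\<close>.\<close>

lemma delta2_I2: "delta2 G (I2 G \<rho> c V \<omega>) x y = \<omega> x y"
proof -
  let ?\<alpha> = "\<lambda>a. I1 G \<rho> c \<omega> (psi a)"
  have "I2 G \<rho> c V \<omega> \<circ> map_prod psi psi = I2_chart"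
    by (auto simp: I2_chart_def)
  then have "delta2 G (I2 G \<rho> c V \<omega>) x y = D (\<lambda>q. D I2_chart q (0, y)) (u, u) (x, 0)"
    unfolding delta2_def second_differential_def Let_def by (simp flip: unit_chart_def)
  also have "\<dots> = D (\<lambda>a. D I2_chart (a, u) (0, y)) u x"
    using D_eq[OF has_derivative_slice1[OF smooth_near_D[OF smooth_I2_chart, of "(0, y)"]]] by simp
  also have "\<dots> = D (\<lambda>a. blinfun_apply (?\<alpha> a) (D log_conj (a, u) (0, y))) u x"
    using D_cong[OF D_I2_chart] by simp
  \<comment> \<open>Since \<open>I1\<close> vanishes at the unit, the dependence of
    \<open>D log_conj (a, u) (0, y)\<close> on \<open>a\<close>, which stems from the conjugation,
    drops out.\<close>
  also have "\<dots> = blinfun_apply (D ?\<alpha> u x) (D log_conj (u, u) (0, y))"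
  proof (rule D_bilinear_vanishing(2)[OF bounded_bilinear_blinfun_apply])
    show "?\<alpha> differentiable at u" by (rule smooth_near_differentiable[OF smooth_I1])
    have "smooth_near u (\<lambda>a. D log_conj (a, u) (0, y))"
      by (rule smooth_near_D_apply[OF fin_dim_prod[OF fin_dim_model fin_dim_model] smooth_near_Pair[OF smooth_near_ident smooth_near_const]
            smooth_log_conj smooth_near_const])
    then show "(\<lambda>a. D log_conj (a, u) (0, y)) differentiable at u" by (rule smooth_near_differentiable)
    show "?\<alpha> u = 0" by (simp add: psi_u I1_one)
  qed
  also have "\<dots> = \<omega> x y" by (simp add: D_I1 D_log_conj)
  finally show ?thesis .
qed

section \<open>Membership in the local cochains\<close>

lemma smooth_transition:
  assumes "\<kappa> \<in> atlas G" "g \<in> fst \<kappa>" "g \<in> dom1"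
  shows "smooth_near (snd \<kappa> g) (\<lambda>a. phi (chart_inv \<kappa> a))"
proof -
  have \<kappa>: "is_chart \<kappa>" using atlas assms(1) unfolding smooth_atlas_def by blast
  have "smooth_on (snd \<kappa> ` (fst \<kappa> \<inter> dom1)) (phi \<circ> chart_inv \<kappa>)"
    using atlas assms(1) unit_chart(1) unfolding smooth_atlas_def by blast
  moreover have "open (snd \<kappa> ` (fst \<kappa> \<inter> dom1))"
    using is_chartD(1)[OF \<kappa>] unit_chartD(1) by (intro open_chart_image[OF \<kappa>]) auto
  ultimately show ?thesis
    using assms smooth_on_imp_near[of _ "phi \<circ> chart_inv \<kappa>" "snd \<kappa> g"] by (auto simp: o_def)
qed

lemma I2_phi: "g \<in> dom1 \<Longrightarrow> h \<in> dom1 \<Longrightarrow> I2 G \<rho> c V \<omega> (g, h) = I2_chart (phi g, phi h)"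
  by (simp add: I2_chart_def unit_chartD(5))

text \<open>\<open>smooth_map\<close> tests against all charts of the product atlas, whereas
  smoothness is known in the unit chart. Transition maps lead from one to the other, and they are
  available because \<open>W\<close> lies in \<open>dom1 \<times> dom1\<close>.\<close>

lemma smooth_map_I2:
  assumes W: "open W" "W \<subseteq> dom1 \<times> dom1" and F: "\<And>g h. (g, h) \<in> W \<Longrightarrow> smooth_near (phi g, phi h) I2_chart"
  shows "smooth_map (prod_atlas (atlas G) (atlas G)) vec_atlas W (I2 G \<rho> c V \<omega>)"
proof -
  let ?f = "I2 G \<rho> c V \<omega>"
  have cont: "continuous_on W ?f"
  proof (rule continuous_on_eq)
    have ph: "continuous_on W (\<lambda>p. (phi (fst p), phi (snd p)))"
      using W(2) by (intro continuous_on_Pair continuous_on_compose2[OF unit_chartD(3)] continuous_intros) auto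
    show "continuous_on W (\<lambda>p. I2_chart (phi (fst p), phi (snd p)))"
    proof (rule continuous_on_compose2[OF _ ph subset_refl])
      show "continuous_on ((\<lambda>p. (phi (fst p), phi (snd p))) ` W) I2_chart"
        using F by (auto intro!: continuous_at_imp_continuous_on smooth_near_isCont)
    qed
    show "I2_chart (phi (fst p), phi (snd p)) = ?f p" if "p \<in> W" for p
      using I2_phi[of "fst p" "snd p"] that W(2) by auto
  qed
  have "smooth_on (snd \<kappa> ` {p \<in> W \<inter> fst \<kappa>. ?f p \<in> fst \<mu>}) (snd \<mu> \<circ> ?f \<circ> chart_inv \<kappa>)"
    if \<kappa>\<mu>: "\<kappa> \<in> prod_atlas (atlas G) (atlas G)" "\<mu> \<in> vec_atlas" for \<kappa> :: "('g \<times> 'g, 'e \<times> 'e) chart" and \<mu> :: "('a, 'a) chart"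
  proof (rule smooth_near_imp_on)
    obtain \<kappa>1 \<kappa>2 where \<kappa>: "\<kappa> = (fst \<kappa>1 \<times> fst \<kappa>2, map_prod (snd \<kappa>1) (snd \<kappa>2))"
      and at: "\<kappa>1 \<in> atlas G" "\<kappa>2 \<in> atlas G"
      using \<kappa>\<mu>(1) unfolding prod_atlas_def by blast
    have ch: "is_chart \<kappa>1" "is_chart \<kappa>2" using atlas at unfolding smooth_atlas_def by blast+
    have \<mu>: "\<mu> = (UNIV, id)" using \<kappa>\<mu>(2) by (simp add: vec_atlas_def)
    fix q assume "q \<in> snd \<kappa> ` {p \<in> W \<inter> fst \<kappa>. ?f p \<in> fst \<mu>}"
    then obtain g h where gh: "(g, h) \<in> W" "g \<in> fst \<kappa>1" "h \<in> fst \<kappa>2" and q: "q = (snd \<kappa>1 g, snd \<kappa>2 h)"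
      unfolding \<kappa> by auto
    have d1: "g \<in> dom1" "h \<in> dom1" using gh W(2) by auto
    have f: "smooth_near q fst" "smooth_near q snd"
      by (simp_all add: smooth_near_linear bounded_linear_fst bounded_linear_snd)
    have t1: "smooth_near q (\<lambda>p. phi (chart_inv \<kappa>1 (fst p)))" "smooth_near q (\<lambda>p. phi (chart_inv \<kappa>2 (snd p)))"
      using smooth_near_compose[OF fin_dim_model f(1), of "\<lambda>a. phi (chart_inv \<kappa>1 a)"]
        smooth_near_compose[OF fin_dim_model f(2), of "\<lambda>a. phi (chart_inv \<kappa>2 a)"]
        smooth_transition[OF at(1) gh(2) d1(1)] smooth_transition[OF at(2) gh(3) d1(2)] q by simp_all
    have e: "chart_inv \<kappa>1 (fst q) = g" "chart_inv \<kappa>2 (snd q) = h"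
      using is_chartD(5)[OF ch(1)] is_chartD(5)[OF ch(2)] gh q by auto
    have "smooth_near (phi (chart_inv \<kappa>1 (fst q)), phi (chart_inv \<kappa>2 (snd q))) I2_chart"
      unfolding e by (rule F[OF gh(1)])
    from smooth_near_compose[OF fin_dim_prod[OF fin_dim_model fin_dim_model] smooth_near_Pair[OF t1] this]
    have s: "smooth_near q (\<lambda>p. I2_chart (phi (chart_inv \<kappa>1 (fst p)), phi (chart_inv \<kappa>2 (snd p))))" .
    have "(g, h) \<in> fst \<kappa>" "snd \<kappa> (g, h) = q" using gh q by (auto simp: \<kappa>)
    moreover have "is_chart \<kappa>" unfolding \<kappa> by (rule is_chart_prod[OF ch])
    ultimately have ev1: "eventually (\<lambda>p. chart_inv \<kappa> p \<in> W) (nhds q)"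
      and ev2: "eventually (\<lambda>p. p \<in> snd \<kappa> ` fst \<kappa>) (nhds q)"
      using eventually_chart_inv[of \<kappa> "(g, h)"] eventually_nhds_in_open[OF W(1) gh(1)] by auto
    have "eventually (\<lambda>p. (snd \<mu> \<circ> ?f \<circ> chart_inv \<kappa>) p =
        I2_chart (phi (chart_inv \<kappa>1 (fst p)), phi (chart_inv \<kappa>2 (snd p)))) (nhds q)"
      using ev1 ev2
    proof eventually_elim
      case (elim p)
      have "chart_inv \<kappa> (fst p, snd p) = (chart_inv \<kappa>1 (fst p), chart_inv \<kappa>2 (snd p))"
        using elim(2) unfolding \<kappa> by (intro chart_inv_prod[OF ch]) auto
      then have i: "chart_inv \<kappa> p = (chart_inv \<kappa>1 (fst p), chart_inv \<kappa>2 (snd p))" by simp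
      then have "chart_inv \<kappa>1 (fst p) \<in> dom1" "chart_inv \<kappa>2 (snd p) \<in> dom1"
        using elim(1) W(2) by auto
      from I2_phi[OF this] show ?case by (simp add: i \<mu>)
    qed
    with s show "smooth_near q (snd \<mu> \<circ> ?f \<circ> chart_inv \<kappa>)" by (rule smooth_near_cong)
  qed
  then have "smooth_map_open (prod_atlas (atlas G) (atlas G)) vec_atlas W ?f"
    using W(1) cont unfolding smooth_map_open_def by blast
  then show ?thesis unfolding smooth_map_def by blast
qed

text \<open>A chart neighbourhood on which \<open>I2_chart\<close> is smooth and both membership
  conditions of \<open>U2loc\<close> hold is pulled back to the group. The vanishing conditions hold
  for all group elements: for h = 1 the conjugate is 1 and its logarithm is 0, and for g = 1 the
  form \<open>I1\<close> is 0.\<close>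

lemma I2_local_cochain:
  assumes U: "\<one> \<in> interior U"
  shows "I2 G \<rho> c V \<omega> \<in> local_cochains G U"
proof -
  let ?k = "\<lambda>p. conj_by G (psi (fst p)) (psi (snd p))"
  have "eventually (\<lambda>p. psi (snd p) \<in> interior U) (nhds (u, u))"
    by (rule unit_germ_eventually[OF unit_germ_psi_snd open_interior U])
  with smooth_near_eventually[OF smooth_I2_chart] unit_germ_eventually[OF unit_germ_conj_psi open_interior U]
  have "eventually (\<lambda>p. smooth_near p I2_chart \<and> ?k p \<in> U \<and> psi (snd p) \<in> U) (nhds (u, u))"
    by eventually_elim (use interior_subset in blast)
  then obtain N where N: "open N" "(u, u) \<in> N"
    "\<And>p. p \<in> N \<Longrightarrow> smooth_near p I2_chart \<and> ?k p \<in> U \<and> psi (snd p) \<in> U"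
    unfolding eventually_nhds by blast
  define W where "W = (dom1 \<times> dom1) \<inter> (\<lambda>p. (phi (fst p), phi (snd p))) -` N"
  have "open W"
    unfolding W_def
  proof (rule continuous_open_preimage[OF _ _ N(1)])
    show "continuous_on (dom1 \<times> dom1) (\<lambda>p. (phi (fst p), phi (snd p)))"
      by (intro continuous_on_Pair continuous_on_compose2[OF unit_chartD(3)] continuous_intros) auto
    show "open (dom1 \<times> dom1)" using unit_chartD(1) by (intro open_Times)
  qed
  moreover have "(\<one>, \<one>) \<in> W" using N(2) unit_chart(2) by (simp add: W_def)
  moreover have "W \<subseteq> U2loc G U"
  proof
    fix p assume "p \<in> W"
    then obtain g h where p: "p = (g, h)" "g \<in> dom1" "h \<in> dom1" "(phi g, phi h) \<in> N"
      by (auto simp: W_def)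
    from N(3)[OF p(4)] show "p \<in> U2loc G U"
      using p unit_chartD(5) by (simp add: U2loc_def)
  qed
  moreover have "smooth_map (prod_atlas (atlas G) (atlas G)) vec_atlas W (I2 G \<rho> c V \<omega>)"
    using \<open>open W\<close> N(3) by (intro smooth_map_I2) (auto simp: W_def)
  moreover have "I2 G \<rho> c V \<omega> (g, \<one>) = 0" "I2 G \<rho> c V \<omega> (\<one>, h) = 0" for g h
    unfolding I2_eq by (simp_all add: log_one I1_one blinfun.zero_right blinfun.zero_left)
  ultimately show ?thesis unfolding local_cochains_def by blast
qed

end

theorem proposition3p15:
  fixes G :: "('g::{t2_space, second_countable_topology}, 'e::banach) lie_struct"
    and \<rho> :: "'g \<Rightarrow> 'a::banach \<Rightarrow>\<^sub>L 'a"
    and U :: "'g set" and V :: "'e set"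
    and c :: "'g \<Rightarrow> real \<Rightarrow> 'g"
  assumes "lie_group G"
    and "simply_connected (UNIV :: 'g set)"
    and "log_branch G V"
    and "\<one>\<^bsub>G\<^esub> \<in> interior U" and "U \<subseteq> lie_exp G ` V"
    and "lie_rep G \<rho>"
    and "path_family G c"
  shows "\<forall>\<omega> \<in> ZL2 G \<rho>. I2 G \<rho> c V \<omega> \<in> local_cochains G U \<and> delta2 G (I2 G \<rho> c V \<omega>) = \<omega>"
proof
  fix \<omega> assume "\<omega> \<in> ZL2 G \<rho>"
  then have "bilinear \<omega>" by (simp add: ZL2_def)
  then interpret leibniz_integration G \<rho> V c \<omega>
    using assms by (intro leibniz_integration.intro leibniz_integration_axioms.intro)
  show "I2 G \<rho> c V \<omega> \<in> local_cochains G U \<and> delta2 G (I2 G \<rho> c V \<omega>) = \<omega>"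
    using I2_local_cochain[OF assms(4)] delta2_I2 by blast
qed

end
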